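(* Let $X$ and $Y$ be Banach spaces, and assume that either (i) there exists a coarse solvent map $X\to Y$, or (ii) there exists a uniformly continuous map $\varphi:B_X\to Y$ such that $\overline{\rho}_\varphi(t)>0$ for some $t\in(0,1)$. Then: (a) if $Y$ is reflexive, then $X$ is reflexive or $X$ has a spreading model equivalent to the $\ell_1$-basis; (b) if $Y$ is super-reflexive, then $X$ is super-reflexive or $X$ has trivial type.
   Context: All Banach spaces are over the reals; $B_X$ is the closed unit ball of $X$. Let $f:(M,d)\to(N,\partial)$ be a map between metric spaces. Set $\omega_f(t)=\sup\{\partial(f(x),f(y)): d(x,y)\le t\}$ and $\overline{\rho}_f(t)=\inf\{\partial(f(x),f(y)): d(x,y)=t\}$ for $t\ge 0$ (with $x,y\in M$ and $\inf\emptyset=+\infty$). The map $f$ is coarse if $\omega_f(t)<\infty$ for all $t\ge0$; solvent if for each $n\in\mathbb{N}$ there is $R>0$ such that for all $x,y\in M$, $d(x,y)\in[R,R+n]$ implies $\partial(f(x),f(y))>n$. A Banach space $X$ has type $p\in(1,2]$ if there is $T>0$ such that for all $n$ and all $x_1,\dots,x_n\in X$, $\mathbb{E}_\varepsilon\|\sum_{j}\varepsilon_jx_j\|^p\le T^p\sum_{j}\|x_j\|^p$, with expectation over uniformly chosen signs $\varepsilon\in\{-1,1\}^n$; $X$ has trivial type if it has type $p$ for no $p\in(1,2]$. $X$ is super-reflexive if every ultrapower of $X$ is reflexive. A sequence $(e_j)_j$ in a (semi)normed space is a spreading model of $X$ if it is generated by a bounded sequence $(x_n)_n$ in $X$, i.e.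 for all $k$ and all scalars $a_1,\dots,a_k$, $\|\sum_{j=1}^ka_je_j\|=\lim_{n_1<\dots<n_k,\ n_1\to\infty}\|\sum_{j=1}^ka_jx_{n_j}\|$; it is equivalent to the $\ell_1$-basis if there is $c>0$ with $\|\sum_{j=1}^k a_je_j\|\ge c\sum_{j=1}^k|a_j|$ for all $k$ and all scalars. *)

theory Defs
  imports "HOL-Probability.Probability" "HOL-Analysis.Finite_Function_Topology"
begin

section \<open>Coarse and solvent maps\<close>

text \<open>
  The moduli take values in \<open>[0,\<infinity>]\<close>; the domain metric space is a subset \<open>M\<close> of a type.
  In \<^typ>\<open>ennreal\<close> the infimum of the empty set is \<open>\<infinity>\<close> and the supremum of the empty set is \<open>0\<close>.
\<close>

definition expansion_modulus ::
  "'a::metric_space set \<Rightarrow> ('a \<Rightarrow> 'b::metric_space) \<Rightarrow> real \<Rightarrow> ennreal" where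
  "expansion_modulus M f t =
     (SUP (x, y) \<in> {(x, y). x \<in> M \<and> y \<in> M \<and> dist x y \<le> t}. ennreal (dist (f x) (f y)))"

definition exact_compression_modulus ::
  "'a::metric_space set \<Rightarrow> ('a \<Rightarrow> 'b::metric_space) \<Rightarrow> real \<Rightarrow> ennreal" where
  "exact_compression_modulus M f t =
     (INF (x, y) \<in> {(x, y). x \<in> M \<and> y \<in> M \<and> dist x y = t}. ennreal (dist (f x) (f y)))"

definition coarse_on :: "'a::metric_space set \<Rightarrow> ('a \<Rightarrow> 'b::metric_space) \<Rightarrow> bool" where
  "coarse_on M f \<longleftrightarrow> (\<forall>t\<ge>0. expansion_modulus M f t < \<infinity>)"

definition solvent_on :: "'a::metric_space set \<Rightarrow> ('a \<Rightarrow> 'b::metric_space) \<Rightarrow> bool" where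
  "solvent_on M f \<longleftrightarrow>
     (\<forall>n::nat. \<exists>R>0. \<forall>x\<in>M. \<forall>y\<in>M.
        dist x y \<in> {R..R + real n} \<longrightarrow> dist (f x) (f y) > real n)"


section \<open>Type of a Banach space\<close>

definition has_type :: "'a::real_normed_vector itself \<Rightarrow> real \<Rightarrow> bool" where
  "has_type X p \<longleftrightarrow>
     (\<exists>T>0. \<forall>(n::nat) (x :: nat \<Rightarrow> 'a).
        measure_pmf.expectation (pmf_of_set ({..<n} \<rightarrow>\<^sub>E {-1, 1 :: real}))
            (\<lambda>\<epsilon>. norm (\<Sum>j<n. \<epsilon> j *\<^sub>R x j) powr p)
          \<le> T powr p * (\<Sum>j<n. norm (x j) powr p))"

definition trivial_type :: "'a::real_normed_vector itself \<Rightarrow> bool" where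
  "trivial_type X \<longleftrightarrow> \<not> (\<exists>p. 1 < p \<and> p \<le> 2 \<and> has_type X p)"


section \<open>Spreading models\<close>

definition seminorm :: "('e::real_vector \<Rightarrow> real) \<Rightarrow> bool" where
  "seminorm N \<longleftrightarrow>
     (\<forall>v. 0 \<le> N v) \<and> (\<forall>c v. N (c *\<^sub>R v) = \<bar>c\<bar> * N v) \<and> (\<forall>v w. N (v + w) \<le> N v + N w)"

definition generates_spreading_model ::
  "(nat \<Rightarrow> 'a::real_normed_vector) \<Rightarrow> ('e::real_vector \<Rightarrow> real) \<Rightarrow> (nat \<Rightarrow> 'e) \<Rightarrow> bool" where
  "generates_spreading_model x N e \<longleftrightarrow>
     bounded (range x) \<and>
     (\<forall>(k::nat) (a :: nat \<Rightarrow> real). \<forall>\<delta>>0. \<exists>m. \<forall>n :: nat \<Rightarrow> nat.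
        strict_mono_on {..<k} n \<and> (\<forall>j<k. m \<le> n j) \<longrightarrow>
        \<bar>norm (\<Sum>j<k. a j *\<^sub>R x (n j)) - N (\<Sum>j<k. a j *\<^sub>R e j)\<bar> < \<delta>)"

definition equivalent_to_l1_basis :: "('e::real_vector \<Rightarrow> real) \<Rightarrow> (nat \<Rightarrow> 'e) \<Rightarrow> bool" where
  "equivalent_to_l1_basis N e \<longleftrightarrow>
     (\<exists>c>0. \<forall>(k::nat) (a :: nat \<Rightarrow> real). c * (\<Sum>j<k. \<bar>a j\<bar>) \<le> N (\<Sum>j<k. a j *\<^sub>R e j))"

text \<open>
  The seminormed space carrying the spreading model is \<^typ>\<open>nat \<Rightarrow>\<^sub>0 real\<close>, the finitely supported
  sequences \<open>c\<^sub>0\<^sub>0\<close>, with an arbitrary seminorm. This is no restriction: for a sequence \<open>e\<close> in any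
  seminormed space, the seminorm pulls back to \<open>c\<^sub>0\<^sub>0\<close> along the linear map sending the \<open>j\<close>-th unit
  vector to \<open>e j\<close>.
\<close>

definition has_l1_spreading_model :: "'a::real_normed_vector itself \<Rightarrow> bool" where
  "has_l1_spreading_model X \<longleftrightarrow>
     (\<exists>(x :: nat \<Rightarrow> 'a) (N :: (nat \<Rightarrow>\<^sub>0 real) \<Rightarrow> real) e.
        seminorm N \<and> generates_spreading_model x N e \<and> equivalent_to_l1_basis N e)"


section \<open>Reflexivity\<close>

text \<open>Surjectivity of the canonical embedding into the bidual.\<close>

definition reflexive :: "'a::real_normed_vector itself \<Rightarrow> bool" where
  "reflexive X \<longleftrightarrow>
     (\<forall>\<Phi> :: ('a \<Rightarrow>\<^sub>L real) \<Rightarrow>\<^sub>L real. \<exists>x :: 'a. \<forall>f. blinfun_apply \<Phi> f = blinfun_apply f x)"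

text \<open>
  An ultrapower depends on an ultrafilter and hence is not a type. So normed spaces are also needed
  in the form of explicit structures on a carrier set; their functionals are made unique by being
  \<^const>\<open>undefined\<close> outside the carrier.
\<close>

record 'v nspace =
  car :: "'v set"
  add :: "'v \<Rightarrow> 'v \<Rightarrow> 'v"
  smul :: "real \<Rightarrow> 'v \<Rightarrow> 'v"
  nrm :: "'v \<Rightarrow> real"

definition dual_nspace :: "'v nspace \<Rightarrow> ('v \<Rightarrow> real) nspace" where
  "dual_nspace V =
     \<lparr> car = {f \<in> extensional (car V).
               (\<forall>x\<in>car V. \<forall>y\<in>car V. f (add V x y) = f x + f y) \<and>
               (\<forall>c. \<forall>x\<in>car V. f (smul V c x) = c * f x) \<and>
               (\<exists>K. \<forall>x\<in>car V. \<bar>f x\<bar> \<le> K * nrm V x)},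
       add = (\<lambda>f g. \<lambda>x\<in>car V. f x + g x),
       smul = (\<lambda>c f. \<lambda>x\<in>car V. c * f x),
       nrm = (\<lambda>f. SUP x \<in> {x \<in> car V. nrm V x \<le> 1}. \<bar>f x\<bar>) \<rparr>"

definition reflexive_nspace :: "'v nspace \<Rightarrow> bool" where
  "reflexive_nspace V \<longleftrightarrow>
     (\<forall>\<Phi> \<in> car (dual_nspace (dual_nspace V)). \<exists>x \<in> car V. \<forall>f \<in> car (dual_nspace V). \<Phi> f = f x)"

definition nspace_of :: "'a::real_normed_vector itself \<Rightarrow> 'a nspace" where
  "nspace_of X = \<lparr> car = UNIV, add = (+), smul = (*\<^sub>R), nrm = norm \<rparr>"

lemma dual_nspace_of_car:
  "car (dual_nspace (nspace_of TYPE('a::real_normed_vector))) = range (blinfun_apply :: ('a \<Rightarrow>\<^sub>L real) \<Rightarrow> _)"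
proof -
  have "f \<in> range blinfun_apply" 
    if "f \<in> car (dual_nspace (nspace_of TYPE('a)))" for f :: "'a \<Rightarrow> real"
  proof -
    from that obtain K where "\<And>x y. f (x + y) = f x + f y" "\<And>c x. f (c *\<^sub>R x) = c * f x"
      "\<And>x. \<bar>f x\<bar> \<le> K * norm x"
      by (auto simp: dual_nspace_def nspace_of_def)
    then have "bounded_linear f"
      by (intro bounded_linear_intro[where K = K]) (simp_all add: mult.commute)
    then show ?thesis by (metis bounded_linear_Blinfun_apply rangeI)
  qed
  moreover have "blinfun_apply f \<in> car (dual_nspace (nspace_of TYPE('a)))" for f :: "'a \<Rightarrow>\<^sub>L real"
    using norm_blinfun[of f]
    by (auto simp: dual_nspace_def nspace_of_def blinfun.bilinear_simps intro!: exI[of _ "norm f"])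
  ultimately show ?thesis by auto
qed

lemma dual_nspace_of_nrm:
  "nrm (dual_nspace (nspace_of TYPE('a::real_normed_vector))) (blinfun_apply f) = norm f"
proof -
  let ?S = "(\<lambda>x. \<bar>blinfun_apply f x\<bar>) ` {x::'a. norm x \<le> 1}"
  have le: "\<bar>blinfun_apply f x\<bar> \<le> norm f" if "norm x \<le> 1" for x :: 'a
    using norm_blinfun[of f x] mult_left_mono[OF that, of "norm f"] by simp
  then have bdd: "bdd_above ?S" by (intro bdd_aboveI[of _ "norm f"]) auto
  have ge0: "0 \<le> Sup ?S"
    by (rule cSup_upper[OF _ bdd]) (rule image_eqI[of _ _ 0], auto)
  have "norm f \<le> Sup ?S"
  proof (rule norm_blinfun_bound[OF ge0])
    fix x :: 'a
    show "norm (blinfun_apply f x) \<le> Sup ?S * norm x"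
    proof (cases "x = 0")
      case False
      let ?y = "(1 / norm x) *\<^sub>R x"
      have "\<bar>blinfun_apply f ?y\<bar> \<le> Sup ?S"
        by (rule cSup_upper[OF _ bdd]) (use False in auto)
      then show ?thesis using False by (simp add: blinfun.bilinear_simps field_simps)
    qed simp
  qed
  moreover have "Sup ?S \<le> norm f"
  proof (rule cSup_least)
    have "blinfun_apply f 0 \<in> ?S" by (rule image_eqI[of _ _ 0]) auto
    then show "?S \<noteq> {}" by blast
  qed (use le in auto)
  ultimately show ?thesis by (simp add: dual_nspace_def nspace_of_def)
qed

lemma reflexive_nspace_of:
  "reflexive_nspace (nspace_of TYPE('a::real_normed_vector)) \<longleftrightarrow> reflexive TYPE('a)"
proof
  assume R: "reflexive_nspace (nspace_of TYPE('a))"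
  show "reflexive TYPE('a)"
    unfolding reflexive_def
  proof
    fix \<Phi> :: "('a \<Rightarrow>\<^sub>L real) \<Rightarrow>\<^sub>L real"
    let ?V = "dual_nspace (nspace_of TYPE('a))"
    let ?F = "\<lambda>f \<in> car ?V. blinfun_apply \<Phi> (Blinfun f)"
    have BA: "Blinfun (blinfun_apply g) = g" for g :: "'a \<Rightarrow>\<^sub>L real" 
      by (rule blinfun_apply_inverse)
    have ad: "add ?V (blinfun_apply f) (blinfun_apply g) = blinfun_apply (f + g)" for f g :: "'a \<Rightarrow>\<^sub>L real"
      by (auto simp: dual_nspace_def nspace_of_def blinfun.bilinear_simps)
    have sm: "smul ?V c (blinfun_apply f) = blinfun_apply (c *\<^sub>R f)" for c and f :: "'a \<Rightarrow>\<^sub>L real"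
      by (auto simp: dual_nspace_def nspace_of_def blinfun.bilinear_simps)
    have "?F \<in> car (dual_nspace ?V)"
      unfolding dual_nspace_def[of ?V]
      using norm_blinfun[of \<Phi>]
      by (auto simp: dual_nspace_of_car dual_nspace_of_nrm ad sm BA blinfun.add_right
          blinfun.scaleR_right intro!: exI[of _ "norm \<Phi>"])
    then obtain x where "\<forall>f \<in> car ?V. ?F f = f x"
      using R unfolding reflexive_nspace_def by blast
    then show "\<exists>x. \<forall>f. blinfun_apply \<Phi> f = blinfun_apply f x"
      by (auto simp: dual_nspace_of_car BA)
  qed
next
  assume R: "reflexive TYPE('a)"
  show "reflexive_nspace (nspace_of TYPE('a))"
    unfolding reflexive_nspace_def
  proof
    fix F
    let ?V = "dual_nspace (nspace_of TYPE('a))"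
    assume F: "F \<in> car (dual_nspace ?V)"
    have ad: "blinfun_apply (f + g) = add ?V (blinfun_apply f) (blinfun_apply g)" for f g :: "'a \<Rightarrow>\<^sub>L real"
      by (auto simp: dual_nspace_def nspace_of_def blinfun.bilinear_simps)
    have sm: "blinfun_apply (c *\<^sub>R f) = smul ?V c (blinfun_apply f)" for c and f :: "'a \<Rightarrow>\<^sub>L real"
      by (auto simp: dual_nspace_def nspace_of_def blinfun.bilinear_simps)
    from F obtain K where "\<forall>x\<in>car ?V. \<bar>F x\<bar> \<le> K * nrm ?V x"
      by (auto simp: dual_nspace_def[of ?V])
    then have K: "\<bar>F (blinfun_apply f)\<bar> \<le> norm f * K" for f :: "'a \<Rightarrow>\<^sub>L real"
      by (auto simp: dual_nspace_of_car dual_nspace_of_nrm mult.commute)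
    have "bounded_linear (\<lambda>f :: 'a \<Rightarrow>\<^sub>L real. F (blinfun_apply f))"
      using F K
      by (intro bounded_linear_intro[where K = K])
        (auto simp: dual_nspace_def[of ?V] dual_nspace_of_car ad sm)
    then obtain \<Phi> :: "('a \<Rightarrow>\<^sub>L real) \<Rightarrow>\<^sub>L real" where "\<And>f. blinfun_apply \<Phi> f = F (blinfun_apply f)"
      by (metis bounded_linear_Blinfun_apply)
    then show "\<exists>x\<in>car (nspace_of TYPE('a)). \<forall>f\<in>car ?V. F f = f x"
      using R unfolding reflexive_def dual_nspace_of_car
      by (simp add: nspace_of_def) metis
  qed
qed


section \<open>Ultrapowers and super-reflexivity\<close>

definition ultrafilter :: "'i filter \<Rightarrow> bool" where
  "ultrafilter U \<longleftrightarrow> U \<noteq> bot \<and> (\<forall>P. eventually P U \<or> eventually (\<lambda>i. \<not> P i) U)"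

definition ultrapower_rel :: "'i filter \<Rightarrow> (('i \<Rightarrow> 'a::real_normed_vector) \<times> ('i \<Rightarrow> 'a)) set" where
  "ultrapower_rel U =
     {(x, y). bounded (range x) \<and> bounded (range y) \<and> ((\<lambda>i. norm (x i - y i)) \<longlongrightarrow> 0) U}"

definition ultrapower :: "'a::real_normed_vector itself \<Rightarrow> 'i filter \<Rightarrow> ('i \<Rightarrow> 'a) set nspace" where
  "ultrapower X U =
     \<lparr> car = {x. bounded (range x)} // ultrapower_rel U,
       add = (\<lambda>A B. \<Union>x\<in>A. \<Union>y\<in>B. ultrapower_rel U `` {\<lambda>i. x i + y i}),
       smul = (\<lambda>c A. \<Union>x\<in>A. ultrapower_rel U `` {\<lambda>i. c *\<^sub>R x i}),
       nrm = (\<lambda>A. the_elem ((\<lambda>x. Lim U (\<lambda>i. norm (x i))) ` A)) \<rparr>"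

text \<open>
  A definition cannot quantify over all index types, so the index type is a parameter. Any
  ultrapower over an index set of cardinality at most that of \<^typ>\<open>'i\<close> is covered, since
  \<^term>\<open>U\<close> may concentrate on a subset. The space is super-reflexive if the predicate holds for all
  types \<^typ>\<open>'i\<close>.
\<close>

definition super_reflexive :: "'i itself \<Rightarrow> 'a::real_normed_vector itself \<Rightarrow> bool" where
  "super_reflexive I X \<longleftrightarrow> (\<forall>U :: 'i filter. ultrafilter U \<longrightarrow> reflexive_nspace (ultrapower X U))"

lemma equiv_ultrapower_rel:
  "equiv {x :: 'i \<Rightarrow> 'a::real_normed_vector. bounded (range x)} (ultrapower_rel U)"
proof (rule equivI)
  show "trans (ultrapower_rel U :: (('i \<Rightarrow> 'a) \<times> _) set)"
  proof (rule transI)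
    fix x y z :: "'i \<Rightarrow> 'a"
    assume xy: "(x, y) \<in> ultrapower_rel U" and yz: "(y, z) \<in> ultrapower_rel U"
    then have "((\<lambda>i. norm (x i - y i) + norm (y i - z i)) \<longlongrightarrow> 0) U"
      by (auto simp: ultrapower_rel_def intro: tendsto_add_zero)
    moreover have "norm (norm (x i - z i)) \<le> norm (x i - y i) + norm (y i - z i)" for i
      using norm_triangle_ineq[of "x i - y i" "y i - z i"] by simp
    ultimately have "((\<lambda>i. norm (x i - z i)) \<longlongrightarrow> 0) U"
      by (intro Lim_null_comparison[OF always_eventually, of "\<lambda>i. norm (x i - z i)"] allI)
    then show "(x, z) \<in> ultrapower_rel U" using xy yz by (auto simp: ultrapower_rel_def)
  qed
qed (auto simp: ultrapower_rel_def refl_on_def sym_def norm_minus_commute)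

lemma bounded_range_add:
  fixes x y :: "'i \<Rightarrow> 'a::real_normed_vector"
  assumes "bounded (range x)" "bounded (range y)"
  shows "bounded (range (\<lambda>i. x i + y i))"
  using bounded_plus_comp[OF assms] .

lemma bounded_range_scaleR:
  fixes x :: "'i \<Rightarrow> 'a::real_normed_vector"
  assumes "bounded (range x)"
  shows "bounded (range (\<lambda>i. c *\<^sub>R x i))"
  using bounded_scaleR_comp[OF assms] .

lemma ultrapower_add:
  fixes x y :: "'i \<Rightarrow> 'a::real_normed_vector"
  assumes x: "bounded (range x)" and y: "bounded (range y)"
  shows "add (ultrapower TYPE('a) U) (ultrapower_rel U `` {x}) (ultrapower_rel U `` {y})
           = ultrapower_rel U `` {\<lambda>i. x i + y i}"
proof -
  have "ultrapower_rel U `` {\<lambda>i. x' i + y' i} = ultrapower_rel U `` {\<lambda>i. x i + y i}"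
    if "(x, x') \<in> ultrapower_rel U" "(y, y') \<in> ultrapower_rel U" for x' y'
  proof (rule equiv_class_eq[OF equiv_ultrapower_rel, symmetric])
    have "((\<lambda>i. norm (x i - x' i) + norm (y i - y' i)) \<longlongrightarrow> 0) U"
      using that by (auto simp: ultrapower_rel_def intro: tendsto_add_zero)
    then have "((\<lambda>i. norm (x i + y i - (x' i + y' i))) \<longlongrightarrow> 0) U"
      by (rule Lim_null_comparison[rotated]) (simp add: norm_diff_triangle_ineq)
    then show "(\<lambda>i. x i + y i, \<lambda>i. x' i + y' i) \<in> ultrapower_rel U"
      using that by (auto simp: ultrapower_rel_def bounded_range_add)
  qed
  moreover have "x \<in> ultrapower_rel U `` {x}" "y \<in> ultrapower_rel U `` {y}"
    using x y by (auto simp: ultrapower_rel_def)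
  ultimately have "(\<Union>x'\<in>ultrapower_rel U `` {x}. \<Union>y'\<in>ultrapower_rel U `` {y}.
      ultrapower_rel U `` {\<lambda>i. x' i + y' i}) = ultrapower_rel U `` {\<lambda>i. x i + y i}"
    by blast
  then show ?thesis by (simp add: ultrapower_def)
qed

lemma ultrapower_smul:
  fixes x :: "'i \<Rightarrow> 'a::real_normed_vector"
  assumes x: "bounded (range x)"
  shows "smul (ultrapower TYPE('a) U) c (ultrapower_rel U `` {x}) = ultrapower_rel U `` {\<lambda>i. c *\<^sub>R x i}"
proof -
  have "ultrapower_rel U `` {\<lambda>i. c *\<^sub>R x' i} = ultrapower_rel U `` {\<lambda>i. c *\<^sub>R x i}"
    if "(x, x') \<in> ultrapower_rel U" for x'
  proof (rule equiv_class_eq[OF equiv_ultrapower_rel, symmetric])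
    have "((\<lambda>i. \<bar>c\<bar> * norm (x i - x' i)) \<longlongrightarrow> 0) U"
      using that by (auto simp: ultrapower_rel_def intro: tendsto_mult_right_zero)
    moreover have "norm (c *\<^sub>R x i - c *\<^sub>R x' i) = \<bar>c\<bar> * norm (x i - x' i)" for i
      by (metis norm_scaleR scaleR_diff_right)
    ultimately show "(\<lambda>i. c *\<^sub>R x i, \<lambda>i. c *\<^sub>R x' i) \<in> ultrapower_rel U"
      using that by (simp add: ultrapower_rel_def bounded_range_scaleR)
  qed
  moreover have "x \<in> ultrapower_rel U `` {x}" using x by (auto simp: ultrapower_rel_def)
  ultimately have "(\<Union>x'\<in>ultrapower_rel U `` {x}. ultrapower_rel U `` {\<lambda>i. c *\<^sub>R x' i})
      = ultrapower_rel U `` {\<lambda>i. c *\<^sub>R x i}"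
    by blast
  then show ?thesis by (simp add: ultrapower_def)
qed

lemma ultrafilter_bounded_tendsto:
  fixes f :: "'i \<Rightarrow> real"
  assumes U: "ultrafilter U" and f: "bounded (range f)"
  shows "(f \<longlongrightarrow> Lim U f) U"
proof -
  have nb: "U \<noteq> bot" using U by (simp add: ultrafilter_def)
  have "\<exists>l\<in>closure (range f). inf (nhds l) (filtermap f U) \<noteq> bot"
  proof -
    have "compact (closure (range f))" using f by simp
    moreover have "filtermap f U \<noteq> bot" using nb by (simp add: filtermap_bot_iff)
    moreover have "eventually (\<lambda>x. x \<in> closure (range f)) (filtermap f U)"
      by (auto simp: eventually_filtermap intro!: always_eventually closure_subset[THEN subsetD])
    ultimately show ?thesis unfolding compact_filter by blast
  qed
  then obtain l where l: "inf (nhds l) (filtermap f U) \<noteq> bot" by blast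
  have "(f \<longlongrightarrow> l) U"
  proof (rule topological_tendstoI, rule ccontr)
    fix S assume S: "open S" "l \<in> S" "\<not> (\<forall>\<^sub>F i in U. f i \<in> S)"
    then have "\<forall>\<^sub>F i in U. f i \<notin> S" using U by (auto simp: ultrafilter_def)
    moreover have "\<forall>\<^sub>F x in nhds l. x \<in> S" using S eventually_nhds by blast
    ultimately have "eventually (\<lambda>x. False) (inf (nhds l) (filtermap f U))"
      unfolding eventually_inf eventually_filtermap
      by (intro exI[of _ "\<lambda>x. x \<in> S"] exI[of _ "\<lambda>x. x \<notin> S"]) auto
    then show False using l by (simp add: trivial_limit_def)
  qed
  with nb show ?thesis by (metis tendsto_Lim)
qed

lemma ultrapower_nrm:
  fixes x :: "'i \<Rightarrow> 'a::real_normed_vector"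
  assumes U: "ultrafilter U" and x: "bounded (range x)"
  shows "nrm (ultrapower TYPE('a) U) (ultrapower_rel U `` {x}) = Lim U (\<lambda>i. norm (x i))"
proof -
  have nb: "U \<noteq> bot" using U by (simp add: ultrafilter_def)
  have *: "((\<lambda>i. norm (x i)) \<longlongrightarrow> Lim U (\<lambda>i. norm (x i))) U"
    using x by (intro ultrafilter_bounded_tendsto U) (auto simp: bounded_iff)
  have eq: "Lim U (\<lambda>i. norm (x' i)) = Lim U (\<lambda>i. norm (x i))"
    if "x' \<in> ultrapower_rel U `` {x}" for x'
  proof -
    have "((\<lambda>i. norm (x' i) - norm (x i)) \<longlongrightarrow> 0) U"
      by (rule Lim_null_comparison[of _ "\<lambda>i. norm (x i - x' i)"])
        (use that in \<open>auto simp: ultrapower_rel_def norm_minus_commute[of "x _"] norm_triangle_ineq3\<close>)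
    from tendsto_add[OF this *] show ?thesis by (intro tendsto_Lim nb) simp
  qed
  have "x \<in> ultrapower_rel U `` {x}" using x by (auto simp: ultrapower_rel_def)
  then have "(\<lambda>x. Lim U (\<lambda>i. norm (x i))) ` (ultrapower_rel U `` {x}) = {Lim U (\<lambda>i. norm (x i))}"
    using eq by blast
  then show ?thesis by (simp add: ultrapower_def)
qed

end

theory Submission
  imports Defs
begin

text \<open>
  Suppose that \<open>X\<close> is not reflexive. Some functional on the dual of \<open>X\<close> then has norm at most \<open>1\<close> and
  distance more than \<open>\<tau>\<close> from \<open>X\<close>, where \<open>\<tau> < 1\<close> is given in advance, and by Goldstine's theorem it
  is the weak* limit, along an ultrafilter, of a family \<open>x\<close> in the unit ball. Iterated limits of
  \<open>\<parallel>\<Sum> a\<^sub>j x\<^sub>j\<parallel>\<close> along the ultrafilter define a spreading model. Let \<open>\<sigma>\<close> and \<open>\<rho>\<close> be successive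
  \<open>k\<close>-tuples of indices. The distance between the sums of \<open>x\<close> over \<open>\<sigma>\<close> and over \<open>\<rho>\<close> is at least
  \<open>k \<tau>\<close> in the limit (\<open>far_functional_difference\<close>). If \<open>\<sigma>\<close> and \<open>\<rho>\<close> are interlaced instead, the
  difference of the two sums is an alternating sum of \<open>2 k\<close> terms. There are two cases.

  If the alternating sums grow linearly in \<open>k\<close>, then the differences of consecutive members of the
  spreading model are equivalent to the \<open>\<ell>\<^sub>1\<close>-basis, because they form an unconditional spreading
  sequence (\<open>u_lower_bound\<close>). A diagonal choice of indices turns the iterated limits into limits
  over actual sequences (\<open>sequence_approx\<close>).

  Otherwise, for a suitable \<open>k\<close>, rescaled sums over interlaced tuples are arbitrarily close to each
  other, whereas sums over successive tuples have a distance close to any prescribed value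
  \<open>t < \<tau>\<close>, and all of them lie in the unit ball. A map \<open>\<phi>\<close> to a reflexive space \<open>Y\<close> has Kalton's
  property Q (\<open>reflexive_property_Q\<close>): if the images of interlaced tuples are within \<open>\<omega>\<close> of each other,
  then most images lie in a ball of radius hardly more than \<open>\<omega>\<close>, so that the images of successive
  tuples are at distance less than \<open>3 \<omega>\<close>. This is impossible if \<open>\<phi>\<close> moves points at distance about
  \<open>t\<close> at least \<open>3 \<omega>\<close> apart, but points at a very small distance at most \<open>\<omega>\<close>. Both a coarse solvent
  map and a uniformly continuous map as in the theorem yield, after rescaling, such a map on the
  unit ball (\<open>ball_separating\<close>). This gives (a).

  For (b), let an ultrapower of \<open>X\<close> be non-reflexive. The map \<open>\<phi>\<close> acts coordinatewise between the
  ultrapowers of \<open>X\<close> and \<open>Y\<close> with the same ultrafilter, so the ultrapower of \<open>X\<close> has an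
  \<open>\<ell>\<^sub>1\<close>-spreading model, and \<open>X\<close> contains, for every \<open>k\<close>, vectors \<open>x\<^sub>1, \<dots>, x\<^sub>k\<close> of bounded norm such
  that all signed sums of them have norm at least a fixed multiple of \<open>k\<close>. This is incompatible with
  type greater than \<open>1\<close>.

  The ultrapower depends on a filter and is therefore not a type. To treat (a) and (b) at once, the
  argument is carried out for a seminorm \<open>p\<close> on a type. In the case of an ultrapower, the type
  consists of all bounded families, and \<open>p\<close> is the limit of the norms along the ultrafilter. The
  prefix \<open>semi\<close> marks notions that refer to a seminorm.
\<close>

section \<open>Norming functionals\<close>

definition sublinear :: "('v::real_vector \<Rightarrow> real) \<Rightarrow> bool" where
  "sublinear q \<longleftrightarrow> (\<forall>c x. 0 \<le> c \<longrightarrow> q (c *\<^sub>R x) = c * q x) \<and> (\<forall>x y. q (x + y) \<le> q x + q y)"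

text \<open>
  Lowering \<open>q\<close> as far as possible in the direction of \<open>v\<close>: the new functional is the infimum over
  \<open>t \<ge> 0\<close> of \<open>q (x + t v) - t q v\<close>. Applied to a minimal \<open>q\<close> this forces linearity; applied to a
  seminorm it makes every linear functional below the result norming at \<open>v\<close>.
\<close>
lemma sublinear_lowered:
  fixes q :: "'v::real_vector \<Rightarrow> real"
  assumes q: "sublinear q"
  obtains r where "sublinear r" "\<And>x. r x \<le> q x" "r (- v) \<le> - q v"
proof -
  have hom: "q (c *\<^sub>R x) = c * q x" if "0 \<le> c" for c x
    using q that by (simp add: sublinear_def)
  have sub: "q (x + y) \<le> q x + q y" for x y
    using q by (simp add: sublinear_def)
  have q0: "q 0 = 0" using hom[of 0 0] by simp
  define A where "A x = (\<lambda>t. q (x + t *\<^sub>R v) - t * q v) ` {0..}" for x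
  define r where "r x = Inf (A x)" for x
  have lb: "- q (- x) \<le> q (x + t *\<^sub>R v) - t * q v" if "0 \<le> t" for x t
    using sub[of "x + t *\<^sub>R v" "- x"] hom[OF that, of v] by simp
  have bdd: "bdd_below (A x)" for x
    by (rule bdd_belowI[of _ "- q (- x)"]) (auto simp: A_def lb)
  have ne: "A x \<noteq> {}" for x by (auto simp: A_def)
  have le: "r x \<le> q (x + t *\<^sub>R v) - t * q v" if "0 \<le> t" for x t
    unfolding r_def by (rule cInf_lower[OF _ bdd]) (use that in \<open>auto simp: A_def\<close>)
  have ge: "B \<le> r x" if "\<And>t. 0 \<le> t \<Longrightarrow> B \<le> q (x + t *\<^sub>R v) - t * q v" for B x
    unfolding r_def by (rule cInf_greatest[OF ne]) (use that in \<open>auto simp: A_def\<close>)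
  have rsub: "r (x + y) \<le> r x + r y" for x y
  proof -
    have "r (x + y) - (q (y + t *\<^sub>R v) - t * q v) \<le> r x" if t: "0 \<le> t" for t
    proof (rule ge)
      fix s :: real assume "0 \<le> s"
      then have "r (x + y) \<le> q (x + y + (s + t) *\<^sub>R v) - (s + t) * q v" by (intro le) (use t in simp)
      also have "x + y + (s + t) *\<^sub>R v = (x + s *\<^sub>R v) + (y + t *\<^sub>R v)" by (simp add: algebra_simps)
      also have "q \<dots> - (s + t) * q v \<le> (q (x + s *\<^sub>R v) - s * q v) + (q (y + t *\<^sub>R v) - t * q v)"
        using sub[of "x + s *\<^sub>R v" "y + t *\<^sub>R v"] by (simp add: algebra_simps)
      finally show "r (x + y) - (q (y + t *\<^sub>R v) - t * q v) \<le> q (x + s *\<^sub>R v) - s * q v" by simp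
    qed
    then have "r (x + y) - r x \<le> r y" by (intro ge) (smt (verit))
    then show ?thesis by simp
  qed
  have rhom': "r (c *\<^sub>R x) \<le> c * r x" if c: "0 < c" for c x
  proof -
    have "r (c *\<^sub>R x) / c \<le> r x"
    proof (rule ge)
      fix t :: real assume t: "0 \<le> t"
      have "r (c *\<^sub>R x) \<le> q (c *\<^sub>R x + (c * t) *\<^sub>R v) - c * t * q v" by (rule le) (use c t in simp)
      also have "c *\<^sub>R x + (c * t) *\<^sub>R v = c *\<^sub>R (x + t *\<^sub>R v)" by (simp add: algebra_simps)
      also have "q \<dots> - c * t * q v = c * (q (x + t *\<^sub>R v) - t * q v)"
        using c hom[of c "x + t *\<^sub>R v"] by (simp add: right_diff_distrib)
      finally show "r (c *\<^sub>R x) / c \<le> q (x + t *\<^sub>R v) - t * q v" using c by (simp add: field_simps)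
    qed
    then show ?thesis using c by (simp add: field_simps)
  qed
  have r0: "r 0 = 0"
  proof (rule antisym)
    show "r 0 \<le> 0" using le[of 0 0] q0 by simp
    show "0 \<le> r 0" by (rule ge) (simp add: hom)
  qed
  have rhom: "r (c *\<^sub>R x) = c * r x" if "0 \<le> c" for c x
  proof (cases "c = 0")
    case False
    then have c: "0 < c" using that by simp
    have "r (inverse c *\<^sub>R (c *\<^sub>R x)) \<le> inverse c * r (c *\<^sub>R x)" by (rule rhom') (use c in simp)
    then have "c * r x \<le> r (c *\<^sub>R x)" using c by (simp add: field_simps)
    with rhom'[OF c] show ?thesis by (rule antisym)
  qed (simp add: r0)
  show thesis
  proof (rule that)
    show "sublinear r" using rhom rsub by (simp add: sublinear_def)
    show "r x \<le> q x" for x using le[of 0 x] by simp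
    show "r (- v) \<le> - q v" using le[of 1 "- v"] q0 by simp
  qed
qed

lemma sublinear_ge_minus: "sublinear q \<Longrightarrow> - q (- x) \<le> q x"
proof -
  assume q: "sublinear q"
  have "q 0 \<le> q x + q (- x)" using q unfolding sublinear_def by (metis add.right_inverse)
  moreover have "q (0 *\<^sub>R 0) = 0 * q 0" using q unfolding sublinear_def by blast
  ultimately show ?thesis by simp
qed

text \<open>
  A form of the Hahn-Banach theorem. By Zorn's lemma there is a minimal sublinear functional below \<open>q\<close>;
  by \<open>sublinear_lowered\<close> it is odd, and an odd sublinear functional is linear.
\<close>
lemma sublinear_dominates_linear:
  fixes q :: "'v::real_vector \<Rightarrow> real"
  assumes q: "sublinear q"
  obtains f where "linear f" "\<And>x. f x \<le> q x"
proof -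
  define A where "A = {r. sublinear r \<and> (\<forall>x. r x \<le> q x)}"
  define P where "P = (\<lambda>a b :: 'v \<Rightarrow> real. \<forall>x. b x \<le> a x)"
  have "\<exists>m\<in>A. \<forall>a\<in>A. P m a \<longrightarrow> a = m"
  proof (rule predicate_Zorn)
    show "partial_order_on A (relation_of P A)"
      by (rule partial_order_on_relation_ofI) (auto simp: P_def fun_eq_iff intro: order_trans antisym)
    fix C assume "C \<in> Chains (relation_of P A)"
    then have CA: "C \<subseteq> A" and ch: "\<And>a b. a \<in> C \<Longrightarrow> b \<in> C \<Longrightarrow> P a b \<or> P b a"
      by (auto simp: Chains_def relation_of_def)
    show "\<exists>u\<in>A. \<forall>a\<in>C. P a u"
    proof (cases "C = {}")
      case True
      then show ?thesis using q by (auto simp: A_def)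
    next
      case False
      define u where "u x = (INF r\<in>C. r x)" for x
      have sl: "sublinear r" "r x \<le> q x" if "r \<in> C" for r x using CA that by (auto simp: A_def)
      have bdd: "bdd_below ((\<lambda>r. r x) ` C)" for x
      proof (rule bdd_belowI2)
        fix r assume "r \<in> C"
        from sublinear_ge_minus[OF sl(1)[OF this], of x] sl(2)[OF this, of "- x"]
        show "- q (- x) \<le> r x" by simp
      qed
      have le: "u x \<le> r x" if "r \<in> C" for r x
        unfolding u_def by (rule cINF_lower[OF bdd that])
      have ge: "B \<le> u x" if "\<And>r. r \<in> C \<Longrightarrow> B \<le> r x" for B x
        unfolding u_def by (rule cINF_greatest[OF False that])
      have usub: "u (x + y) \<le> u x + u y" for x y
      proof -
        have "u (x + y) - r' y \<le> u x" if r': "r' \<in> C" for r'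
        proof (rule ge)
          fix r assume r: "r \<in> C"
          obtain s where s: "s \<in> C" "s x \<le> r x" "s y \<le> r' y"
            using ch[OF r r'] r r' by (auto simp: P_def)
          have "u (x + y) \<le> s x + s y"
            using le[OF s(1), of "x + y"] sl(1)[OF s(1)] by (smt (verit) sublinear_def)
          then show "u (x + y) - r' y \<le> r x" using s by simp
        qed
        then have "u (x + y) - u x \<le> u y" by (intro ge) (smt (verit))
        then show ?thesis by simp
      qed
      have uhom: "u (c *\<^sub>R x) = c * u x" if c: "0 \<le> c" for c x
      proof -
        have eq: "r (c *\<^sub>R x) = c * r x" if "r \<in> C" for r using sl(1)[OF that] c by (simp add: sublinear_def)
        show ?thesis
        proof (cases "c = 0")
          case True
          then have "u (c *\<^sub>R x) = (INF r\<in>C. 0)" unfolding u_def by (intro INF_cong refl, subst eq) (simp_all add: True)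
          then show ?thesis using True False by simp
        next
          case nz: False
          show ?thesis
          proof (rule antisym)
            have "u (c *\<^sub>R x) / c \<le> u x"
              by (rule ge) (use le[of _ "c *\<^sub>R x"] eq c nz in \<open>force simp: field_simps\<close>)
            then show "u (c *\<^sub>R x) \<le> c * u x" using c nz by (simp add: field_simps)
            show "c * u x \<le> u (c *\<^sub>R x)"
              by (rule ge) (simp add: eq mult_left_mono[OF le c])
          qed
        qed
      qed
      have "u x \<le> q x" for x using False le sl(2) by (meson all_not_in_conv order_trans)
      then have "u \<in> A" using usub uhom by (simp add: A_def sublinear_def)
      then show ?thesis using le by (auto simp: P_def)
    qed
  qed
  then obtain m where mA: "m \<in> A" and mmin: "\<And>a. a \<in> A \<Longrightarrow> P m a \<Longrightarrow> a = m" by blast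
  have m: "sublinear m" "\<And>x. m x \<le> q x" using mA by (auto simp: A_def)
  have min: "a = m" if "sublinear a" "\<And>x. a x \<le> m x" for a
  proof (rule mmin)
    show "a \<in> A" using that m(2) by (auto simp: A_def intro: order_trans)
    show "P m a" using that by (simp add: P_def)
  qed
  have odd: "m (- v) = - m v" for v
  proof (rule antisym)
    obtain r where "sublinear r" "\<And>x. r x \<le> m x" "r (- v) \<le> - m v"
      using sublinear_lowered[OF m(1)] by blast
    then show "m (- v) \<le> - m v" using min by blast
    show "- m v \<le> m (- v)" using sublinear_ge_minus[OF m(1), of "- v"] by simp
  qed
  have sub: "m (x + y) \<le> m x + m y" for x y using m(1) by (simp add: sublinear_def)
  have "linear m"
  proof (rule linearI)
    fix x y
    have "- (m x + m y) = m (- x) + m (- y)" by (simp add: odd)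
    also have "\<dots> \<ge> m (- (x + y))" using sub[of "- x" "- y"] by simp
    finally show "m (x + y) = m x + m y" using sub[of x y] odd[of "x + y"] by simp
  next
    fix c x
    have pos: "m (c *\<^sub>R x) = c * m x" if "0 \<le> c" for c x using m(1) that by (simp add: sublinear_def)
    show "m (c *\<^sub>R x) = c *\<^sub>R m x"
    proof (cases "0 \<le> c")
      case False
      then have "m (c *\<^sub>R x) = - m ((- c) *\<^sub>R x)" by (simp add: odd[symmetric])
      also have "\<dots> = - ((- c) * m x)" using False by (subst pos) auto
      finally show ?thesis by simp
    qed (simp add: pos)
  qed
  then show thesis using that m(2) by blast
qed

lemma seminorm_props:
  assumes "seminorm p"
  shows seminorm_nonneg: "0 \<le> p v" and seminorm_scaleR: "p (c *\<^sub>R v) = \<bar>c\<bar> * p v"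
    and seminorm_triangle: "p (v + w) \<le> p v + p w"
    and seminorm_zero: "p 0 = 0" and seminorm_minus: "p (- v) = p v"
    and seminorm_diff: "p (v - w) \<le> p v + p w"
    and seminorm_triangle_diff: "\<bar>p v - p w\<bar> \<le> p (v - w)"
proof -
  show 0: "0 \<le> p v" and sc: "p (c *\<^sub>R v) = \<bar>c\<bar> * p v" and tr: "p (v + w) \<le> p v + p w" for v w c
    using assms by (auto simp: seminorm_def)
  show "p 0 = 0" using sc[of 0 0] by simp
  show m: "p (- v) = p v" for v using sc[of "-1" v] by simp
  show "p (v - w) \<le> p v + p w" using tr[of v "- w"] m by simp
  have c: "p (v - w) = p (w - v)" for v w using m[of "v - w"] by simp
  show "\<bar>p v - p w\<bar> \<le> p (v - w)" using tr[of "v - w" w] tr[of "w - v" v] c[of v w] by simp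
qed

lemma seminorm_sum_le:
  assumes "seminorm p"
  shows "p (\<Sum>i\<in>A. v i) \<le> (\<Sum>i\<in>A. p (v i))"
proof (induction A rule: infinite_finite_induct)
  case (insert a A)
  then show ?case using seminorm_triangle[OF assms, of "v a" "\<Sum>i\<in>A. v i"] by simp
qed (simp_all add: seminorm_zero[OF assms])

lemma seminorm_norming_functional:
  fixes p :: "'v::real_vector \<Rightarrow> real"
  assumes p: "seminorm p"
  obtains f where "linear f" "\<And>x. \<bar>f x\<bar> \<le> p x" "f v = p v"
proof -
  have "sublinear p" using p by (simp add: sublinear_def seminorm_def)
  then obtain r where r: "sublinear r" "\<And>x. r x \<le> p x" "r (- v) \<le> - p v"
    using sublinear_lowered by blast
  obtain f where f: "linear f" "\<And>x. f x \<le> r x" using sublinear_dominates_linear[OF r(1)] by blast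
  have ub: "f x \<le> p x" for x using f(2) r(2) order_trans by blast
  have "\<bar>f x\<bar> \<le> p x" for x
    using ub[of x] ub[of "- x"] by (simp add: linear_neg[OF f(1)] seminorm_minus[OF p])
  moreover have "f v = p v"
    using ub[of v] f(2)[of "- v"] r(3) by (simp add: linear_neg[OF f(1)])
  ultimately show thesis using that f(1) by blast
qed

section \<open>Ultrafilters and iterated limits\<close>
lemma ultrafilter_exists_le:
  fixes F :: "'i filter"
  assumes "F \<noteq> bot"
  obtains U where "ultrafilter U" "U \<le> F"
proof -
  define A where "A = {G. G \<noteq> bot \<and> G \<le> F}"
  have "\<exists>m\<in>A. \<forall>a\<in>A. a \<le> m \<longrightarrow> a = m"
  proof (rule predicate_Zorn)
    show "partial_order_on A (relation_of (\<lambda>a b. b \<le> a) A)"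
      by (rule partial_order_on_relation_ofI) auto
    fix C assume "C \<in> Chains (relation_of (\<lambda>a b. b \<le> a) A)"
    then have CA: "C \<subseteq> A" and ch: "\<And>a b. a \<in> C \<Longrightarrow> b \<in> C \<Longrightarrow> a \<le> b \<or> b \<le> a"
      by (auto simp: Chains_def relation_of_def)
    show "\<exists>u\<in>A. \<forall>a\<in>C. u \<le> a"
    proof (cases "C = {}")
      case True
      then show ?thesis using assms by (auto simp: A_def)
    next
      case False
      have "eventually P (Inf C) \<longleftrightarrow> (\<exists>b\<in>C. eventually P b)" for P
        by (rule eventually_Inf_base[OF False]) (metis ch inf.orderE inf.commute order_refl)
      then have "Inf C \<noteq> bot" using CA by (auto simp: A_def trivial_limit_def)
      moreover obtain G where "G \<in> C" "G \<le> F" using False CA by (auto simp: A_def)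
      then have "Inf C \<le> F" by (rule Inf_lower2)
      ultimately show ?thesis by (intro bexI[of _ "Inf C"]) (auto simp: A_def Inf_lower)
    qed
  qed
  then obtain U where UA: "U \<in> A" and Umin: "\<And>G. G \<in> A \<Longrightarrow> G \<le> U \<Longrightarrow> G = U" by blast
  have U: "U \<noteq> bot" "U \<le> F" using UA by (auto simp: A_def)
  have min: "G = U" if "G \<noteq> bot" "G \<le> U" for G
    using that U(2) by (intro Umin) (auto simp: A_def)
  have "eventually P U" if "\<not> eventually (\<lambda>i. \<not> P i) U" for P
  proof -
    have "inf U (principal {i. P i}) \<noteq> bot"
      using that by (simp add: trivial_limit_def eventually_inf_principal)
    then have "inf U (principal {i. P i}) = U" by (intro min) auto
    moreover have "eventually P (inf U (principal {i. P i}))" by (simp add: eventually_inf_principal)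
    ultimately show ?thesis by simp
  qed
  then show thesis using that U by (auto simp: ultrafilter_def)
qed

text \<open>
  Convergence along this filter is an iterated limit: the inner limit, along \<open>V\<close>, is taken first.
  Unlike the product filter it is an ultrafilter if both factors are, so that bounded functions of
  two variables always have a limit.
\<close>
definition fubini_filter :: "'i filter \<Rightarrow> 'j filter \<Rightarrow> ('i \<times> 'j) filter" where
  "fubini_filter U V = Abs_filter (\<lambda>P. \<forall>\<^sub>F x in U. \<forall>\<^sub>F y in V. P (x, y))"

lemma eventually_fubini_filter:
  "eventually P (fubini_filter U V) \<longleftrightarrow> (\<forall>\<^sub>F x in U. \<forall>\<^sub>F y in V. P (x, y))"
  unfolding fubini_filter_def
proof (rule eventually_Abs_filter, rule is_filter.intro)
  fix P Q
  assume "\<forall>\<^sub>F x in U. \<forall>\<^sub>F y in V. P (x, y)" "\<forall>\<^sub>F x in U. \<forall>\<^sub>F y in V. Q (x, y)"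
  then show "\<forall>\<^sub>F x in U. \<forall>\<^sub>F y in V. P (x, y) \<and> Q (x, y)"
    by eventually_elim (rule eventually_conj)
next
  fix P Q :: "'a \<times> 'b \<Rightarrow> bool"
  assume *: "\<forall>x. P x \<longrightarrow> Q x" and P: "\<forall>\<^sub>F x in U. \<forall>\<^sub>F y in V. P (x, y)"
  from P show "\<forall>\<^sub>F x in U. \<forall>\<^sub>F y in V. Q (x, y)"
    by eventually_elim (use * in \<open>auto elim: eventually_mono\<close>)
qed simp

lemma ultrafilter_not_eventually:
  "ultrafilter U \<Longrightarrow> \<not> eventually P U \<longleftrightarrow> eventually (\<lambda>x. \<not> P x) U"
  unfolding ultrafilter_def
  by (auto simp: trivial_limit_def dest: eventually_conj)

lemma ultrafilterI:
  assumes "\<And>P. \<not> eventually P U \<longleftrightarrow> eventually (\<lambda>x. \<not> P x) U"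
  shows "ultrafilter U"
  using assms[of "\<lambda>_. True"] assms by (auto simp: ultrafilter_def trivial_limit_def)

lemma ultrafilter_fubini:
  assumes "ultrafilter U" "ultrafilter V"
  shows "ultrafilter (fubini_filter U V)"
  by (rule ultrafilterI) (simp add: eventually_fubini_filter ultrafilter_not_eventually assms)

lemma tendsto_fubini_filter:
  fixes l :: real
  assumes F: "\<And>x. ((\<lambda>y. F (x, y)) \<longlongrightarrow> G x) V" and G: "(G \<longlongrightarrow> l) U"
  shows "(F \<longlongrightarrow> l) (fubini_filter U V)"
proof (rule tendstoI)
  fix e :: real assume e: "0 < e"
  then have "\<forall>\<^sub>F x in U. dist (G x) l < e / 2" using G by (intro tendstoD) simp_all
  then show "\<forall>\<^sub>F z in fubini_filter U V. dist (F z) l < e"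
    unfolding eventually_fubini_filter
  proof eventually_elim
    case (elim x)
    have "\<forall>\<^sub>F y in V. dist (F (x, y)) (G x) < e / 2" using F[of x] e by (intro tendstoD) simp_all
    then show ?case
    proof eventually_elim
      case (elim y)
      then show ?case using \<open>dist (G x) l < e / 2\<close> dist_triangle[of "F (x, y)" l "G x"] by linarith
    qed
  qed
qed

lemma tendsto_fubini_filterD:
  fixes l :: real
  assumes V: "V \<noteq> bot" and F: "\<And>x. ((\<lambda>y. F (x, y)) \<longlongrightarrow> G x) V"
    and FL: "(F \<longlongrightarrow> l) (fubini_filter U V)"
  shows "(G \<longlongrightarrow> l) U"
proof (rule tendstoI)
  fix e :: real assume e: "0 < e"
  then have "\<forall>\<^sub>F z in fubini_filter U V. dist (F z) l < e / 2" using FL by (intro tendstoD) simp_all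
  then show "\<forall>\<^sub>F x in U. dist (G x) l < e"
    unfolding eventually_fubini_filter
  proof eventually_elim
    case (elim x)
    have "\<forall>\<^sub>F y in V. dist (F (x, y)) (G x) < e / 2" using F[of x] e by (intro tendstoD) simp_all
    from eventually_happens'[OF V eventually_conj[OF this elim]]
    obtain y where "dist (F (x, y)) (G x) < e / 2" "dist (F (x, y)) l < e / 2" by blast
    then show ?case using dist_triangle2[of "G x" l "F (x, y)"] by (simp add: dist_commute)
  qed
qed

primrec power_filter :: "'i filter \<Rightarrow> nat \<Rightarrow> 'i list filter" where
  "power_filter U 0 = principal {[]}"
| "power_filter U (Suc k) = filtermap (\<lambda>(x, xs). x # xs) (fubini_filter U (power_filter U k))"

lemma eventually_power_filter_0: "eventually P (power_filter U 0) \<longleftrightarrow> P []"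
  by (simp add: eventually_principal)

lemma eventually_power_filter_Suc:
  "eventually P (power_filter U (Suc k)) \<longleftrightarrow> (\<forall>\<^sub>F x in U. \<forall>\<^sub>F xs in power_filter U k. P (x # xs))"
  by (simp add: eventually_filtermap eventually_fubini_filter)

lemma ultrafilter_power_filter: "ultrafilter U \<Longrightarrow> ultrafilter (power_filter U k)"
proof (induction k)
  case 0
  show ?case by (rule ultrafilterI) (simp add: eventually_power_filter_0 del: power_filter.simps)
next
  case (Suc k)
  then show ?case
    by (intro ultrafilterI)
      (simp add: eventually_power_filter_Suc ultrafilter_not_eventually del: power_filter.simps)
qed

lemma ultrafilter_not_bot: "ultrafilter U \<Longrightarrow> U \<noteq> bot"
  by (simp add: ultrafilter_def)

lemma tendsto_power_filter_0: "F [] = l \<Longrightarrow> (F \<longlongrightarrow> (l::real)) (power_filter U 0)"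
  by (rule tendstoI) (simp add: eventually_power_filter_0 del: power_filter.simps)

lemma tendsto_power_filter_0D: "(F \<longlongrightarrow> (l::real)) (power_filter U 0) \<Longrightarrow> F [] = l"
proof (rule ccontr)
  assume "(F \<longlongrightarrow> l) (power_filter U 0)" "F [] \<noteq> l"
  then have "\<forall>\<^sub>F xs in power_filter U 0. dist (F xs) l < dist (F []) l" by (intro tendstoD) simp_all
  then show False unfolding eventually_power_filter_0 by simp
qed

lemma tendsto_power_filter_Suc:
  fixes l :: real
  assumes "\<And>x. ((\<lambda>xs. F (x # xs)) \<longlongrightarrow> G x) (power_filter U k)" "(G \<longlongrightarrow> l) U"
  shows "(F \<longlongrightarrow> l) (power_filter U (Suc k))"
proof -
  have "((\<lambda>z. F ((\<lambda>(x, xs). x # xs) z)) \<longlongrightarrow> l) (fubini_filter U (power_filter U k))"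
    by (rule tendsto_fubini_filter[OF _ assms(2)]) (simp add: assms(1))
  then show ?thesis by (simp add: filterlim_filtermap)
qed

lemma tendsto_power_filter_SucD:
  fixes l :: real
  assumes U: "ultrafilter U" and F: "\<And>x. ((\<lambda>xs. F (x # xs)) \<longlongrightarrow> G x) (power_filter U k)"
    and FL: "(F \<longlongrightarrow> l) (power_filter U (Suc k))"
  shows "(G \<longlongrightarrow> l) U"
proof (rule tendsto_fubini_filterD)
  show "power_filter U k \<noteq> bot" by (intro ultrafilter_not_bot ultrafilter_power_filter U)
  show "((\<lambda>z. F ((\<lambda>(x, xs). x # xs) z)) \<longlongrightarrow> l) (fubini_filter U (power_filter U k))"
    using FL by (simp add: filterlim_filtermap)
qed (use F in auto)

lemma ultrafilter_tendsto_bound: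
  fixes f :: "'i \<Rightarrow> real"
  assumes "ultrafilter U" "\<And>i. \<bar>f i\<bar> \<le> B"
  obtains l where "(f \<longlongrightarrow> l) U" "\<bar>l\<bar> \<le> B"
proof -
  have "bounded (range f)" using assms(2) by (auto simp: bounded_iff)
  then have *: "(f \<longlongrightarrow> Lim U f) U" by (rule ultrafilter_bounded_tendsto[OF assms(1)])
  have "((\<lambda>i. \<bar>f i\<bar>) \<longlongrightarrow> \<bar>Lim U f\<bar>) U" using * by (rule tendsto_rabs)
  then have "\<bar>Lim U f\<bar> \<le> B"
    by (rule tendsto_upperbound) (use assms in \<open>auto simp: ultrafilter_not_bot\<close>)
  with * that show thesis by blast
qed

section \<open>Dual and bidual of a seminormed space\<close>
definition semi_dual :: "('v::real_vector \<Rightarrow> real) \<Rightarrow> ('v \<Rightarrow> real) set" where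
  "semi_dual p = {f. linear f \<and> (\<exists>K. \<forall>x. \<bar>f x\<bar> \<le> K * p x)}"

text \<open>
  The functionals on the dual of norm at most \<open>K\<close>. The dual norm is avoided: \<open>f\<close> has dual norm at
  most \<open>L\<close> if \<open>\<bar>f x\<bar> \<le> L * p x\<close> for all \<open>x\<close>.
\<close>
definition semi_bidual :: "('v::real_vector \<Rightarrow> real) \<Rightarrow> real \<Rightarrow> (('v \<Rightarrow> real) \<Rightarrow> real) set" where
  "semi_bidual p K = {\<Phi>.
     (\<forall>f\<in>semi_dual p. \<forall>g\<in>semi_dual p. \<Phi> (\<lambda>x. f x + g x) = \<Phi> f + \<Phi> g) \<and>
     (\<forall>c. \<forall>f\<in>semi_dual p. \<Phi> (\<lambda>x. c * f x) = c * \<Phi> f) \<and>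
     (\<forall>f\<in>semi_dual p. \<forall>L\<ge>0. (\<forall>x. \<bar>f x\<bar> \<le> L * p x) \<longrightarrow> \<bar>\<Phi> f\<bar> \<le> K * L)}"

definition semi_reflexive :: "('v::real_vector \<Rightarrow> real) \<Rightarrow> bool" where
  "semi_reflexive p \<longleftrightarrow> (\<forall>K. \<forall>\<Phi>\<in>semi_bidual p K. \<exists>x. \<forall>f\<in>semi_dual p. \<Phi> f = f x)"

lemma semi_dual_bound:
  assumes p: "seminorm p" and f: "f \<in> semi_dual p"
  obtains K where "0 \<le> K" "\<And>x. \<bar>f x\<bar> \<le> K * p x"
proof -
  obtain K where K: "\<And>x. \<bar>f x\<bar> \<le> K * p x" using f by (auto simp: semi_dual_def)
  have "\<bar>f x\<bar> \<le> \<bar>K\<bar> * p x" for x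
    by (rule order_trans[OF K mult_right_mono]) (auto simp: seminorm_nonneg[OF p])
  then show thesis by (intro that[of "\<bar>K\<bar>"]) auto
qed

lemma semi_dual_add:
  assumes p: "seminorm p" and "f \<in> semi_dual p" "g \<in> semi_dual p"
  shows "(\<lambda>x. f x + g x) \<in> semi_dual p"
proof -
  obtain K where K: "\<And>x. \<bar>f x\<bar> \<le> K * p x" using assms by (auto simp: semi_dual_def)
  obtain L where L: "\<And>x. \<bar>g x\<bar> \<le> L * p x" using assms by (auto simp: semi_dual_def)
  have "\<bar>f x + g x\<bar> \<le> (K + L) * p x" for x
    using K[of x] L[of x] by (simp add: distrib_right)
  then show ?thesis using assms linear_compose_add by (auto simp: semi_dual_def)
qed

lemma semi_dual_scale:
  assumes "f \<in> semi_dual p"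
  shows "(\<lambda>x. c * f x) \<in> semi_dual p"
proof -
  obtain K where K: "\<And>x. \<bar>f x\<bar> \<le> K * p x" using assms by (auto simp: semi_dual_def)
  have "\<bar>c * f x\<bar> \<le> (\<bar>c\<bar> * K) * p x" for x
    using mult_left_mono[OF K[of x], of "\<bar>c\<bar>"] by (simp add: abs_mult mult.assoc)
  then show ?thesis using assms linear_compose_scale_right[of f c] by (auto simp: semi_dual_def)
qed

lemma semi_dual_zero: "seminorm p \<Longrightarrow> (\<lambda>x. 0) \<in> semi_dual p"
  by (auto simp: semi_dual_def linear_zero intro!: exI[of _ 0])

lemma semi_dual_sum:
  assumes p: "seminorm p" and S: "\<And>f. f \<in> S \<Longrightarrow> f \<in> semi_dual p"
  shows "(\<lambda>x. \<Sum>f\<in>S. c f * f x) \<in> semi_dual p"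
  using S
proof (induction S rule: infinite_finite_induct)
  case (insert g S)
  then show ?case
    using semi_dual_add[OF p semi_dual_scale[of g p "c g"], of "\<lambda>x. \<Sum>f\<in>S. c f * f x"] by simp
qed (simp_all add: semi_dual_zero p)

lemma semi_bidual_add:
  "\<Phi> \<in> semi_bidual p K \<Longrightarrow> f \<in> semi_dual p \<Longrightarrow> g \<in> semi_dual p \<Longrightarrow>
    \<Phi> (\<lambda>x. f x + g x) = \<Phi> f + \<Phi> g"
  by (simp add: semi_bidual_def)

lemma semi_bidual_scale:
  "\<Phi> \<in> semi_bidual p K \<Longrightarrow> f \<in> semi_dual p \<Longrightarrow> \<Phi> (\<lambda>x. c * f x) = c * \<Phi> f"
  by (simp add: semi_bidual_def)

lemma semi_bidual_bound:
  "\<Phi> \<in> semi_bidual p K \<Longrightarrow> f \<in> semi_dual p \<Longrightarrow> 0 \<le> L \<Longrightarrow> (\<And>x. \<bar>f x\<bar> \<le> L * p x) \<Longrightarrow> \<bar>\<Phi> f\<bar> \<le> K * L"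
  by (simp add: semi_bidual_def)

lemma semi_bidual_sum:
  assumes p: "seminorm p" and \<Phi>: "\<Phi> \<in> semi_bidual p K" and "finite S" and "S \<subseteq> semi_dual p"
  shows "\<Phi> (\<lambda>x. \<Sum>f\<in>S. c f * f x) = (\<Sum>f\<in>S. c f * \<Phi> f)"
  using assms(3,4)
proof (induction S rule: finite_induct)
  case empty
  show ?case using semi_bidual_scale[OF \<Phi> semi_dual_zero[OF p], of 0] by simp
next
  case (insert g S)
  have "(\<lambda>x. \<Sum>f\<in>S. c f * f x) \<in> semi_dual p" using insert by (intro semi_dual_sum p) auto
  moreover have "g \<in> semi_dual p" "(\<lambda>x. c g * g x) \<in> semi_dual p" using insert semi_dual_scale by auto
  ultimately have "\<Phi> (\<lambda>x. c g * g x + (\<Sum>f\<in>S. c f * f x)) = c g * \<Phi> g + \<Phi> (\<lambda>x. \<Sum>f\<in>S. c f * f x)"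
    using \<Phi> unfolding semi_bidual_def by auto
  then show ?case using insert by simp
qed

text \<open>
  The finite-dimensional core of Goldstine's theorem, proved by least squares. Let \<open>\<delta>\<close> be the infimum
  of the sum over the ball. Near a point \<open>x\<close> that almost attains it, the functional
  \<open>g = (\<Sum>f\<in>S. (\<Phi> f - f x) * f)\<close> is almost maximal on the ball, so \<open>\<bar>g z\<bar> \<le> (g x + small) * p z\<close> for
  all \<open>z\<close> and hence \<open>\<Phi> g \<le> g x + small\<close>. But \<open>\<Phi> g - g x\<close> is the value of the sum at \<open>x\<close>, which is
  at least \<open>\<delta>\<close>.
\<close>
lemma approx_point_in_ball:
  fixes p :: "'v::real_vector \<Rightarrow> real"
  assumes p: "seminorm p" and \<Phi>: "\<Phi> \<in> semi_bidual p 1"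
    and S: "finite S" "S \<subseteq> semi_dual p" and \<epsilon>: "0 < \<epsilon>"
  shows "\<exists>x. p x \<le> 1 \<and> (\<Sum>f\<in>S. (f x - \<Phi> f)\<^sup>2) < \<epsilon>"
proof (rule ccontr)
  assume contra: "\<not> ?thesis"
  define E where "E x = (\<Sum>f\<in>S. (f x - \<Phi> f)\<^sup>2)" for x
  define V where "V = E ` {x. p x \<le> 1}"
  define \<delta> where "\<delta> = Inf V"
  have ne: "V \<noteq> {}" using seminorm_zero[OF p] by (auto simp: V_def intro!: exI[of _ 0])
  have bdd: "bdd_below V" by (rule bdd_belowI[of _ 0]) (auto simp: V_def E_def intro: sum_nonneg)
  have \<delta>_le: "\<delta> \<le> E x" if "p x \<le> 1" for x
    unfolding \<delta>_def by (rule cInf_lower[OF _ bdd]) (use that in \<open>auto simp: V_def\<close>)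
  have "\<epsilon> \<le> \<delta>" unfolding \<delta>_def
    by (rule cInf_greatest[OF ne]) (use contra in \<open>auto simp: V_def E_def not_less\<close>)
  with \<epsilon> have \<delta>0: "0 < \<delta>" by simp
  have lin: "linear f" if "f \<in> S" for f using S that by (auto simp: semi_dual_def)
  have "\<forall>f\<in>S. \<exists>K\<ge>0. \<forall>x. \<bar>f x\<bar> \<le> K * p x" using S semi_dual_bound[OF p] by (metis subsetD)
  then obtain K where K0: "\<And>f. f \<in> S \<Longrightarrow> 0 \<le> K f" and K: "\<And>f x. f \<in> S \<Longrightarrow> \<bar>f x\<bar> \<le> K f * p x"
    by metis
  define C where "C = (\<Sum>f\<in>S. (2 * K f)\<^sup>2)"
  have C0: "0 \<le> C" by (auto simp: C_def intro: sum_nonneg)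
  have key: "\<delta> \<le> s * (1 + C) / 2" if s: "0 < s" "s \<le> 1" for s
  proof -
    have "\<exists>v\<in>V. v < \<delta> + s\<^sup>2" using cInf_lessD[OF ne, of "\<delta> + s\<^sup>2"] s by (auto simp: \<delta>_def)
    then obtain x where x: "p x \<le> 1" "E x < \<delta> + s\<^sup>2" by (auto simp: V_def)
    define a where "a f = \<Phi> f - f x" for f
    define g where "g z = (\<Sum>f\<in>S. a f * f z)" for z
    have g: "g \<in> semi_dual p" unfolding g_def using S by (intro semi_dual_sum p) auto
    have ling: "linear g" using g by (simp add: semi_dual_def)
    have ball: "g z \<le> g x + s * (1 + C) / 2" if z: "p z \<le> 1" for z
    proof -
      define y where "y = (1 - s) *\<^sub>R x + s *\<^sub>R z"
      have "p y \<le> (1 - s) * p x + s * p z"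
        unfolding y_def using seminorm_triangle[OF p] seminorm_scaleR[OF p] s
        by (metis abs_of_nonneg diff_ge_0_iff_ge less_imp_le)
      also have "\<dots> \<le> (1 - s) * 1 + s * 1" using s x z by (intro add_mono mult_left_mono) auto
      finally have "\<delta> \<le> E y" by (intro \<delta>_le) simp
      also have "E y = (\<Sum>f\<in>S. (a f)\<^sup>2 - 2 * s * (a f * f z - a f * f x) + s\<^sup>2 * (f z - f x)\<^sup>2)"
        unfolding E_def
      proof (rule sum.cong[OF refl])
        fix f assume "f \<in> S"
        then have "f y = (1 - s) * f x + s * f z"
          unfolding y_def by (simp add: linear_add linear_scale lin)
        then show "(f y - \<Phi> f)\<^sup>2 = (a f)\<^sup>2 - 2 * s * (a f * f z - a f * f x) + s\<^sup>2 * (f z - f x)\<^sup>2"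
          by (simp only: a_def power2_eq_square) (simp add: algebra_simps)
      qed
      also have "\<dots> = E x - 2 * s * (g z - g x) + s\<^sup>2 * (\<Sum>f\<in>S. (f z - f x)\<^sup>2)"
        by (simp add: sum.distrib sum_subtractf sum_distrib_left[symmetric] g_def E_def a_def
            power2_commute)
      also have "(\<Sum>f\<in>S. (f z - f x)\<^sup>2) \<le> C"
        unfolding C_def
      proof (rule sum_mono)
        fix f assume f: "f \<in> S"
        have "\<bar>f z - f x\<bar> \<le> K f * p z + K f * p x" using K[OF f, of z] K[OF f, of x] by linarith
        also have "\<dots> \<le> K f * 1 + K f * 1" using K0[OF f] x z by (intro add_mono mult_left_mono) auto
        finally show "(f z - f x)\<^sup>2 \<le> (2 * K f)\<^sup>2" by (intro abs_le_square_iff[THEN iffD1]) simp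
      qed
      finally have "\<delta> \<le> E x - 2 * s * (g z - g x) + s\<^sup>2 * C" by (simp add: mult_left_mono)
      with x(2) have "s * (2 * (g z - g x)) \<le> s * (s * (1 + C))"
        by (simp add: power2_eq_square algebra_simps)
      then show ?thesis using s by (simp add: mult_le_cancel_left_pos)
    qed
    define L where "L = g x + s * (1 + C) / 2"
    have L0: "0 \<le> L" using ball[of 0] by (simp add: L_def seminorm_zero[OF p] linear_0[OF ling])
    have abs1: "\<bar>g z\<bar> \<le> L" if "p z \<le> 1" for z
      using ball[of z] ball[of "- z"] that
      by (simp add: seminorm_minus[OF p] linear_neg[OF ling] L_def)
    have absL: "\<bar>g z\<bar> \<le> L * p z" for z
    proof (cases "p z = 0")
      case True
      obtain M where "\<And>x. \<bar>g x\<bar> \<le> M * p x" using g by (auto simp: semi_dual_def)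
      from this[of z] True show ?thesis by simp
    next
      case False
      then have pz: "0 < p z" using seminorm_nonneg[OF p, of z] by simp
      have "\<bar>g (inverse (p z) *\<^sub>R z)\<bar> \<le> L" using pz by (intro abs1) (simp add: seminorm_scaleR[OF p])
      then show ?thesis using pz by (simp add: linear_scale[OF ling] abs_mult field_simps)
    qed
    have "\<bar>\<Phi> g\<bar> \<le> 1 * L" using \<Phi> g L0 absL unfolding semi_bidual_def by blast
    moreover have "\<Phi> g = (\<Sum>f\<in>S. a f * \<Phi> f)" unfolding g_def by (rule semi_bidual_sum[OF p \<Phi> S])
    moreover have "\<dots> = E x + g x"
      unfolding E_def g_def sum.distrib[symmetric]
      by (rule sum.cong) (auto simp: a_def power2_eq_square algebra_simps)
    ultimately show ?thesis using \<delta>_le[OF x(1)] by (simp add: L_def)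
  qed
  define s where "s = min 1 (\<delta> / (1 + C))"
  have "0 < s" "s \<le> 1" using \<delta>0 C0 by (auto simp: s_def)
  from key[OF this] have "\<delta> \<le> s * (1 + C) / 2" .
  moreover have "s \<le> \<delta> / (1 + C)" by (simp add: s_def)
  then have "s * (1 + C) \<le> \<delta>" using C0 by (subst (asm) pos_le_divide_eq) auto
  ultimately show False using \<delta>0 by simp
qed

lemma Goldstine_ultrafilter:
  fixes p :: "'v::real_vector \<Rightarrow> real"
  assumes p: "seminorm p" and \<Phi>: "\<Phi> \<in> semi_bidual p 1"
  obtains U :: "'v filter" and x :: "'v \<Rightarrow> 'v"
  where "ultrafilter U" "\<And>i. p (x i) \<le> 1" "\<And>f. f \<in> semi_dual p \<Longrightarrow> ((\<lambda>i. f (x i)) \<longlongrightarrow> \<Phi> f) U"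
proof -
  define I where "I = semi_dual p \<times> {0::real<..}"
  define A where "A = (\<lambda>(f, e). {x. p x \<le> 1 \<and> \<bar>f x - \<Phi> f\<bar> < e})"
  define F where "F = (INF i\<in>I. principal (A i))"
  have "F \<noteq> bot"
    unfolding F_def
  proof (rule INF_filter_not_bot)
    fix B assume B: "B \<subseteq> I" "finite B"
    define S where "S = fst ` B"
    define e where "e = Min (insert 1 (snd ` B))"
    have e: "0 < e" "\<And>b. b \<in> B \<Longrightarrow> e \<le> snd b" using B by (auto simp: e_def I_def)
    have S: "finite S" "S \<subseteq> semi_dual p" using B by (auto simp: S_def I_def)
    obtain x where x: "p x \<le> 1" "(\<Sum>f\<in>S. (f x - \<Phi> f)\<^sup>2) < e\<^sup>2"
      using approx_point_in_ball[OF p \<Phi> S, of "e\<^sup>2"] e by auto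
    have "x \<in> (\<Inter>b\<in>B. A b)"
    proof (clarsimp simp: A_def x(1))
      fix f d assume fd: "(f, d) \<in> B"
      then have f: "f \<in> S" by (force simp: S_def)
      have "(f x - \<Phi> f)\<^sup>2 \<le> (\<Sum>f\<in>S. (f x - \<Phi> f)\<^sup>2)" by (rule member_le_sum[OF f _ S(1)]) simp
      then have "(f x - \<Phi> f)\<^sup>2 < e\<^sup>2" using x(2) by simp
      then have "\<bar>f x - \<Phi> f\<bar> < e" using e(1) by (intro power2_less_imp_less[of "\<bar>f x - \<Phi> f\<bar>" e]) auto
      then show "\<bar>f x - \<Phi> f\<bar> < d" using e(2)[OF fd] by simp
    qed
    then show "(INF b\<in>B. principal (A b)) \<noteq> bot"
      using B by (auto simp: INF_principal_finite principal_eq_bot_iff)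
  qed
  then obtain U where U: "ultrafilter U" "U \<le> F" using ultrafilter_exists_le by blast
  have ev: "\<forall>\<^sub>F x in U. p x \<le> 1 \<and> \<bar>f x - \<Phi> f\<bar> < e" if "f \<in> semi_dual p" "0 < e" for f e
  proof (rule filter_leD[OF U(2)], unfold F_def, rule eventually_INF1)
    show "(f, e) \<in> I" using that by (simp add: I_def)
  qed (simp add: A_def eventually_principal)
  define x where "x v = (if p v \<le> 1 then v else 0)" for v
  show thesis
  proof (rule that[OF U(1)])
    show "p (x i) \<le> 1" for i by (simp add: x_def seminorm_zero[OF p])
    fix f assume f: "f \<in> semi_dual p"
    show "((\<lambda>i. f (x i)) \<longlongrightarrow> \<Phi> f) U"
    proof (rule tendstoI)
      fix e :: real assume "0 < e"
      from ev[OF f this] show "\<forall>\<^sub>F i in U. dist (f (x i)) (\<Phi> f) < e"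
        by eventually_elim (simp add: x_def dist_real_def)
    qed
  qed
qed

section \<open>Functionals far from a non-reflexive space\<close>

text \<open>
  The norm of \<open>'v\<close> induces on the quotient by the kernel of \<open>p\<close> the norm given by \<open>p\<close>. On a Banach
  space this makes \<open>p\<close> complete: series converging absolutely for \<open>p\<close> have representatives that
  converge absolutely in norm.
\<close>
definition quotient_seminorm :: "('v::real_normed_vector \<Rightarrow> real) \<Rightarrow> bool" where
  "quotient_seminorm p \<longleftrightarrow> seminorm p \<and> (\<forall>v. p v \<le> norm v) \<and>
     (\<forall>v e. p v < e \<longrightarrow> (\<exists>w. p (v - w) = 0 \<and> norm w \<le> e))"

lemma semi_dualI:
  assumes "linear f" "\<And>x. \<bar>f x\<bar> \<le> L * p x"
  shows "f \<in> semi_dual p"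
  using assms by (auto simp: semi_dual_def)

text \<open>The distance from \<open>\<Phi>\<close> to the canonical image of \<open>x\<close> is at most \<open>K\<close>.\<close>
definition bidual_near :: "('v::real_vector \<Rightarrow> real) \<Rightarrow> (('v \<Rightarrow> real) \<Rightarrow> real) \<Rightarrow> 'v \<Rightarrow> real \<Rightarrow> bool" where
  "bidual_near p \<Phi> x K \<longleftrightarrow>
     (\<forall>f L. linear f \<longrightarrow> 0 \<le> L \<longrightarrow> (\<forall>y. \<bar>f y\<bar> \<le> L * p y) \<longrightarrow> \<bar>\<Phi> f - f x\<bar> \<le> K * L)"

text \<open>
  The canonical image of a complete space is closed: the points \<open>x n\<close> form a Cauchy sequence for
  \<open>p\<close>, because their differences have norming functionals.
\<close>
lemma bidual_near_limit:
  fixes p :: "'v::banach \<Rightarrow> real"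
  assumes p: "quotient_seminorm p"
    and near: "\<And>n::nat. bidual_near p \<Phi> (x n) ((1/2) ^ n)"
  obtains z where "\<And>f. f \<in> semi_dual p \<Longrightarrow> \<Phi> f = f z"
proof -
  have sp: "seminorm p" and pn: "\<And>v. p v \<le> norm v"
    and lift: "\<And>v e. p v < e \<Longrightarrow> \<exists>w. p (v - w) = 0 \<and> norm w \<le> e"
    using p by (auto simp: quotient_seminorm_def)
  have step: "p (x (Suc n) - x n) < 2 * (1/2) ^ n" for n
  proof -
    obtain f where f: "linear f" "\<And>y. \<bar>f y\<bar> \<le> p y" "f (x (Suc n) - x n) = p (x (Suc n) - x n)"
      using seminorm_norming_functional[OF sp] by blast
    have "\<bar>\<Phi> f - f (x n)\<bar> \<le> (1/2) ^ n * 1" "\<bar>\<Phi> f - f (x (Suc n))\<bar> \<le> (1/2) ^ Suc n * 1"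
      using near f(1,2) unfolding bidual_near_def by (metis mult_1 zero_le_one)+
    moreover have "(1/2 :: real) ^ Suc n < (1/2) ^ n" by simp
    ultimately show ?thesis using f(3) linear_diff[OF f(1)] by (smt (verit))
  qed
  have "\<exists>w. \<forall>n. p (x (Suc n) - x n - w n) = 0 \<and> norm (w n) \<le> 2 * (1/2) ^ n"
    using lift[OF step] by metis
  then obtain w where w0: "\<And>n. p (x (Suc n) - x n - w n) = 0"
    and wn: "\<And>n. norm (w n) \<le> 2 * (1/2) ^ n" by blast
  have geo: "summable (\<lambda>n. 2 * (1/2 :: real) ^ n)" by (intro summable_mult summable_geometric) simp
  have sw: "summable w" by (rule summable_comparison_test'[OF geo, of 0]) (use wn in auto)
  define s where "s n = x 0 + (\<Sum>i<n. w i)" for n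
  have xs: "p (x n - s n) = 0" for n
  proof (induction n)
    case (Suc n)
    have "x (Suc n) - s (Suc n) = (x n - s n) + (x (Suc n) - x n - w n)" by (simp add: s_def)
    then have "p (x (Suc n) - s (Suc n)) \<le> 0" using seminorm_triangle[OF sp] Suc w0 by (metis add_0)
    then show ?case using seminorm_nonneg[OF sp] by (meson antisym)
  qed (simp add: s_def seminorm_zero[OF sp])
  define z where "z = x 0 + suminf w"
  have "s \<longlonglongrightarrow> z" unfolding s_def z_def using summable_LIMSEQ[OF sw] by (intro tendsto_intros)
  then have lim0: "(\<lambda>n. (1/2) ^ n + norm (s n - z)) \<longlonglongrightarrow> 0 + 0"
    by (intro tendsto_add LIMSEQ_realpow_zero) (auto simp: LIM_zero_iff tendsto_norm_zero)
  show thesis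
  proof (rule that)
    fix f assume f: "f \<in> semi_dual p"
    then have linf: "linear f" by (simp add: semi_dual_def)
    obtain L where L: "0 \<le> L" "\<And>y. \<bar>f y\<bar> \<le> L * p y" using semi_dual_bound[OF sp f] by blast
    have bound: "\<bar>\<Phi> f - f z\<bar> \<le> L * ((1/2) ^ n + norm (s n - z))" for n
    proof -
      have "\<bar>\<Phi> f - f (x n)\<bar> \<le> (1/2) ^ n * L" using near linf L unfolding bidual_near_def by blast
      moreover have "\<bar>f (x n) - f z\<bar> \<le> L * p (x n - z)" using L(2)[of "x n - z"] by (simp add: linear_diff[OF linf])
      moreover have "p (x n - z) \<le> norm (s n - z)"
        using seminorm_triangle[OF sp, of "x n - s n" "s n - z"] xs[of n] pn[of "s n - z"] by simp
      then have "L * p (x n - z) \<le> L * norm (s n - z)" using L(1) by (rule mult_left_mono)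
      ultimately have "\<bar>\<Phi> f - f z\<bar> \<le> (1/2) ^ n * L + L * norm (s n - z)" by linarith
      then show ?thesis by (simp add: algebra_simps)
    qed
    have "(\<lambda>n. L * ((1/2) ^ n + norm (s n - z))) \<longlonglongrightarrow> L * (0 + 0)" by (intro tendsto_mult_left lim0)
    then have "\<bar>\<Phi> f - f z\<bar> \<le> L * (0 + 0)" by (rule LIMSEQ_le_const) (use bound in auto)
    then show "\<Phi> f = f z" by simp
  qed
qed

text \<open>
  Riesz's lemma in the quotient of the bidual by \<open>X\<close>. A functional outside \<open>X\<close> has positive distance
  \<open>d\<close> from \<open>X\<close>; subtracting an almost nearest point of \<open>X\<close> and normalizing gives \<open>\<Psi>\<close>.
\<close>
lemma nonreflexive_far_functional:
  fixes p :: "'v::banach \<Rightarrow> real"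
  assumes p: "quotient_seminorm p" and nr: "\<not> semi_reflexive p" and \<tau>: "0 < \<tau>" "\<tau> < 1"
  obtains \<Psi> where "\<Psi> \<in> semi_bidual p 1" "\<And>x. \<not> bidual_near p \<Psi> x \<tau>"
proof -
  have sp: "seminorm p" using p by (simp add: quotient_seminorm_def)
  obtain K0 \<Phi> where \<Phi>: "\<Phi> \<in> semi_bidual p K0" and nrep: "\<And>x. \<exists>f\<in>semi_dual p. \<Phi> f \<noteq> f x"
    using nr unfolding semi_reflexive_def by blast
  define D where "D = {K. 0 \<le> K \<and> (\<exists>x. bidual_near p \<Phi> x K)}"
  define d where "d = Inf D"
  have bdd: "bdd_below D" by (rule bdd_belowI[of _ 0]) (auto simp: D_def)
  have mono: "bidual_near p \<Phi> x K'" if "bidual_near p \<Phi> x K" "K \<le> K'" for x K K'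
    using that unfolding bidual_near_def by (meson mult_right_mono order_trans)
  have "bidual_near p \<Phi> 0 K0"
    unfolding bidual_near_def
  proof (intro allI impI)
    fix f L assume f: "linear f" "0 \<le> L" "\<forall>y. \<bar>f y\<bar> \<le> L * p y"
    then have "f \<in> semi_dual p" by (intro semi_dualI) auto
    then show "\<bar>\<Phi> f - f 0\<bar> \<le> K0 * L" using semi_bidual_bound[OF \<Phi>, of f L] f by (simp add: linear_0)
  qed
  then have "\<bar>K0\<bar> \<in> D" using mono[OF _ abs_ge_self] by (auto simp: D_def)
  then have ne: "D \<noteq> {}" by blast
  have d0: "0 \<le> d" unfolding d_def by (rule cInf_greatest[OF ne]) (auto simp: D_def)
  have above: "\<exists>x. bidual_near p \<Phi> x K" if K: "d < K" for K
  proof -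
    obtain K' where "K' \<in> D" "K' < K" using cInf_lessD[OF ne] K unfolding d_def by blast
    then show ?thesis using mono[of _ K' K] by (auto simp: D_def)
  qed
  have dpos: "0 < d"
  proof (rule ccontr)
    assume "\<not> 0 < d"
    then have "\<exists>x. bidual_near p \<Phi> x ((1/2) ^ n)" for n :: nat using d0 by (intro above) simp
    then obtain x where "\<And>n::nat. bidual_near p \<Phi> (x n) ((1/2) ^ n)" by metis
    from bidual_near_limit[OF p this] nrep show False by metis
  qed
  \<comment> \<open>any number strictly between \<open>d\<close> and \<open>d / \<tau>\<close>\<close>
  define K where "K = d / ((1 + \<tau>) / 2)"
  have K: "d < K" "0 < K" "\<tau> * K < d" using dpos \<tau> by (auto simp: K_def field_simps)
  obtain x0 where x0: "bidual_near p \<Phi> x0 K" using above[OF K(1)] by blast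
  define \<Psi> where "\<Psi> f = (\<Phi> f - f x0) / K" for f
  show thesis
  proof (rule that)
    show "\<Psi> \<in> semi_bidual p 1"
      unfolding semi_bidual_def
    proof (intro CollectI conjI ballI allI impI)
      fix f g assume "f \<in> semi_dual p" "g \<in> semi_dual p"
      then show "\<Psi> (\<lambda>x. f x + g x) = \<Psi> f + \<Psi> g"
        using K by (simp add: \<Psi>_def semi_bidual_add[OF \<Phi>] field_simps)
    next
      fix c f assume "f \<in> semi_dual p"
      then show "\<Psi> (\<lambda>x. c * f x) = c * \<Psi> f"
        using K by (simp add: \<Psi>_def semi_bidual_scale[OF \<Phi>] field_simps)
    next
      fix f L assume "f \<in> semi_dual p" "0 \<le> L" "\<forall>x. \<bar>f x\<bar> \<le> L * p x"
      then have "\<bar>\<Phi> f - f x0\<bar> \<le> K * L" using x0 by (auto simp: bidual_near_def semi_dual_def)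
      then show "\<bar>\<Psi> f\<bar> \<le> 1 * L" using K by (simp add: \<Psi>_def abs_divide field_simps)
    qed
    fix x
    show "\<not> bidual_near p \<Psi> x \<tau>"
    proof
      assume *: "bidual_near p \<Psi> x \<tau>"
      have "bidual_near p \<Phi> (x0 + K *\<^sub>R x) (\<tau> * K)"
        unfolding bidual_near_def
      proof (intro allI impI)
        fix f L assume f: "linear f" "0 \<le> L" "\<forall>y. \<bar>f y\<bar> \<le> L * p y"
        have "\<bar>\<Psi> f - f x\<bar> \<le> \<tau> * L" using * f by (simp add: bidual_near_def)
        then have "K * \<bar>\<Psi> f - f x\<bar> \<le> K * (\<tau> * L)" using K by (intro mult_left_mono) auto
        moreover have "\<Phi> f - f (x0 + K *\<^sub>R x) = K * (\<Psi> f - f x)"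
          using K by (simp add: \<Psi>_def linear_add[OF f(1)] linear_scale[OF f(1)] field_simps)
        then have "\<bar>\<Phi> f - f (x0 + K *\<^sub>R x)\<bar> = K * \<bar>\<Psi> f - f x\<bar>" using K by (simp add: abs_mult)
        ultimately show "\<bar>\<Phi> f - f (x0 + K *\<^sub>R x)\<bar> \<le> \<tau> * K * L" by (simp add: mult.commute mult.left_commute)
      qed
      then have "\<tau> * K \<in> D" using \<tau> K by (auto simp: D_def)
      then have "d \<le> \<tau> * K" unfolding d_def by (rule cInf_lower[OF _ bdd])
      then show False using K by simp
    qed
  qed
qed

section \<open>Interlaced tuples in reflexive spaces\<close>

text \<open>
  A list \<open>n\<^sub>1, m\<^sub>1, n\<^sub>2, m\<^sub>2, \<dots>\<close> of even length is read as the pair of interlaced tuples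
  \<open>n\<^sub>1, n\<^sub>2, \<dots>\<close> and \<open>m\<^sub>1, m\<^sub>2, \<dots>\<close>.
\<close>
fun evens :: "'i list \<Rightarrow> 'i list" and odds :: "'i list \<Rightarrow> 'i list" where
  "evens [] = []" | "evens (x # xs) = x # odds xs"
| "odds [] = []" | "odds (x # xs) = evens xs"

lemma power_filter_double_Suc:
  "eventually P (power_filter U (2 * Suc k)) \<longleftrightarrow>
     (\<forall>\<^sub>F n in U. \<forall>\<^sub>F m in U. \<forall>\<^sub>F zs in power_filter U (2 * k). P (n # m # zs))"
  by (simp add: eventually_power_filter_Suc del: power_filter.simps)

lemma eventually_evens:
  "eventually P (power_filter U k) \<Longrightarrow> \<forall>\<^sub>F zs in power_filter U (2 * k). P (evens zs)"
proof (induction k arbitrary: P)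
  case (Suc k)
  from Suc.prems have "\<forall>\<^sub>F x in U. \<forall>\<^sub>F xs in power_filter U k. P (x # xs)"
    by (simp add: eventually_power_filter_Suc del: power_filter.simps)
  then show ?case unfolding power_filter_double_Suc
  proof eventually_elim
    case (elim n)
    from Suc.IH[OF this] show ?case by simp
  qed
qed (simp add: eventually_power_filter_0 del: power_filter.simps)

lemma tendsto_evens:
  "(F \<longlongrightarrow> (l::real)) (power_filter U k) \<Longrightarrow> ((\<lambda>zs. F (evens zs)) \<longlongrightarrow> l) (power_filter U (2 * k))"
  by (rule tendstoI) (rule eventually_evens, erule tendstoD)

lemma semi_reflexive_weak_limit:
  fixes q :: "'v::real_vector \<Rightarrow> real"
  assumes q: "seminorm q" "semi_reflexive q" and W: "ultrafilter W" and B: "\<And>j. q (f j) \<le> B"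
  shows "\<exists>y. \<forall>h\<in>semi_dual q. ((\<lambda>j. h (f j)) \<longlongrightarrow> h y) W"
proof -
  define \<Phi> where "\<Phi> h = Lim W (\<lambda>j. h (f j))" for h :: "'v \<Rightarrow> real"
  have nb: "W \<noteq> bot" by (rule ultrafilter_not_bot[OF W])
  have bnd: "\<bar>h (f j)\<bar> \<le> L * B" if "0 \<le> L" "\<And>x. \<bar>h x\<bar> \<le> L * q x" for h L j
    using that B by (meson mult_left_mono order_trans)
  have lim: "((\<lambda>j. h (f j)) \<longlongrightarrow> \<Phi> h) W" if h: "h \<in> semi_dual q" for h
  proof -
    obtain L where L: "0 \<le> L" "\<And>x. \<bar>h x\<bar> \<le> L * q x" using semi_dual_bound[OF q(1) h] by blast
    then show ?thesis unfolding \<Phi>_def using bnd[OF L]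
      by (intro ultrafilter_bounded_tendsto W) (auto simp: bounded_iff)
  qed
  have "\<Phi> \<in> semi_bidual q B"
    unfolding semi_bidual_def
  proof (intro CollectI conjI ballI allI impI)
    fix f' g assume "f' \<in> semi_dual q" "g \<in> semi_dual q"
    then show "\<Phi> (\<lambda>x. f' x + g x) = \<Phi> f' + \<Phi> g"
      unfolding \<Phi>_def[of "\<lambda>x. f' x + g x"] by (intro tendsto_Lim[OF nb] tendsto_add lim)
  next
    fix c f' assume "f' \<in> semi_dual q"
    then show "\<Phi> (\<lambda>x. c * f' x) = c * \<Phi> f'"
      unfolding \<Phi>_def[of "\<lambda>x. c * f' x"] by (intro tendsto_Lim[OF nb] tendsto_mult_left lim)
  next
    fix h L assume h: "h \<in> semi_dual q" "0 \<le> L" "\<forall>x. \<bar>h x\<bar> \<le> L * q x"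
    have "((\<lambda>j. \<bar>h (f j)\<bar>) \<longlongrightarrow> \<bar>\<Phi> h\<bar>) W" using lim[OF h(1)] by (rule tendsto_rabs)
    then show "\<bar>\<Phi> h\<bar> \<le> B * L"
      by (rule tendsto_upperbound) (use nb bnd[of L h] h in \<open>auto simp: mult.commute\<close>)
  qed
  then obtain y where "\<forall>h\<in>semi_dual q. \<Phi> h = h y" using q(2) unfolding semi_reflexive_def by blast
  with lim show ?thesis by metis
qed

lemma dual_ball_pointwise_limit:
  fixes q :: "'v::real_vector \<Rightarrow> real"
  assumes W: "ultrafilter W" and g: "\<And>j. linear (g j)" "\<And>j v. \<bar>g j v\<bar> \<le> q v"
  shows "\<exists>h. linear h \<and> (\<forall>v. \<bar>h v\<bar> \<le> q v) \<and> (\<forall>v. ((\<lambda>j. g j v) \<longlongrightarrow> h v) W)"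
proof -
  have nb: "W \<noteq> bot" by (rule ultrafilter_not_bot[OF W])
  have "\<exists>l. ((\<lambda>j. g j v) \<longlongrightarrow> l) W \<and> \<bar>l\<bar> \<le> q v" for v
    using ultrafilter_tendsto_bound[OF W, of "\<lambda>j. g j v" "q v"] g(2) by blast
  then obtain h where h: "\<And>v. ((\<lambda>j. g j v) \<longlongrightarrow> h v) W" "\<And>v. \<bar>h v\<bar> \<le> q v" by metis
  have "linear h"
  proof (rule linearI)
    show "h (x + y) = h x + h y" for x y
      by (rule tendsto_unique[OF nb h(1)]) (simp add: linear_add[OF g(1)] tendsto_add h(1))
    show "h (c *\<^sub>R x) = c *\<^sub>R h x" for c x
      by (rule tendsto_unique[OF nb h(1)]) (simp add: linear_scale[OF g(1)] tendsto_mult_left h(1))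
  qed
  with h show ?thesis by blast
qed

text \<open>
  The limit of the pairing of interlaced tuples factors through the weak limit \<open>y\<close> of \<open>f\<close> and the
  weak* limit \<open>h\<close> of \<open>g\<close>, although \<open>g\<close> may depend on its whole tuple. By induction, for fixed first
  entries \<open>n\<close> and \<open>m\<close> the limit is \<open>H n (Y m)\<close>, where \<open>H n\<close> and \<open>Y m\<close> are the limits of \<open>g\<close> and \<open>f\<close>
  over the remaining entries; as \<open>m\<close> comes after \<open>n\<close>, letting first \<open>m\<close> and then \<open>n\<close> vary yields
  \<open>H n y\<close> and finally \<open>h y\<close>.
\<close>
lemma interlaced_pairing_limit:
  fixes q :: "'v::real_vector \<Rightarrow> real"
  assumes q: "seminorm q" "semi_reflexive q" and U: "ultrafilter U"
    and f: "\<And>xs. q (f xs) \<le> B" and g: "\<And>xs. linear (g xs)" "\<And>xs v. \<bar>g xs v\<bar> \<le> q v"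
    and y: "\<And>h. h \<in> semi_dual q \<Longrightarrow> ((\<lambda>xs. h (f xs)) \<longlongrightarrow> h y) (power_filter U k)"
    and h: "\<And>v. ((\<lambda>xs. g xs v) \<longlongrightarrow> h v) (power_filter U k)"
  shows "((\<lambda>zs. g (evens zs) (f (odds zs))) \<longlongrightarrow> h y) (power_filter U (2 * k))"
  using f g y h
proof (induction k arbitrary: f g y h)
  case 0
  have "h = g []" using tendsto_power_filter_0D[OF "0.prems"(5)] by auto
  moreover have "g [] \<in> semi_dual q"
    using "0.prems"(2,3) by (intro semi_dualI[where L = 1]) auto
  then have "g [] (f []) = g [] y" using tendsto_power_filter_0D[OF "0.prems"(4)] by auto
  ultimately show ?case using tendsto_power_filter_0[of "\<lambda>zs. g (evens zs) (f (odds zs))" "h y" U] by simp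
next
  case (Suc k)
  let ?W = "power_filter U k"
  have W: "ultrafilter ?W" by (rule ultrafilter_power_filter[OF U])
  have "\<exists>y'. \<forall>h\<in>semi_dual q. ((\<lambda>xs. h (f (m # xs))) \<longlongrightarrow> h y') ?W" for m
    by (rule semi_reflexive_weak_limit[OF q W, of "\<lambda>xs. f (m # xs)" B]) (rule Suc.prems(1))
  then obtain Y where Y: "\<And>m h. h \<in> semi_dual q \<Longrightarrow> ((\<lambda>xs. h (f (m # xs))) \<longlongrightarrow> h (Y m)) ?W" by metis
  have "\<exists>h'. linear h' \<and> (\<forall>v. \<bar>h' v\<bar> \<le> q v) \<and> (\<forall>v. ((\<lambda>xs. g (n # xs) v) \<longlongrightarrow> h' v) ?W)" for n
    by (rule dual_ball_pointwise_limit[OF W]) (rule Suc.prems(2,3))+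
  then obtain H where H: "\<And>n. linear (H n)" "\<And>n v. \<bar>H n v\<bar> \<le> q v"
    "\<And>n v. ((\<lambda>xs. g (n # xs) v) \<longlongrightarrow> H n v) ?W" by metis
  have Hd: "H n \<in> semi_dual q" for n
    using H(1,2) by (intro semi_dualI[where L = 1]) auto
  have IH: "((\<lambda>zs. g (n # evens zs) (f (m # odds zs))) \<longlongrightarrow> H n (Y m)) (power_filter U (2 * k))" for n m
    by (rule Suc.IH) (use Suc.prems Y H in auto)
  have Ylim: "((\<lambda>m. h' (Y m)) \<longlongrightarrow> h' y) U" if "h' \<in> semi_dual q" for h'
    by (rule tendsto_power_filter_SucD[OF U Y[OF that]]) (rule Suc.prems(4)[OF that])
  have Hlim: "((\<lambda>n. H n y) \<longlongrightarrow> h y) U"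
    by (rule tendsto_power_filter_SucD[OF U H(3)]) (rule Suc.prems(5))
  have "((\<lambda>zs. g (evens zs) (f (odds zs))) \<longlongrightarrow> h y) (power_filter U (Suc (Suc (2 * k))))"
    by (rule tendsto_power_filter_Suc[OF tendsto_power_filter_Suc Hlim])
       (use IH Ylim[OF Hd] in auto)
  then show ?case by (simp del: power_filter.simps)
qed

text \<open>
  The centre \<open>y\<close> is the weak limit of \<open>f\<close>, and \<open>g xs\<close> is a functional that norms \<open>f xs - y\<close>. By
  \<open>interlaced_pairing_limit\<close>, the quantity \<open>g (evens zs) (f (evens zs) - f (odds zs))\<close>, which is at most
  \<open>\<omega>\<close>, has the same limit as \<open>g xs (f xs - y) = q (f xs - y)\<close>.
\<close>
lemma reflexive_property_Q:
  fixes q :: "'v::real_vector \<Rightarrow> real"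
  assumes q: "seminorm q" "semi_reflexive q" and U: "ultrafilter U"
    and f: "\<And>xs. q (f xs) \<le> B"
    and \<omega>: "\<forall>\<^sub>F zs in power_filter U (2 * k). q (f (evens zs) - f (odds zs)) \<le> \<omega>"
    and \<omega>': "\<omega> < \<omega>'"
  obtains y where "\<forall>\<^sub>F xs in power_filter U k. q (f xs - y) < \<omega>'"
proof -
  let ?W = "power_filter U k" and ?W2 = "power_filter U (2 * k)"
  have W: "ultrafilter ?W" "ultrafilter ?W2" by (rule ultrafilter_power_filter[OF U])+
  obtain y where y: "\<And>h. h \<in> semi_dual q \<Longrightarrow> ((\<lambda>xs. h (f xs)) \<longlongrightarrow> h y) ?W"
    using semi_reflexive_weak_limit[OF q W(1), of f B] f by blast
  have "\<exists>g. linear g \<and> (\<forall>v. \<bar>g v\<bar> \<le> q v) \<and> g (f xs - y) = q (f xs - y)" for xs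
    using seminorm_norming_functional[OF q(1)] by metis
  then obtain g where g: "\<And>xs. linear (g xs)" "\<And>xs v. \<bar>g xs v\<bar> \<le> q v"
    "\<And>xs. g xs (f xs - y) = q (f xs - y)" by metis
  obtain h where h: "\<And>v. ((\<lambda>xs. g xs v) \<longlongrightarrow> h v) ?W"
    using dual_ball_pointwise_limit[OF W(1), of g q] g(1,2) by blast
  have pair: "((\<lambda>zs. g (evens zs) (f (odds zs))) \<longlongrightarrow> h y) ?W2"
    by (rule interlaced_pairing_limit[where q = q and B = B]) (use q U f g(1,2) y h in auto)
  have "\<bar>q (f xs - y)\<bar> \<le> B + q y" for xs
    using seminorm_diff[OF q(1), of "f xs" y] f[of xs] seminorm_nonneg[OF q(1), of "f xs - y"] by simp
  then obtain l where l: "((\<lambda>xs. q (f xs - y)) \<longlongrightarrow> l) ?W"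
    by (rule ultrafilter_tendsto_bound[OF W(1)])
  have "((\<lambda>zs. q (f (evens zs) - y) + g (evens zs) y - g (evens zs) (f (odds zs))) \<longlongrightarrow> l + h y - h y) ?W2"
    by (intro tendsto_intros pair tendsto_evens[OF l] tendsto_evens[OF h])
  then have "l + h y - h y \<le> \<omega>"
  proof (rule tendsto_upperbound)
    show "\<forall>\<^sub>F zs in ?W2. q (f (evens zs) - y) + g (evens zs) y - g (evens zs) (f (odds zs)) \<le> \<omega>"
      using \<omega>
    proof eventually_elim
      case (elim zs)
      have "q (f (evens zs) - y) + g (evens zs) y - g (evens zs) (f (odds zs))
          = g (evens zs) (f (evens zs) - f (odds zs))"
        by (simp add: g(3)[symmetric] linear_diff[OF g(1)])
      then show ?case using g(2)[of "evens zs" "f (evens zs) - f (odds zs)"] elim by linarith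
    qed
  qed (rule ultrafilter_not_bot[OF W(2)])
  then have "\<forall>\<^sub>F xs in ?W. q (f xs - y) < \<omega>'" using \<omega>' by (intro order_tendstoD(2)[OF l]) simp
  then show thesis by (rule that)
qed

section \<open>Iterated limits of norms and the spreading model\<close>
primrec iterated_norm :: "('v::real_vector \<Rightarrow> real) \<Rightarrow> 'i filter \<Rightarrow> ('i \<Rightarrow> 'v) \<Rightarrow> real list \<Rightarrow> 'v \<Rightarrow> real" where
  "iterated_norm p U x [] v = p v"
| "iterated_norm p U x (a # as) v = Lim U (\<lambda>i. iterated_norm p U x as (v + a *\<^sub>R x i))"

locale unit_ball_family =
  fixes p :: "'v::real_vector \<Rightarrow> real" and U :: "'i filter" and x :: "'i \<Rightarrow> 'v"
  assumes seminorm: "seminorm p" and ultrafilter: "ultrafilter U" and in_ball: "p (x i) \<le> 1"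
begin

abbreviation T :: "real list \<Rightarrow> 'v \<Rightarrow> real" where "T \<equiv> iterated_norm p U x"

lemma U_not_bot: "U \<noteq> bot"
  by (rule ultrafilter_not_bot[OF ultrafilter])

lemma scaled_in_ball: "p (a *\<^sub>R x i) \<le> \<bar>a\<bar>"
  using mult_left_mono[OF in_ball[of i], of "\<bar>a\<bar>"] by (simp add: seminorm_scaleR[OF seminorm])

lemma iterated_norm_bounds: "0 \<le> T as v" "T as v \<le> p v + (\<Sum>a\<leftarrow>as. \<bar>a\<bar>)"
proof -
  have "0 \<le> T as v \<and> T as v \<le> p v + (\<Sum>a\<leftarrow>as. \<bar>a\<bar>)"
  proof (induction as arbitrary: v)
    case Nil
    show ?case by (simp add: seminorm_nonneg[OF seminorm])
  next
    case (Cons a as)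
    let ?f = "\<lambda>i. T as (v + a *\<^sub>R x i)" and ?B = "p v + (\<Sum>a\<leftarrow>a # as. \<bar>a\<bar>)"
    have B: "?f i \<le> ?B" for i
      using Cons.IH[of "v + a *\<^sub>R x i"] seminorm_triangle[OF seminorm, of v "a *\<^sub>R x i"] scaled_in_ball[of a i]
      by simp
    have "bounded (range ?f)"
      unfolding bounded_iff using B Cons.IH by (intro exI[of _ ?B]) auto
    then have lim: "(?f \<longlongrightarrow> T (a # as) v) U" by (simp add: ultrafilter_bounded_tendsto[OF ultrafilter])
    have "0 \<le> T (a # as) v"
      by (rule tendsto_lowerbound[OF lim]) (use Cons.IH U_not_bot in auto)
    moreover have "T (a # as) v \<le> ?B"
      by (rule tendsto_upperbound[OF lim]) (use B U_not_bot in auto)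
    ultimately show ?case by simp
  qed
  then show "0 \<le> T as v" "T as v \<le> p v + (\<Sum>a\<leftarrow>as. \<bar>a\<bar>)" by auto
qed

lemma iterated_norm_tendsto: "((\<lambda>i. T as (v + a *\<^sub>R x i)) \<longlongrightarrow> T (a # as) v) U"
proof -
  let ?B = "p v + (\<Sum>a\<leftarrow>a # as. \<bar>a\<bar>)"
  have "T as (v + a *\<^sub>R x i) \<le> ?B" for i
    using iterated_norm_bounds(2)[of as "v + a *\<^sub>R x i"]
      seminorm_triangle[OF seminorm, of v "a *\<^sub>R x i"] scaled_in_ball[of a i] by simp
  then have "bounded (range (\<lambda>i. T as (v + a *\<^sub>R x i)))"
    unfolding bounded_iff using iterated_norm_bounds(1) by (intro exI[of _ ?B]) auto
  then show ?thesis by (simp add: ultrafilter_bounded_tendsto[OF ultrafilter])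
qed

declare iterated_norm.simps(2) [simp del]

lemma iterated_norm_add:
  "T (map (\<lambda>j. a j + b j) js) (v + w) \<le> T (map a js) v + T (map b js) w"
proof (induction js arbitrary: v w)
  case Nil
  show ?case by (simp add: seminorm_triangle[OF seminorm])
next
  case (Cons j js)
  have "T (map (\<lambda>j. a j + b j) js) (v + w + (a j + b j) *\<^sub>R x i)
      \<le> T (map a js) (v + a j *\<^sub>R x i) + T (map b js) (w + b j *\<^sub>R x i)" for i
    using Cons.IH[of "v + a j *\<^sub>R x i" "w + b j *\<^sub>R x i"] by (simp add: algebra_simps)
  then show ?case
    unfolding list.map
    by (intro tendsto_le[OF U_not_bot tendsto_add[OF iterated_norm_tendsto iterated_norm_tendsto]
          iterated_norm_tendsto]) auto
qed

lemma iterated_norm_scale: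
  "T (map (\<lambda>j. c * a j) js) (c *\<^sub>R v) = \<bar>c\<bar> * T (map a js) v"
proof (induction js arbitrary: v)
  case Nil
  show ?case by (simp add: seminorm_scaleR[OF seminorm])
next
  case (Cons j js)
  have "T (map (\<lambda>j. c * a j) js) (c *\<^sub>R v + (c * a j) *\<^sub>R x i) = \<bar>c\<bar> * T (map a js) (v + a j *\<^sub>R x i)" for i
    using Cons.IH[of "v + a j *\<^sub>R x i"] by (simp add: algebra_simps)
  then have "((\<lambda>i. T (map (\<lambda>j. c * a j) js) (c *\<^sub>R v + (c * a j) *\<^sub>R x i)) \<longlongrightarrow> \<bar>c\<bar> * T (map a (j # js)) v) U"
    by (simp add: tendsto_mult_left iterated_norm_tendsto)
  then show ?case unfolding list.map by (rule tendsto_unique[OF U_not_bot iterated_norm_tendsto])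
qed

text \<open>Vanishing coefficients may be dropped; this is where the spreading property comes from.\<close>
lemma iterated_norm_filter_nonzero: "T (filter (\<lambda>a. a \<noteq> 0) as) v = T as v"
proof (induction as arbitrary: v)
  case (Cons a as)
  show ?case
  proof (cases "a = 0")
    case True
    have "((\<lambda>i. T as v) \<longlongrightarrow> T (0 # as) v) U" using iterated_norm_tendsto[of as v 0] by simp
    then have "T (0 # as) v = T as v" using tendsto_unique[OF U_not_bot] tendsto_const by blast
    then show ?thesis using True Cons.IH by simp
  qed (simp add: iterated_norm.simps(2) Cons.IH)
qed simp

lemma lookup_scaleR: "Poly_Mapping.lookup (c *\<^sub>R a) i = c * Poly_Mapping.lookup (a :: nat \<Rightarrow>\<^sub>0 real) i"
proof -
  have "finite {j. c * Poly_Mapping.lookup a j \<noteq> 0}"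
    by (rule finite_subset[OF _ finite_keys[of a]]) (auto simp: in_keys_iff)
  then show ?thesis by (simp add: scaleR_poly_mapping_def)
qed

text \<open>
  The norm of the spreading model, on finitely supported sequences: the iterated limit along the
  ultrafilter with the entries of \<open>a\<close> as coefficients, taken in increasing order of their index.
\<close>
definition N :: "(nat \<Rightarrow>\<^sub>0 real) \<Rightarrow> real" where
  "N a = T (map (Poly_Mapping.lookup a) (sorted_list_of_set (Poly_Mapping.keys a))) 0"

lemma N_eq:
  assumes S: "finite S" "Poly_Mapping.keys a \<subseteq> S"
  shows "N a = T (map (Poly_Mapping.lookup a) (sorted_list_of_set S)) 0"
proof -
  have "filter (\<lambda>j. Poly_Mapping.lookup a j \<noteq> 0) (sorted_list_of_set S) = sorted_list_of_set (Poly_Mapping.keys a)"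
    by (rule sorted_distinct_set_unique) (use S in \<open>auto simp: in_keys_iff sorted_filter[of "\<lambda>x. x", simplified]\<close>)
  then have "map (Poly_Mapping.lookup a) (sorted_list_of_set (Poly_Mapping.keys a)) =
      filter (\<lambda>a. a \<noteq> 0) (map (Poly_Mapping.lookup a) (sorted_list_of_set S))"
    by (simp add: filter_map o_def)
  then show ?thesis by (simp add: N_def iterated_norm_filter_nonzero)
qed

lemma seminorm_N: "seminorm N"
  unfolding seminorm_def
proof (intro conjI allI)
  show "0 \<le> N v" for v by (simp add: N_def iterated_norm_bounds)
  show "N (c *\<^sub>R v) = \<bar>c\<bar> * N v" for c v
  proof -
    have "Poly_Mapping.keys (c *\<^sub>R v) \<subseteq> Poly_Mapping.keys v" by (auto simp: in_keys_iff lookup_scaleR)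
    then have "N (c *\<^sub>R v) = T (map (\<lambda>j. c * Poly_Mapping.lookup v j) (sorted_list_of_set (Poly_Mapping.keys v))) (c *\<^sub>R 0)"
      by (subst N_eq[of "Poly_Mapping.keys v"]) (simp_all add: lookup_scaleR[abs_def])
    then show ?thesis unfolding iterated_norm_scale by (simp add: N_def)
  qed
  show "N (v + w) \<le> N v + N w" for v w
  proof -
    let ?S = "Poly_Mapping.keys v \<union> Poly_Mapping.keys w"
    have "Poly_Mapping.keys (v + w) \<subseteq> ?S" by (auto simp: in_keys_iff lookup_add)
    then have "N (v + w) = T (map (\<lambda>j. Poly_Mapping.lookup v j + Poly_Mapping.lookup w j) (sorted_list_of_set ?S)) (0 + 0)"
      by (subst N_eq[of ?S]) (simp_all add: lookup_add[abs_def])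
    also have "\<dots> \<le> N v + N w"
      using iterated_norm_add[of "Poly_Mapping.lookup v" "Poly_Mapping.lookup w" "sorted_list_of_set ?S" 0 0]
      by (simp add: N_eq[of ?S v] N_eq[of ?S w])
    finally show ?thesis .
  qed
qed

lemma N_spreading:
  assumes n: "strict_mono_on {..<k} n"
  shows "N (\<Sum>j<k. a j *\<^sub>R Poly_Mapping.single (n j) 1) = T (map a [0..<k]) 0"
proof -
  let ?v = "\<Sum>j<k. a j *\<^sub>R Poly_Mapping.single (n j) (1::real)"
  have inj: "inj_on n {..<k}" using n by (rule strict_mono_on_imp_inj_on)
  have look: "Poly_Mapping.lookup ?v i = (\<Sum>j<k. if n j = i then a j else 0)" for i
    by (auto simp: lookup_sum lookup_scaleR lookup_single when_def intro!: sum.cong)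
  have look_n: "Poly_Mapping.lookup ?v (n j) = a j" if "j < k" for j
  proof -
    have "Poly_Mapping.lookup ?v (n j) = (\<Sum>j'<k. if j' = j then a j' else 0)"
      unfolding look using inj that by (intro sum.cong) (auto simp: inj_on_def)
    then show ?thesis using that by simp
  qed
  have "sorted_list_of_set (n ` {..<k}) = map n [0..<k]"
  proof (rule sorted_distinct_set_unique)
    show "sorted (map n [0..<k])"
      using n by (auto simp: sorted_iff_nth_mono_less strict_mono_on_def less_imp_le)
    show "distinct (map n [0..<k])" using inj by (simp add: distinct_map atLeast0LessThan)
  qed (auto simp: atLeast0LessThan)
  moreover have "Poly_Mapping.keys ?v \<subseteq> n ` {..<k}"
  proof
    fix i assume "i \<in> Poly_Mapping.keys ?v"
    then have "(\<Sum>j<k. if n j = i then a j else 0) \<noteq> 0" by (simp add: in_keys_iff look)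
    then show "i \<in> n ` {..<k}" by (rule contrapos_np) (auto intro!: sum.neutral)
  qed
  ultimately have "N ?v = T (map (Poly_Mapping.lookup ?v) (map n [0..<k])) 0"
    using N_eq[of "n ` {..<k}" ?v] by simp
  moreover have "map (Poly_Mapping.lookup ?v) (map n [0..<k]) = map a [0..<k]"
    using look_n by simp
  ultimately show ?thesis by (simp only:)
qed

lemma sum_in_ball: "p (\<Sum>j\<in>J. a j *\<^sub>R x (\<iota> j)) \<le> (\<Sum>j\<in>J. \<bar>a j\<bar>)"
  by (rule order_trans[OF seminorm_sum_le[OF seminorm] sum_mono]) (rule scaled_in_ball)

lemma iterated_norm_perturb:
  "\<bar>T (map a [0..<k]) 0 - T (map b [0..<k]) 0\<bar> \<le> (\<Sum>j<k. \<bar>a j - b j\<bar>)"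
proof -
  have *: "T (map a [0..<k]) 0 \<le> T (map b [0..<k]) 0 + (\<Sum>j<k. \<bar>a j - b j\<bar>)" for a b
  proof -
    have "T (map a [0..<k]) 0 \<le> T (map b [0..<k]) 0 + T (map (\<lambda>j. a j - b j) [0..<k]) 0"
      using iterated_norm_add[of b "\<lambda>j. a j - b j" "[0..<k]" 0 0] by simp
    also have "T (map (\<lambda>j. a j - b j) [0..<k]) 0 \<le> (\<Sum>j<k. \<bar>a j - b j\<bar>)"
      using iterated_norm_bounds(2)[of "map (\<lambda>j. a j - b j) [0..<k]" 0]
      by (simp add: seminorm_zero[OF seminorm] interv_sum_list_conv_sum_set_nat o_def atLeast0LessThan)
    finally show ?thesis by simp
  qed
  show ?thesis using *[of a b] *[of b a] by (simp add: abs_le_iff abs_minus_commute)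
qed

text \<open>
  Passing from the iterated limits to limits over a sequence of indices: the next index \<open>i\<close> has to
  realize one of the limits approximately, for all choices of earlier indices and for coefficient
  lists from a finite set that grows with the length of the sequence and exhausts all lists of
  rationals. Rational coefficients suffice by continuity.
\<close>

text \<open>
  The error made when the limit over the index at position \<open>length js\<close> is replaced by the index \<open>i\<close>,
  after the indices \<open>js\<close> have been chosen for the preceding positions.
\<close>
definition step_error :: "real list \<Rightarrow> 'i list \<Rightarrow> 'i \<Rightarrow> real" where
  "step_error as js i =
     \<bar>T (drop (Suc (length js)) as) ((\<Sum>j<length js. (as ! j) *\<^sub>R x (js ! j)) + (as ! length js) *\<^sub>R x i)
      - T (drop (length js) as) (\<Sum>j<length js. (as ! j) *\<^sub>R x (js ! j))\<bar>"

definition good_choice :: "'i list \<Rightarrow> 'i \<Rightarrow> bool" where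
  "good_choice is i \<longleftrightarrow>
     (\<forall>c\<in>{..<length is}. \<forall>js\<in>{js. set js \<subseteq> set is \<and> length js \<le> length (from_nat c :: rat list)}.
        length js < length (from_nat c :: rat list) \<longrightarrow>
        step_error (map real_of_rat (from_nat c)) js i < (1/2) ^ length is)"

lemma step_error_small:
  assumes "length js < length as" "0 < e"
  shows "\<forall>\<^sub>F i in U. step_error as js i < e"
proof -
  define v where "v = (\<Sum>j<length js. (as ! j) *\<^sub>R x (js ! j))"
  have "((\<lambda>i. T (drop (Suc (length js)) as) (v + (as ! length js) *\<^sub>R x i)) \<longlongrightarrow>
      T (as ! length js # drop (Suc (length js)) as) v) U"
    by (rule iterated_norm_tendsto)
  then have "((\<lambda>i. T (drop (Suc (length js)) as) (v + (as ! length js) *\<^sub>R x i)) \<longlongrightarrow> T (drop (length js) as) v) U"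
    unfolding Cons_nth_drop_Suc[OF assms(1)] .
  from tendstoD[OF this assms(2)] show ?thesis by (simp add: dist_real_def step_error_def v_def)
qed

lemma good_choice_exists: "\<exists>i. good_choice is i"
proof -
  have "\<forall>\<^sub>F i in U. good_choice is i"
    unfolding good_choice_def
  proof (rule eventually_ball_finite[OF finite_lessThan], rule ballI,
      rule eventually_ball_finite[OF finite_lists_length_le[OF finite_set]], rule ballI)
    fix c js
    show "\<forall>\<^sub>F i in U. length js < length (from_nat c :: rat list) \<longrightarrow>
        step_error (map real_of_rat (from_nat c)) js i < (1/2) ^ length is"
    proof (cases "length js < length (from_nat c :: rat list)")
      case True
      from step_error_small[of js "map real_of_rat (from_nat c)" "(1/2) ^ length is"] True
      show ?thesis by simp
    qed simp
  qed
  from eventually_happens'[OF U_not_bot this] show ?thesis .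
qed

primrec history :: "nat \<Rightarrow> 'i list" where
  "history 0 = []"
| "history (Suc n) = history n @ [SOME i. good_choice (history n) i]"

definition \<iota> :: "nat \<Rightarrow> 'i" where "\<iota> n = (SOME i. good_choice (history n) i)"

lemma history_eq: "history n = map \<iota> [0..<n]"
  by (induction n) (simp_all add: \<iota>_def)

lemma good_choice_\<iota>: "good_choice (map \<iota> [0..<n]) (\<iota> n)"
  unfolding \<iota>_def[of n] history_eq[symmetric] by (rule someI_ex[OF good_choice_exists])

text \<open>
  Replacing the \<open>k\<close> limits one after the other by the indices chosen costs at most \<open>(1/2) ^ m\<close> each.
\<close>
lemma sequence_rational_approx:
  fixes qs :: "rat list"
  defines "a \<equiv> \<lambda>j. real_of_rat (qs ! j)" and "k \<equiv> length qs"
  assumes n: "strict_mono_on {..<k} n" and m: "\<And>j. j < k \<Longrightarrow> m \<le> n j" "to_nat qs < m"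
  shows "\<bar>p (\<Sum>j<k. a j *\<^sub>R x (\<iota> (n j))) - T (map a [0..<k]) 0\<bar> \<le> real k * (1/2) ^ m"
proof -
  define rs where "rs = map real_of_rat qs"
  have rs: "length rs = k" "\<And>j. j < k \<Longrightarrow> rs ! j = a j" by (auto simp: rs_def k_def a_def)
  define v where "v l = (\<Sum>j<l. a j *\<^sub>R x (\<iota> (n j)))" for l
  define D where "D l = T (drop l rs) (v l)" for l
  have step: "\<bar>D (Suc l) - D l\<bar> \<le> (1/2) ^ m" if l: "l < k" for l
  proof -
    define js where "js = map (\<iota> \<circ> n) [0..<l]"
    have "n j < n l" if "j < l" for j using n l that by (auto simp: strict_mono_on_def)
    then have js: "set js \<subseteq> set (map \<iota> [0..<n l])" "length js = l" by (auto simp: js_def)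
    have "to_nat qs < n l" using m(1)[OF l] m(2) by simp
    then have "step_error (map real_of_rat (from_nat (to_nat qs))) js (\<iota> (n l)) < (1/2) ^ n l"
      using good_choice_\<iota>[of "n l", unfolded good_choice_def, rule_format, of "to_nat qs" js] js l
      by (simp add: k_def)
    then have "step_error rs js (\<iota> (n l)) < (1/2) ^ n l" by (simp add: rs_def)
    moreover have "(\<Sum>j<l. (rs ! j) *\<^sub>R x (js ! j)) = v l"
      unfolding v_def using l rs by (intro sum.cong) (auto simp: js_def)
    ultimately have "\<bar>D (Suc l) - D l\<bar> < (1/2) ^ n l" using rs l by (simp add: D_def v_def step_error_def js)
    also have "(1/2 :: real) ^ n l \<le> (1/2) ^ m" using m(1)[OF l] by (intro power_decreasing) auto
    finally show ?thesis by simp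
  qed
  have "\<bar>D l - D 0\<bar> \<le> real l * (1/2) ^ m" if "l \<le> k" for l
    using that
  proof (induction l)
    case (Suc l)
    then have "\<bar>D l - D 0\<bar> \<le> real l * (1/2) ^ m" "\<bar>D (Suc l) - D l\<bar> \<le> (1/2) ^ m"
      using step by auto
    then show ?case by (simp add: distrib_right)
  qed simp
  from this[of k] have "\<bar>D k - D 0\<bar> \<le> real k * (1/2) ^ m" by simp
  moreover have "D k = p (\<Sum>j<k. a j *\<^sub>R x (\<iota> (n j)))" by (simp add: D_def rs v_def)
  moreover have "rs = map a [0..<k]" by (rule nth_equalityI) (auto simp: rs)
  then have "D 0 = T (map a [0..<k]) 0" by (simp add: D_def v_def)
  ultimately show ?thesis by simp
qed

lemma sequence_approx:
  assumes \<delta>: "0 < \<delta>"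
  shows "\<exists>m. \<forall>n. strict_mono_on {..<k} n \<and> (\<forall>j<k. m \<le> n j) \<longrightarrow>
    \<bar>p (\<Sum>j<k. a j *\<^sub>R x (\<iota> (n j))) - T (map a [0..<k]) 0\<bar> < \<delta>"
proof -
  define e where "e = \<delta> / (4 * (real k + 1))"
  have e: "0 < e" "real k * e \<le> \<delta> / 4" using \<delta> by (auto simp: e_def field_simps)
  have "\<exists>q. \<bar>a j - real_of_rat q\<bar> < e" for j
  proof -
    obtain q where "a j < real_of_rat q" "real_of_rat q < a j + e" using of_rat_dense[of "a j" "a j + e"] e by auto
    then show ?thesis by (intro exI[of _ q]) auto
  qed
  then obtain q where q: "\<And>j. \<bar>a j - real_of_rat (q j)\<bar> < e" by metis
  define qs where "qs = map q [0..<k]"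
  define b where "b = (\<lambda>j. real_of_rat (qs ! j))"
  have ab: "(\<Sum>j<k. \<bar>a j - b j\<bar>) \<le> \<delta> / 4"
  proof -
    have "(\<Sum>j<k. \<bar>a j - b j\<bar>) \<le> (\<Sum>j<k. e)"
      using q by (intro sum_mono) (auto simp: b_def qs_def less_imp_le)
    then show ?thesis using e by simp
  qed
  have "\<forall>\<^sub>F m in sequentially. real k * (1/2) ^ m < \<delta> / 4"
  proof (rule order_tendstoD(2))
    show "(\<lambda>m. real k * (1/2) ^ m) \<longlonglongrightarrow> real k * 0" by (intro tendsto_mult_left LIMSEQ_realpow_zero) auto
  qed (use \<delta> in simp)
  then obtain m0 where m0: "\<And>m. m0 \<le> m \<Longrightarrow> real k * (1/2) ^ m < \<delta> / 4" by (auto simp: eventually_sequentially)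
  define m where "m = max m0 (Suc (to_nat qs))"
  have "\<bar>p (\<Sum>j<k. a j *\<^sub>R x (\<iota> (n j))) - T (map a [0..<k]) 0\<bar> < \<delta>"
    if n: "strict_mono_on {..<k} n" "\<And>j. j < k \<Longrightarrow> m \<le> n j" for n
  proof -
    have "\<bar>p (\<Sum>j<k. b j *\<^sub>R x (\<iota> (n j))) - T (map b [0..<k]) 0\<bar> \<le> real k * (1/2) ^ m"
      using sequence_rational_approx[of qs n m] n by (simp add: qs_def m_def b_def)
    also have "\<dots> < \<delta> / 4" by (rule m0) (simp add: m_def)
    finally have 1: "\<bar>p (\<Sum>j<k. b j *\<^sub>R x (\<iota> (n j))) - T (map b [0..<k]) 0\<bar> < \<delta> / 4" .
    have 2: "\<bar>T (map a [0..<k]) 0 - T (map b [0..<k]) 0\<bar> \<le> \<delta> / 4"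
      using iterated_norm_perturb ab order_trans by blast
    have "\<bar>p (\<Sum>j<k. a j *\<^sub>R x (\<iota> (n j))) - p (\<Sum>j<k. b j *\<^sub>R x (\<iota> (n j)))\<bar>
        \<le> p (\<Sum>j<k. (a j - b j) *\<^sub>R x (\<iota> (n j)))"
      using seminorm_triangle_diff[OF seminorm] by (simp add: scaleR_diff_left sum_subtractf)
    also have "\<dots> \<le> (\<Sum>j<k. \<bar>a j - b j\<bar>)" by (rule sum_in_ball)
    finally have "\<bar>p (\<Sum>j<k. a j *\<^sub>R x (\<iota> (n j))) - p (\<Sum>j<k. b j *\<^sub>R x (\<iota> (n j)))\<bar> \<le> \<delta> / 4"
      using ab by linarith
    with 1 2 \<delta> show ?thesis by linarith
  qed
  then show ?thesis by blast
qed

end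

section \<open>Lower estimates for spreading sequences\<close>
lemma le_if_multiples_le:
  fixes x y c :: real
  assumes "\<And>L::nat. 0 < L \<Longrightarrow> real L * x \<le> real L * y + c"
  shows "x \<le> y"
proof (rule ccontr)
  assume "\<not> x \<le> y"
  then obtain L :: nat where L: "\<bar>c\<bar> + 1 < real L * (x - y)"
    using reals_Archimedean3[of "x - y"] by (metis diff_gt_0_iff_gt not_le)
  then have "0 < L" by (cases "L = 0") auto
  from assms[OF this] L show False by (simp add: algebra_simps)
qed

text \<open>The coefficients \<open>a\<^sub>0, - a\<^sub>0, a\<^sub>1, - a\<^sub>1, \<dots>\<close>.\<close>
definition alternate :: "(nat \<Rightarrow> real) \<Rightarrow> nat \<Rightarrow> real" where
  "alternate a i = (if even i then a (i div 2) else - a (i div 2))"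

lemma sum_pairs:
  fixes f :: "nat \<Rightarrow> 'v::real_vector"
  shows "(\<Sum>j<k. a j *\<^sub>R (f (2 * j) - f (2 * j + 1))) = (\<Sum>i<2 * k. alternate a i *\<^sub>R f i)"
  by (induction k) (simp_all add: alternate_def algebra_simps)

locale spreading_sequence =
  fixes N :: "'v::real_vector \<Rightarrow> real" and e :: "nat \<Rightarrow> 'v"
  assumes N_seminorm: "seminorm N"
    and spreading: "\<And>k a n. strict_mono_on {..<k} n \<Longrightarrow>
      N (\<Sum>j<k. a j *\<^sub>R e (n j)) = N (\<Sum>j<k. a j *\<^sub>R e j)"
begin

definition u :: "nat \<Rightarrow> 'v" where "u j = e (2 * j) - e (2 * j + 1)"

lemma N_e: "N (e j) = N (e 0)"
proof -
  have "strict_mono_on {..<1::nat} (\<lambda>_. j)" by (auto simp: strict_mono_on_def)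
  from spreading[OF this, of "\<lambda>_. 1"] show ?thesis by simp
qed

lemma N_diff_e: "N (e i - e j) \<le> 2 * N (e 0)"
  using seminorm_diff[OF N_seminorm, of "e i" "e j"] by (simp add: N_e[of i] N_e[of j])

text \<open>
  Move the terms after position \<open>i + 1\<close> by \<open>L\<close>. The pair may then be placed at \<open>L\<close> different places
  in the gap without changing the norm. The average
  over these places telescopes, so that the contribution of the pair tends to \<open>0\<close> as \<open>L\<close> grows.
\<close>
lemma cancelling_pair_removable:
  assumes i: "Suc i < K" and b: "b (Suc i) = - b i"
  shows "N (\<Sum>j<K. (b(i := 0, Suc i := 0)) j *\<^sub>R e j) \<le> N (\<Sum>j<K. b j *\<^sub>R e j)" (is "?R \<le> ?Z")
proof (rule le_if_multiples_le)
  fix L :: nat assume L: "0 < L"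
  define b' where "b' = b(i := 0, Suc i := 0)"
  define m where "m j = (if j < i then j else j + L)" for j
  \<comment> \<open>the pair at the positions \<open>i + l\<close> and \<open>i + l + 1\<close>, the later terms moved by \<open>L\<close>\<close>
  define n where "n l j = (if j = i then i + l else if j = Suc i then i + Suc l else m j)" for l j
  define R where "R = (\<Sum>j<K. b' j *\<^sub>R e (m j))"
  have m: "strict_mono_on {..<K} m" by (auto simp: strict_mono_on_def m_def)
  have n: "strict_mono_on {..<K} (n l)" if "l < L" for l
    using that by (auto simp: strict_mono_on_def n_def m_def)
  have R: "N R = ?R" unfolding R_def b'_def by (rule spreading[OF m])
  have W: "(\<Sum>j<K. b j *\<^sub>R e (n l j)) = R + b i *\<^sub>R (e (i + l) - e (i + Suc l))" for l
  proof -
    have "(\<Sum>j<K. b j *\<^sub>R e (n l j)) = (\<Sum>j<K. b' j *\<^sub>R e (m j)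
        + (if j = i then b i *\<^sub>R e (i + l) else 0) + (if j = Suc i then - (b i *\<^sub>R e (i + Suc l)) else 0))"
      by (rule sum.cong) (auto simp: n_def b'_def b)
    then show ?thesis using i by (simp add: sum.distrib R_def scaleR_diff_right)
  qed
  have "(\<Sum>l<L. \<Sum>j<K. b j *\<^sub>R e (n l j)) = real L *\<^sub>R R + b i *\<^sub>R (\<Sum>l<L. e (i + l) - e (i + Suc l))"
    by (simp only: W sum.distrib scaleR_sum_right[symmetric]) (simp add: sum_constant_scaleR)
  also have "(\<Sum>l<L. e (i + l) - e (i + Suc l)) = e i - e (i + L)"
    using sum_lessThan_telescope'[of "\<lambda>l. e (i + l)" L] by simp
  finally have "real L *\<^sub>R R = (\<Sum>l<L. \<Sum>j<K. b j *\<^sub>R e (n l j)) - b i *\<^sub>R (e i - e (i + L))"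
    by simp
  then have "N (real L *\<^sub>R R) \<le> N (\<Sum>l<L. \<Sum>j<K. b j *\<^sub>R e (n l j)) + N (b i *\<^sub>R (e i - e (i + L)))"
    by (simp add: seminorm_diff[OF N_seminorm])
  also have "N (\<Sum>l<L. \<Sum>j<K. b j *\<^sub>R e (n l j)) \<le> (\<Sum>l<L. N (\<Sum>j<K. b j *\<^sub>R e (n l j)))"
    by (rule seminorm_sum_le[OF N_seminorm])
  also have "\<dots> = (\<Sum>l<L. ?Z)" by (rule sum.cong) (simp_all add: spreading[OF n])
  also have "N (b i *\<^sub>R (e i - e (i + L))) \<le> \<bar>b i\<bar> * (2 * N (e 0))"
    unfolding seminorm_scaleR[OF N_seminorm] by (intro mult_left_mono N_diff_e) simp
  finally show "real L * ?R \<le> real L * ?Z + \<bar>b i\<bar> * (2 * N (e 0))"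
    by (simp add: seminorm_scaleR[OF N_seminorm] R)
qed

lemma u_sum: "(\<Sum>j<k. a j *\<^sub>R u j) = (\<Sum>i<2 * k. alternate a i *\<^sub>R e i)"
  unfolding u_def by (rule sum_pairs)

text \<open>Suppression unconditionality of the differences: pairs are removed one at a time.\<close>
lemma u_suppression:
  assumes "finite A"
  shows "N (\<Sum>j<k. (if j \<in> A then 0 else a j) *\<^sub>R u j) \<le> N (\<Sum>j<k. a j *\<^sub>R u j)"
  using assms
proof (induction A rule: finite_induct)
  case (insert i A)
  let ?a = "\<lambda>j. if j \<in> A then 0 else a j" and ?a' = "\<lambda>j. if j \<in> insert i A then 0 else a j"
  have "N (\<Sum>j<k. ?a' j *\<^sub>R u j) \<le> N (\<Sum>j<k. ?a j *\<^sub>R u j)"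
  proof (cases "i < k")
    case True
    let ?b = "alternate ?a"
    have "alternate ?a' = ?b(2 * i := 0, Suc (2 * i) := 0)"
      by (rule ext) (auto simp: alternate_def elim: oddE)
    then show ?thesis
      unfolding u_sum using cancelling_pair_removable[of "2 * i" "2 * k" ?b] True
      by (simp add: alternate_def)
  next
    case False
    then have "(\<Sum>j<k. ?a' j *\<^sub>R u j) = (\<Sum>j<k. ?a j *\<^sub>R u j)" by (intro sum.cong) auto
    then show ?thesis by simp
  qed
  then show ?case using insert.IH by linarith
qed simp

lemma u_shift: "N (\<Sum>j<k. a j *\<^sub>R u (j + s)) = N (\<Sum>j<k. a j *\<^sub>R u j)"
proof -
  have "(\<Sum>j<k. a j *\<^sub>R u (j + s)) = (\<Sum>i<2 * k. alternate a i *\<^sub>R e (i + 2 * s))"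
    using sum_pairs[of a "\<lambda>i. e (i + 2 * s)" k] by (simp add: u_def algebra_simps)
  moreover have "strict_mono_on {..<2 * k} (\<lambda>i. i + 2 * s)" by (auto simp: strict_mono_on_def)
  ultimately show ?thesis using spreading[of "2 * k" "\<lambda>i. i + 2 * s"] by (simp add: u_sum)
qed

text \<open>
  All translates of the combination have the same norm. For nonnegative coefficients the sum of the
  first \<open>L\<close> translates is, up to an error that does not depend on \<open>L\<close>, the multiple by \<open>\<Sum> a\<^sub>j\<close> of
  \<open>\<Sum>j<L. u j\<close>.
\<close>
lemma u_nonneg_lower_bound:
  assumes c: "\<And>L. c * real L \<le> N (\<Sum>j<L. u j)" and a: "\<And>j. 0 \<le> a j"
  shows "c * (\<Sum>j<k. a j) \<le> N (\<Sum>j<k. a j *\<^sub>R u j)" (is "_ \<le> ?Z")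
proof (rule le_if_multiples_le)
  fix L :: nat
  define V where "V = (\<Sum>s<L. u s)"
  define err where "err j = (\<Sum>s<L. u (j + s)) - V" for j
  have Nu: "N (u j) \<le> 2 * N (e 0)" for j unfolding u_def by (rule N_diff_e)
  have err: "N (err j) \<le> real j * (4 * N (e 0))" for j
  proof (induction j)
    case 0
    show ?case by (simp add: err_def V_def seminorm_zero[OF N_seminorm])
  next
    case (Suc j)
    have "(\<Sum>s<L. u (Suc j + s)) = (\<Sum>s<L. u (j + s)) + (u (j + L) - u j)"
      using sum.lessThan_Suc_shift[of "\<lambda>s. u (j + s)" L] by (simp add: algebra_simps)
    then have "err (Suc j) = err j + (u (j + L) - u j)" by (simp add: err_def)
    then have "N (err (Suc j)) \<le> N (err j) + (N (u (j + L)) + N (u j))"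
      using seminorm_triangle[OF N_seminorm, of "err j" "u (j + L) - u j"]
        seminorm_diff[OF N_seminorm, of "u (j + L)" "u j"] by simp
    then show ?case using Suc Nu[of "j + L"] Nu[of j] by (simp add: distrib_right)
  qed
  have "(\<Sum>s<L. \<Sum>j<k. a j *\<^sub>R u (j + s)) = (\<Sum>j<k. a j *\<^sub>R (V + err j))"
    unfolding err_def by (subst sum.swap) (simp add: scaleR_sum_right)
  also have "\<dots> = (\<Sum>j<k. a j) *\<^sub>R V + (\<Sum>j<k. a j *\<^sub>R err j)"
    by (simp add: scaleR_add_right sum.distrib scaleR_sum_left)
  finally have "(\<Sum>j<k. a j) *\<^sub>R V = (\<Sum>s<L. \<Sum>j<k. a j *\<^sub>R u (j + s)) - (\<Sum>j<k. a j *\<^sub>R err j)"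
    by simp
  then have "N ((\<Sum>j<k. a j) *\<^sub>R V) \<le> N (\<Sum>s<L. \<Sum>j<k. a j *\<^sub>R u (j + s)) + N (\<Sum>j<k. a j *\<^sub>R err j)"
    by (simp add: seminorm_diff[OF N_seminorm])
  also have "N (\<Sum>s<L. \<Sum>j<k. a j *\<^sub>R u (j + s)) \<le> (\<Sum>s<L. ?Z)"
    using seminorm_sum_le[OF N_seminorm, of "\<lambda>s. \<Sum>j<k. a j *\<^sub>R u (j + s)" "{..<L}"] by (simp add: u_shift)
  also have "N (\<Sum>j<k. a j *\<^sub>R err j) \<le> (\<Sum>j<k. a j * (real j * (4 * N (e 0))))"
    by (rule order_trans[OF seminorm_sum_le[OF N_seminorm] sum_mono])
      (use a err in \<open>auto simp: seminorm_scaleR[OF N_seminorm] intro!: mult_left_mono\<close>)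
  finally have "(\<Sum>j<k. a j) * N V \<le> real L * ?Z + (\<Sum>j<k. a j * (real j * (4 * N (e 0))))"
    using a by (simp add: seminorm_scaleR[OF N_seminorm] sum_nonneg)
  moreover have "(\<Sum>j<k. a j) * (c * real L) \<le> (\<Sum>j<k. a j) * N V"
    unfolding V_def by (intro mult_left_mono c sum_nonneg) (use a in auto)
  ultimately show "real L * (c * (\<Sum>j<k. a j)) \<le> real L * ?Z + (\<Sum>j<k. a j * (real j * (4 * N (e 0))))"
    by (simp add: mult.commute mult.left_commute)
qed

text \<open>
  By suppression, the norm dominates those of the positive and of the negative part; this costs the
  factor \<open>2\<close>.
\<close>
lemma u_lower_bound:
  assumes c: "\<And>L. c * real L \<le> N (\<Sum>j<L. u j)"
  shows "c / 2 * (\<Sum>j<k. \<bar>a j\<bar>) \<le> N (\<Sum>j<k. a j *\<^sub>R u j)"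
proof -
  have half: "c * (\<Sum>j<k. max 0 (a j)) \<le> N (\<Sum>j<k. a j *\<^sub>R u j)" for a
  proof -
    have "(\<Sum>j<k. max 0 (a j) *\<^sub>R u j) = (\<Sum>j<k. (if j \<in> {j\<in>{..<k}. a j < 0} then 0 else a j) *\<^sub>R u j)"
      by (rule sum.cong) auto
    also have "N \<dots> \<le> N (\<Sum>j<k. a j *\<^sub>R u j)" by (rule u_suppression) simp
    finally show ?thesis using u_nonneg_lower_bound[OF c, of "\<lambda>j. max 0 (a j)" k] by simp
  qed
  have "(\<Sum>j<k. - a j *\<^sub>R u j) = - (\<Sum>j<k. a j *\<^sub>R u j)" by (simp add: sum_negf)
  then have "c * (\<Sum>j<k. max 0 (- a j)) \<le> N (\<Sum>j<k. a j *\<^sub>R u j)"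
    using half[of "\<lambda>j. - a j"] by (simp add: seminorm_minus[OF N_seminorm])
  moreover have "(\<Sum>j<k. \<bar>a j\<bar>) = (\<Sum>j<k. max 0 (a j)) + (\<Sum>j<k. max 0 (- a j))"
    unfolding sum.distrib[symmetric] by (rule sum.cong) auto
  ultimately show ?thesis using half[of a] by (simp add: algebra_simps)
qed

end

section \<open>From separating maps to spreading models\<close>
definition semi_generates_spreading_model ::
  "('v::real_vector \<Rightarrow> real) \<Rightarrow> (nat \<Rightarrow> 'v) \<Rightarrow> ('e::real_vector \<Rightarrow> real) \<Rightarrow> (nat \<Rightarrow> 'e) \<Rightarrow> bool" where
  "semi_generates_spreading_model p x N e \<longleftrightarrow>
     (\<exists>B. \<forall>n. p (x n) \<le> B) \<and>
     (\<forall>(k::nat) (a :: nat \<Rightarrow> real). \<forall>\<delta>>0. \<exists>m. \<forall>n :: nat \<Rightarrow> nat.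
        strict_mono_on {..<k} n \<and> (\<forall>j<k. m \<le> n j) \<longrightarrow>
        \<bar>p (\<Sum>j<k. a j *\<^sub>R x (n j)) - N (\<Sum>j<k. a j *\<^sub>R e j)\<bar> < \<delta>)"

definition semi_l1_spreading_model :: "('v::real_vector \<Rightarrow> real) \<Rightarrow> bool" where
  "semi_l1_spreading_model p \<longleftrightarrow>
     (\<exists>(x :: nat \<Rightarrow> 'v) (N :: (nat \<Rightarrow>\<^sub>0 real) \<Rightarrow> real) e.
        seminorm N \<and> semi_generates_spreading_model p x N e \<and> equivalent_to_l1_basis N e)"

context unit_ball_family
begin

abbreviation unit :: "nat \<Rightarrow> (nat \<Rightarrow>\<^sub>0 real)" where "unit j \<equiv> Poly_Mapping.single j 1"

lemma N_unit_sum: "N (\<Sum>j<k. a j *\<^sub>R unit j) = T (map a [0..<k]) 0"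
  using N_spreading[of k "\<lambda>j. j" a] by (simp add: strict_mono_on_def)

sublocale spreading_sequence N unit
  by unfold_locales (simp_all add: seminorm_N N_unit_sum N_spreading)

text \<open>
  The sequence in question consists of differences of consecutive members of the sequence \<open>x (\<iota> n)\<close>, and
  the vectors \<open>u j\<close> play the role of the basis.
\<close>
lemma l1_spreading_model_if_alternating_large:
  assumes c: "0 < c" "\<And>k. c * real k \<le> T (map (alternate (\<lambda>_. 1)) [0..<2 * k]) 0"
  shows "semi_l1_spreading_model p"
proof -
  define y where "y n = x (\<iota> (2 * n)) - x (\<iota> (2 * n + 1))" for n
  have N_u: "N (\<Sum>j<k. a j *\<^sub>R u j) = T (map (alternate a) [0..<2 * k]) 0" for k a
    unfolding u_sum by (rule N_unit_sum)
  have low: "c * real k \<le> N (\<Sum>j<k. u j)" for k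
    using c(2)[of k] N_u[of "\<lambda>_. 1" k] by simp
  have equiv: "equivalent_to_l1_basis N u"
    unfolding equivalent_to_l1_basis_def using u_lower_bound[OF low] c(1) by (intro exI[of _ "c / 2"]) simp
  have bound: "p (y n) \<le> 2" for n
    using seminorm_diff[OF seminorm, of "x (\<iota> (2 * n))" "x (\<iota> (2 * n + 1))"]
      in_ball[of "\<iota> (2 * n)"] in_ball[of "\<iota> (2 * n + 1)"] by (simp add: y_def)
  have generate: "\<exists>m. \<forall>n. strict_mono_on {..<k} n \<and> (\<forall>j<k. m \<le> n j) \<longrightarrow>
      \<bar>p (\<Sum>j<k. a j *\<^sub>R y (n j)) - N (\<Sum>j<k. a j *\<^sub>R u j)\<bar> < \<delta>" if \<delta>: "0 < \<delta>" for k a \<delta>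
  proof -
    obtain m where m: "\<forall>n. strict_mono_on {..<2 * k} n \<and> (\<forall>j<2 * k. m \<le> n j) \<longrightarrow>
      \<bar>p (\<Sum>j<2 * k. alternate a j *\<^sub>R x (\<iota> (n j))) - T (map (alternate a) [0..<2 * k]) 0\<bar> < \<delta>"
      using sequence_approx[OF \<delta>, of "2 * k" "alternate a"] by (rule exE)
    have "\<bar>p (\<Sum>j<k. a j *\<^sub>R y (n j)) - N (\<Sum>j<k. a j *\<^sub>R u j)\<bar> < \<delta>"
      if n: "strict_mono_on {..<k} n" "\<And>j. j < k \<Longrightarrow> m \<le> n j" for n
    proof -
      \<comment> \<open>the pairs of consecutive indices that belong to the terms \<open>y (n j)\<close>\<close>
      define n' where "n' i = 2 * n (i div 2) + i mod 2" for i
      have "strict_mono_on {..<2 * k} n'"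
      proof (rule strict_mono_onI)
        fix r s assume rs: "r \<in> {..<2 * k}" "s \<in> {..<2 * k}" "r < s"
        show "n' r < n' s"
        proof (cases "r div 2 = s div 2")
          case True
          then have "r mod 2 < s mod 2" using rs(3) by presburger
          then show ?thesis using True by (simp add: n'_def)
        next
          case False
          then have "r div 2 < s div 2" using rs(3) by (simp add: div_le_mono le_neq_implies_less)
          moreover have "r div 2 < k" "s div 2 < k" using rs by auto
          ultimately have "n (r div 2) < n (s div 2)" using n(1) by (auto simp: strict_mono_on_def)
          moreover have "r mod 2 < 2" by simp
          ultimately show ?thesis unfolding n'_def by linarith
        qed
      qed
      moreover have "m \<le> n' i" if "i < 2 * k" for i
        using n(2)[of "i div 2"] that by (simp add: n'_def less_mult_imp_div_less)
      ultimately have "\<bar>p (\<Sum>i<2 * k. alternate a i *\<^sub>R x (\<iota> (n' i))) - N (\<Sum>j<k. a j *\<^sub>R u j)\<bar> < \<delta>"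
        unfolding N_u by (intro m[rule_format]) auto
      moreover have "(\<Sum>i<2 * k. alternate a i *\<^sub>R x (\<iota> (n' i))) = (\<Sum>j<k. a j *\<^sub>R y (n j))"
        using sum_pairs[of a "\<lambda>i. x (\<iota> (n' i))" k] by (simp add: n'_def y_def)
      ultimately show ?thesis by simp
    qed
    then show ?thesis by blast
  qed
  have "semi_generates_spreading_model p y N u"
    unfolding semi_generates_spreading_model_def using bound generate by blast
  then show ?thesis unfolding semi_l1_spreading_model_def using seminorm_N equiv by blast
qed

text \<open>
  Only the first \<open>k\<close> entries are read, whatever the length of the list, so that \<open>S k\<close> is bounded on
  the whole type.
\<close>
definition S :: "nat \<Rightarrow> 'i list \<Rightarrow> 'v" where "S k xs = (\<Sum>j<k. x (xs ! j))"

lemma S_Cons: "S (Suc k) (i # xs) = x i + S k xs"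
  unfolding S_def by (subst sum.lessThan_Suc_shift) simp

lemma S_bound: "p (S k xs) \<le> real k"
proof -
  have "(\<Sum>j<k. p (x (xs ! j))) \<le> real (card {..<k}) * 1" by (rule sum_bounded_above) (rule in_ball)
  then show ?thesis
    unfolding S_def using seminorm_sum_le[OF seminorm, of "\<lambda>j. x (xs ! j)" "{..<k}"] by simp
qed

lemma interlaced_difference_tendsto:
  "((\<lambda>zs. p (v + (S k (evens zs) - S k (odds zs)))) \<longlongrightarrow> T (map (alternate (\<lambda>_. 1)) [0..<2 * k]) v)
     (power_filter U (2 * k))"
proof (induction k arbitrary: v)
  case 0
  show ?case by (auto simp: S_def intro!: tendsto_power_filter_0 simp del: power_filter.simps)
next
  case (Suc k)
  have "((\<lambda>zs. p (v + (S (Suc k) (evens (n # m # zs)) - S (Suc k) (odds (n # m # zs))))) \<longlongrightarrow>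
      T (map (alternate (\<lambda>_. 1)) [0..<2 * k]) (v + 1 *\<^sub>R x n + (-1) *\<^sub>R x m)) (power_filter U (2 * k))" for n m
    using Suc.IH[of "v + 1 *\<^sub>R x n + (-1) *\<^sub>R x m"] by (simp add: S_Cons algebra_simps)
  then have "((\<lambda>zs. p (v + (S (Suc k) (evens zs) - S (Suc k) (odds zs)))) \<longlongrightarrow>
      T (1 # -1 # map (alternate (\<lambda>_. 1)) [0..<2 * k]) v) (power_filter U (Suc (Suc (2 * k))))"
    by (intro tendsto_power_filter_Suc[OF tendsto_power_filter_Suc iterated_norm_tendsto, OF _ iterated_norm_tendsto]) 
  moreover have "map (alternate (\<lambda>_. 1)) [0..<Suc (Suc (2 * k))] = 1 # -1 # map (alternate (\<lambda>_. 1)) [0..<2 * k]"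
    by (simp add: map_upt_Suc alternate_def del: upt_Suc)
  ultimately show ?case by (simp del: upt_Suc power_filter.simps)
qed

lemma functional_S_tendsto:
  assumes f: "linear f" "((\<lambda>i. f (x i)) \<longlongrightarrow> L) U"
  shows "((\<lambda>xs. f (S k xs)) \<longlongrightarrow> real k * L) (power_filter U k)"
proof (induction k)
  case 0
  show ?case by (auto simp: S_def linear_0[OF f(1)] intro!: tendsto_power_filter_0 simp del: power_filter.simps)
next
  case (Suc k)
  show ?case
  proof (rule tendsto_power_filter_Suc)
    show "((\<lambda>xs. f (S (Suc k) (i # xs))) \<longlongrightarrow> f (x i) + real k * L) (power_filter U k)" for i
      unfolding S_Cons linear_add[OF f(1)] by (intro tendsto_intros Suc.IH)
    show "((\<lambda>i. f (x i) + real k * L) \<longlongrightarrow> real (Suc k) * L) U"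
      using tendsto_add[OF f(2) tendsto_const[of "real k * L"]] by (simp add: algebra_simps)
  qed
qed

text \<open>
  The vectors \<open>S k xs\<close> converge weak* to \<open>k \<Psi>\<close>. As \<open>\<Psi>\<close> is at distance more than \<open>\<tau>\<close> from \<open>v / k\<close>, a
  functional witnessing this bounds the limit of \<open>p (v - S k xs)\<close> from below.
\<close>
lemma far_functional_difference:
  assumes \<Psi>: "\<And>f. f \<in> semi_dual p \<Longrightarrow> ((\<lambda>i. f (x i)) \<longlongrightarrow> \<Psi> f) U"
    and far: "\<And>v. \<not> bidual_near p \<Psi> v \<tau>" and k: "0 < k" and \<tau>: "0 < \<tau>"
    and l: "((\<lambda>xs. p (v - S k xs)) \<longlongrightarrow> l) (power_filter U k)"
  shows "real k * \<tau> \<le> l"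
proof -
  let ?W = "power_filter U k"
  have nb: "?W \<noteq> bot" by (intro ultrafilter_not_bot ultrafilter_power_filter ultrafilter)
  obtain f L where f: "linear f" "0 \<le> L" "\<And>y. \<bar>f y\<bar> \<le> L * p y"
    and fL: "\<tau> * L < \<bar>\<Psi> f - f ((1 / real k) *\<^sub>R v)\<bar>"
    using far[of "(1 / real k) *\<^sub>R v"] unfolding bidual_near_def not_le[symmetric] by blast
  have "f \<in> semi_dual p" using f by (intro semi_dualI)
  from \<Psi>[OF this] have lim: "((\<lambda>xs. \<bar>f v - f (S k xs)\<bar>) \<longlongrightarrow> \<bar>f v - real k * \<Psi> f\<bar>) ?W"
    by (intro tendsto_intros functional_S_tendsto f(1))
  have "((\<lambda>xs. L * p (v - S k xs)) \<longlongrightarrow> L * l) ?W" by (intro tendsto_intros l)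
  then have "\<bar>f v - real k * \<Psi> f\<bar> \<le> L * l"
    by (rule tendsto_le[OF nb _ lim]) (use f(3) in \<open>simp add: linear_diff[OF f(1), symmetric]\<close>)
  moreover have "f v - real k * \<Psi> f = - (real k * (\<Psi> f - f ((1 / real k) *\<^sub>R v)))"
    using k by (simp add: linear_scale[OF f(1)] field_simps)
  then have "\<bar>f v - real k * \<Psi> f\<bar> = real k * \<bar>\<Psi> f - f ((1 / real k) *\<^sub>R v)\<bar>" by (simp add: abs_mult)
  ultimately have *: "real k * (\<tau> * L) < L * l" using fL k by (smt (verit) mult_strict_left_mono of_nat_0_less_iff)
  then have "L \<noteq> 0" by auto
  then have "0 < L" using f(2) by simp
  then show ?thesis using * by (simp add: mult.commute mult.left_commute less_imp_le)
qed

end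

text \<open>
  Both hypotheses on maps reduce to this one. The factor \<open>3\<close> leaves room for property Q, which
  yields a diameter slightly larger than \<open>2 \<omega>\<close>. The open condition on \<open>p (x - y)\<close>, in place of an
  exact distance, is stable under limits and hence passes to ultrapowers.
\<close>
definition ball_separating :: "('v::real_vector \<Rightarrow> real) \<Rightarrow> ('w::real_vector \<Rightarrow> real) \<Rightarrow> ('v \<Rightarrow> 'w) \<Rightarrow> bool" where
  "ball_separating p q \<phi> \<longleftrightarrow>
     (\<exists>t \<delta> \<eta> \<omega> B. 0 < t \<and> t < 1 \<and> 0 < \<delta> \<and> 0 < \<eta> \<and> 0 < \<omega> \<and>
        (\<forall>x. p x \<le> 1 \<longrightarrow> q (\<phi> x) \<le> B) \<and>
        (\<forall>x y. p x \<le> 1 \<longrightarrow> p y \<le> 1 \<longrightarrow> p (x - y) < \<delta> \<longrightarrow> q (\<phi> x - \<phi> y) \<le> \<omega>) \<and>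
        (\<forall>x y. p x \<le> 1 \<longrightarrow> p y \<le> 1 \<longrightarrow> \<bar>p (x - y) - t\<bar> < \<eta> \<longrightarrow> 3 * \<omega> \<le> q (\<phi> x - \<phi> y)))"

text \<open>
  If there is no \<open>\<ell>\<^sub>1\<close>-spreading model, then the alternating sums of some length \<open>2 k\<close> have norm less
  than \<open>\<delta> k\<close>. Multiplied by \<open>r = t / C\<close>, where \<open>C \<ge> k \<tau>\<close> is the limit distance of sums over successive
  tuples, sums over interlaced tuples are within \<open>\<delta>\<close> of each other, those over successive tuples
  are about \<open>t\<close> apart, and all are in the unit ball since \<open>t < \<tau>\<close>. Property Q for the composition
  with \<open>\<phi>\<close> then contradicts the separation of points at distance about \<open>t\<close>.
\<close>
theorem l1_spreading_model_of_ball_separating: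
  fixes p :: "'v::banach \<Rightarrow> real" and q :: "'w::real_vector \<Rightarrow> real"
  assumes p: "quotient_seminorm p" "\<not> semi_reflexive p"
    and q: "seminorm q" "semi_reflexive q" and \<phi>: "ball_separating p q \<phi>"
  shows "semi_l1_spreading_model p"
proof -
  obtain t \<delta> \<eta> \<omega> B where t: "0 < t" "t < 1" and pos: "0 < \<delta>" "0 < \<eta>" "0 < \<omega>"
    and B: "\<And>x. p x \<le> 1 \<Longrightarrow> q (\<phi> x) \<le> B"
    and near: "\<And>x y. p x \<le> 1 \<Longrightarrow> p y \<le> 1 \<Longrightarrow> p (x - y) < \<delta> \<Longrightarrow> q (\<phi> x - \<phi> y) \<le> \<omega>"
    and sep: "\<And>x y. p x \<le> 1 \<Longrightarrow> p y \<le> 1 \<Longrightarrow> \<bar>p (x - y) - t\<bar> < \<eta> \<Longrightarrow> 3 * \<omega> \<le> q (\<phi> x - \<phi> y)"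
    using \<phi> unfolding ball_separating_def by metis
  have sp: "seminorm p" using p by (simp add: quotient_seminorm_def)
  \<comment> \<open>any number strictly between \<open>t\<close> and \<open>1\<close>\<close>
  define \<tau> where "\<tau> = (1 + t) / 2"
  have \<tau>: "t < \<tau>" "\<tau> < 1" "0 < \<tau>" using t by (auto simp: \<tau>_def)
  obtain \<Psi> where \<Psi>: "\<Psi> \<in> semi_bidual p 1" "\<And>x. \<not> bidual_near p \<Psi> x \<tau>"
    using nonreflexive_far_functional[OF p \<tau>(3,2)] by blast
  obtain U :: "'v filter" and x :: "'v \<Rightarrow> 'v"
    where U: "ultrafilter U" "\<And>i. p (x i) \<le> 1" "\<And>f. f \<in> semi_dual p \<Longrightarrow> ((\<lambda>i. f (x i)) \<longlongrightarrow> \<Psi> f) U"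
    using Goldstine_ultrafilter[OF sp \<Psi>(1)] by blast
  interpret unit_ball_family p U x by unfold_locales (fact sp U)+
  show ?thesis
  proof (rule ccontr)
    assume no: "\<not> ?thesis"
    obtain k where k: "T (map (alternate (\<lambda>_. 1)) [0..<2 * k]) 0 < \<delta> * real k"
      using l1_spreading_model_if_alternating_large[OF pos(1)] no by (meson not_le)
    then have k0: "0 < k" using iterated_norm_bounds(1)[of "map (alternate (\<lambda>_. 1)) [0..<2 * k]" 0]
      by (cases "k = 0") auto
    let ?W = "power_filter U k" and ?D = "\<lambda>(\<sigma>, \<rho>). p (S k \<sigma> - S k \<rho>)"
    have W: "ultrafilter ?W" "ultrafilter (fubini_filter ?W ?W)"
      by (intro ultrafilter_fubini ultrafilter_power_filter U)+
    have Db: "\<bar>p (S k \<sigma> - S k \<rho>)\<bar> \<le> 2 * real k" for \<sigma> \<rho>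
      using seminorm_diff[OF sp, of "S k \<sigma>" "S k \<rho>"] S_bound[of k \<sigma>] S_bound[of k \<rho>] seminorm_nonneg[OF sp]
      by simp
    obtain C where C: "(?D \<longlongrightarrow> C) (fubini_filter ?W ?W)"
      by (rule ultrafilter_tendsto_bound[OF W(2), of ?D "2 * real k"]) (use Db in auto)
    have "\<exists>l. ((\<lambda>\<rho>. p (S k \<sigma> - S k \<rho>)) \<longlongrightarrow> l) ?W" for \<sigma>
      using ultrafilter_tendsto_bound[OF W(1), of "\<lambda>\<rho>. p (S k \<sigma> - S k \<rho>)" "2 * real k"] Db by blast
    then obtain G where G: "\<And>\<sigma>. ((\<lambda>\<rho>. p (S k \<sigma> - S k \<rho>)) \<longlongrightarrow> G \<sigma>) ?W" by metis
    have "(G \<longlongrightarrow> C) ?W"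
      by (rule tendsto_fubini_filterD[OF ultrafilter_not_bot[OF W(1)] _ C]) (simp add: G)
    then have Ck: "real k * \<tau> \<le> C"
    proof (rule tendsto_lowerbound)
      show "\<forall>\<^sub>F \<sigma> in ?W. real k * \<tau> \<le> G \<sigma>"
        using far_functional_difference[OF U(3) \<Psi>(2) k0 \<tau>(3) G] by simp
    qed (rule ultrafilter_not_bot[OF W(1)])
    have "0 < real k * \<tau>" using k0 \<tau> by simp
    with Ck have C0: "0 < C" by linarith
    define r where "r = t / C"
    have r: "0 < r" "r * C = t" using C0 t by (auto simp: r_def)
    have rk: "r * real k \<le> t / \<tau>"
    proof -
      have "r * (real k * \<tau>) \<le> t" using mult_left_mono[OF Ck, of r] r by simp
      then show ?thesis using \<tau> by (simp add: field_simps)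
    qed
    have t\<tau>: "t / \<tau> < 1" using \<tau> by simp
    define P where "P xs = r *\<^sub>R S k xs" for xs
    have P1: "p (P xs) \<le> 1" for xs
    proof -
      have "r * p (S k xs) \<le> r * real k" using r by (intro mult_left_mono S_bound) simp
      then have "r * p (S k xs) \<le> 1" using rk t\<tau> by linarith
      then show ?thesis using r by (simp add: P_def seminorm_scaleR[OF sp])
    qed
    have Pd: "p (P \<sigma> - P \<rho>) = r * p (S k \<sigma> - S k \<rho>)" for \<sigma> \<rho>
      using r by (simp add: P_def seminorm_scaleR[OF sp] flip: scaleR_diff_right)
    let ?f = "\<lambda>xs. \<phi> (P xs)"
    have inter: "\<forall>\<^sub>F zs in power_filter U (2 * k). q (?f (evens zs) - ?f (odds zs)) \<le> \<omega>"
    proof -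
      let ?A = "T (map (alternate (\<lambda>_. 1)) [0..<2 * k]) 0"
      have "((\<lambda>zs. r * p (0 + (S k (evens zs) - S k (odds zs)))) \<longlongrightarrow> r * ?A) (power_filter U (2 * k))"
        by (intro tendsto_intros interlaced_difference_tendsto)
      moreover have "r * ?A < \<delta>"
      proof -
        have "r * ?A < r * (\<delta> * real k)" using k r by (intro mult_strict_left_mono)
        also have "\<dots> = \<delta> * (r * real k)" by simp
        also have "\<dots> \<le> \<delta> * 1" using pos rk t\<tau> by (intro mult_left_mono) auto
        finally show ?thesis by simp
      qed
      ultimately have "\<forall>\<^sub>F zs in power_filter U (2 * k). r * p (0 + (S k (evens zs) - S k (odds zs))) < \<delta>"
        by (rule order_tendstoD(2))
      then show ?thesis
        by eventually_elim (rule near[OF P1 P1], simp add: Pd)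
    qed
    obtain y where y: "\<forall>\<^sub>F xs in ?W. q (?f xs - y) < 3 / 2 * \<omega>"
    proof (rule reflexive_property_Q[OF q U(1), where f = ?f and B = B and k = k and \<omega> = \<omega> and \<omega>' = "3 / 2 * \<omega>"])
      show "q (\<phi> (P xs)) \<le> B" for xs by (rule B[OF P1])
    qed (use inter pos in auto)
    have small: "\<forall>\<^sub>F z in fubini_filter ?W ?W. q (?f (fst z) - ?f (snd z)) < 3 * \<omega>"
      unfolding eventually_fubini_filter using y
    proof eventually_elim
      case (elim \<sigma>)
      show ?case using y
      proof eventually_elim
        case (elim \<rho>)
        have "q (?f \<sigma> - ?f \<rho>) = q ((?f \<sigma> - y) - (?f \<rho> - y))" by simp
        also have "\<dots> \<le> q (?f \<sigma> - y) + q (?f \<rho> - y)" by (rule seminorm_diff[OF q(1)])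
        finally show ?case using elim \<open>q (?f \<sigma> - y) < 3 / 2 * \<omega>\<close> by simp
      qed
    qed
    have "((\<lambda>z. r * ?D z) \<longlongrightarrow> t) (fubini_filter ?W ?W)"
      using tendsto_mult_left[OF C, of r] r by simp
    from tendstoD[OF this pos(2)]
    have "\<forall>\<^sub>F z in fubini_filter ?W ?W. \<bar>p (P (fst z) - P (snd z)) - t\<bar> < \<eta>"
      by eventually_elim (simp add: Pd dist_real_def split_beta)
    then have "\<forall>\<^sub>F z in fubini_filter ?W ?W. 3 * \<omega> \<le> q (?f (fst z) - ?f (snd z))"
      by eventually_elim (rule sep[OF P1 P1])
    from eventually_happens'[OF ultrafilter_not_bot[OF W(2)] eventually_conj[OF this small]]
    show False by auto
  qed
qed

section \<open>Ultrapowers as seminormed spaces of bounded families\<close>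

text \<open>
  The structure \<open>V\<close> is, via \<open>\<pi>\<close>, the quotient of a seminormed space by the kernel of the seminorm.
  Functionals on \<open>V\<close> correspond to functionals on \<open>'v\<close> bounded by a multiple of \<open>p\<close>, so that
  reflexivity of \<open>V\<close> can be read off from \<open>p\<close>.
\<close>
locale nspace_presentation =
  fixes V :: "'c nspace" and \<pi> :: "'v::real_vector \<Rightarrow> 'c" and p :: "'v \<Rightarrow> real"
  assumes seminorm: "seminorm p" and car: "car V = range \<pi>"
    and add: "add V (\<pi> x) (\<pi> y) = \<pi> (x + y)" and smul: "smul V c (\<pi> x) = \<pi> (c *\<^sub>R x)"
    and nrm: "nrm V (\<pi> x) = p x"
begin

lemma semi_dual_factors:
  assumes g: "g \<in> semi_dual p" and xy: "\<pi> x = \<pi> y"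
  shows "g x = g y"
proof -
  have "\<pi> (x + (-1) *\<^sub>R y) = \<pi> (y + (-1) *\<^sub>R y)"
    using xy by (simp only: add[symmetric] smul[symmetric])
  then have "p (x - y) = p 0" using nrm by (metis add.right_inverse diff_conv_add_uminus scaleR_minus1_left)
  then have 0: "p (x - y) = 0" by (simp add: seminorm_zero[OF seminorm])
  obtain K where "\<And>x. \<bar>g x\<bar> \<le> K * p x" using g by (auto simp: semi_dual_def)
  from this[of "x - y"] 0 have "g (x - y) = 0" by simp
  then show ?thesis using g by (simp add: semi_dual_def linear_diff)
qed

definition descend :: "('v \<Rightarrow> real) \<Rightarrow> 'c \<Rightarrow> real" where
  "descend g = (\<lambda>c\<in>car V. g (SOME x. \<pi> x = c))"

lemma descend_apply: "g \<in> semi_dual p \<Longrightarrow> descend g (\<pi> x) = g x"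
  unfolding descend_def car by (auto intro!: semi_dual_factors someI[of "\<lambda>y. \<pi> y = \<pi> x"])

abbreviation "V' \<equiv> dual_nspace V"

lemma pullback_in_semi_dual: "f \<in> car V' \<Longrightarrow> (\<lambda>x. f (\<pi> x)) \<in> semi_dual p"
  by (auto simp: dual_nspace_def semi_dual_def car nrm[symmetric] add[symmetric] smul[symmetric] intro!: linearI)

lemma descend_in_dual: "g \<in> semi_dual p \<Longrightarrow> descend g \<in> car V'"
proof -
  assume g: "g \<in> semi_dual p"
  then obtain K where K: "\<And>x. \<bar>g x\<bar> \<le> K * p x" and lin: "linear g" by (auto simp: semi_dual_def)
  have ext: "descend g \<in> extensional (car V)" by (simp add: descend_def)
  show ?thesis
    unfolding dual_nspace_def using ext K
    by (auto simp: car add smul nrm descend_apply[OF g] linear_add[OF lin] linear_scale[OF lin])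
qed

lemma descend_pullback: "f \<in> car V' \<Longrightarrow> descend (\<lambda>x. f (\<pi> x)) = f"
proof
  fix c assume f: "f \<in> car V'"
  show "descend (\<lambda>x. f (\<pi> x)) c = f c"
  proof (cases "c \<in> car V")
    case True
    then obtain x where "c = \<pi> x" using car by auto
    then show ?thesis using descend_apply[OF pullback_in_semi_dual[OF f]] by simp
  next
    case False
    then show ?thesis using f by (auto simp: descend_def dual_nspace_def extensional_def)
  qed
qed

lemma descend_bdd:
  assumes "g \<in> semi_dual p"
  shows "bdd_above ((\<lambda>c. \<bar>descend g c\<bar>) ` {c \<in> car V. nrm V c \<le> 1})"
proof -
  obtain K where K: "0 \<le> K" "\<And>x. \<bar>g x\<bar> \<le> K * p x" using semi_dual_bound[OF seminorm assms] by blast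
  show ?thesis
  proof (rule bdd_aboveI2)
    fix c assume "c \<in> {c \<in> car V. nrm V c \<le> 1}"
    then obtain x where x: "c = \<pi> x" "p x \<le> 1" by (auto simp: car nrm)
    have "\<bar>g x\<bar> \<le> K * 1" using K(2)[of x] mult_left_mono[OF x(2) K(1)] by linarith
    then show "\<bar>descend g c\<bar> \<le> K" by (simp add: x descend_apply[OF assms])
  qed
qed

lemma dual_nrm: "nrm V' f = (SUP c \<in> {c \<in> car V. nrm V c \<le> 1}. \<bar>f c\<bar>)"
  by (simp add: dual_nspace_def)

lemma zero_in_ball: "\<pi> 0 \<in> {c \<in> car V. nrm V c \<le> 1}"
  by (auto simp: car nrm seminorm_zero[OF seminorm])

lemma descend_nrm_le:
  assumes g: "g \<in> semi_dual p" and L: "0 \<le> L" "\<And>x. \<bar>g x\<bar> \<le> L * p x"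
  shows "nrm V' (descend g) \<le> L"
  unfolding dual_nrm
proof (rule cSUP_least)
  show "{c \<in> car V. nrm V c \<le> 1} \<noteq> {}" using zero_in_ball by blast
  fix c assume "c \<in> {c \<in> car V. nrm V c \<le> 1}"
  then obtain x where x: "c = \<pi> x" "p x \<le> 1" by (auto simp: car nrm)
  have "\<bar>g x\<bar> \<le> L * 1" using L(2)[of x] mult_left_mono[OF x(2) L(1)] by linarith
  then show "\<bar>descend g c\<bar> \<le> L" by (simp add: x descend_apply[OF g])
qed

lemma descend_nrm_bound:
  assumes g: "g \<in> semi_dual p"
  shows "0 \<le> nrm V' (descend g)" "\<bar>g x\<bar> \<le> nrm V' (descend g) * p x"
proof -
  have up: "\<bar>g y\<bar> \<le> nrm V' (descend g)" if "p y \<le> 1" for y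
  proof -
    have "\<bar>descend g (\<pi> y)\<bar> \<le> nrm V' (descend g)"
      unfolding dual_nrm by (rule cSUP_upper[OF _ descend_bdd[OF g]]) (use that in \<open>auto simp: car nrm\<close>)
    then show ?thesis by (simp add: descend_apply[OF g])
  qed
  show "0 \<le> nrm V' (descend g)" using up[of 0] by (simp add: seminorm_zero[OF seminorm])
  have lin: "linear g" using g by (simp add: semi_dual_def)
  show "\<bar>g x\<bar> \<le> nrm V' (descend g) * p x"
  proof (cases "p x = 0")
    case True
    obtain K where "\<And>x. \<bar>g x\<bar> \<le> K * p x" using g by (auto simp: semi_dual_def)
    from this[of x] True show ?thesis by simp
  next
    case False
    then have px: "0 < p x" using seminorm_nonneg[OF seminorm, of x] by simp
    have "\<bar>g (inverse (p x) *\<^sub>R x)\<bar> \<le> nrm V' (descend g)"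
      using px by (intro up) (simp add: seminorm_scaleR[OF seminorm])
    then show ?thesis using px by (simp add: linear_scale[OF lin] abs_mult field_simps)
  qed
qed

lemma descend_add:
  "g \<in> semi_dual p \<Longrightarrow> h \<in> semi_dual p \<Longrightarrow> descend (\<lambda>x. g x + h x) = add V' (descend g) (descend h)"
  by (auto simp: dual_nspace_def descend_def)

lemma descend_scale: "g \<in> semi_dual p \<Longrightarrow> descend (\<lambda>x. c * g x) = smul V' c (descend g)"
  by (auto simp: dual_nspace_def descend_def)

lemma dual_nspace_car_iff:
  "F \<in> car (dual_nspace V') \<longleftrightarrow> F \<in> extensional (car V') \<and>
     (\<forall>f\<in>car V'. \<forall>g\<in>car V'. F (add V' f g) = F f + F g) \<and>
     (\<forall>c. \<forall>f\<in>car V'. F (smul V' c f) = c * F f) \<and> (\<exists>K. \<forall>f\<in>car V'. \<bar>F f\<bar> \<le> K * nrm V' f)"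
  by (simp add: dual_nspace_def[of V'])

lemma dual_pullback_nrm:
  assumes "f \<in> car V'"
  shows "0 \<le> nrm V' f" "\<bar>f (\<pi> x)\<bar> \<le> nrm V' f * p x"
  using descend_nrm_bound[OF pullback_in_semi_dual[OF assms]] by (simp_all add: descend_pullback[OF assms])

lemma dual_add_apply: "add V' f g (\<pi> x) = f (\<pi> x) + g (\<pi> x)"
  and dual_smul_apply: "smul V' c f (\<pi> x) = c * f (\<pi> x)"
  by (simp_all add: dual_nspace_def car)

lemma dual_add_closed: "f \<in> car V' \<Longrightarrow> g \<in> car V' \<Longrightarrow> add V' f g \<in> car V'"
  using descend_in_dual[OF semi_dual_add[OF seminorm pullback_in_semi_dual pullback_in_semi_dual], of f g]
  by (simp add: descend_add pullback_in_semi_dual descend_pullback)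

lemma dual_smul_closed: "f \<in> car V' \<Longrightarrow> smul V' c f \<in> car V'"
  using descend_in_dual[OF semi_dual_scale[OF pullback_in_semi_dual], of f c]
  by (simp add: descend_scale pullback_in_semi_dual descend_pullback)

lemma reflexive_iff: "reflexive_nspace V \<longleftrightarrow> semi_reflexive p"
proof
  assume R: "reflexive_nspace V"
  show "semi_reflexive p"
    unfolding semi_reflexive_def
  proof (intro allI ballI)
    fix K \<Phi> assume \<Phi>: "\<Phi> \<in> semi_bidual p K"
    define F where "F = (\<lambda>f\<in>car V'. \<Phi> (\<lambda>x. f (\<pi> x)))"
    have "F \<in> car (dual_nspace V')"
      unfolding dual_nspace_car_iff
    proof (intro conjI ballI allI exI[of _ K])
      show "F \<in> extensional (car V')" by (simp add: F_def)
      show "F (add V' f g) = F f + F g" if "f \<in> car V'" "g \<in> car V'" for f g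
        using that by (simp add: F_def dual_add_closed dual_add_apply semi_bidual_add[OF \<Phi>] pullback_in_semi_dual)
      show "F (smul V' c f) = c * F f" if "f \<in> car V'" for c f
        using that by (simp add: F_def dual_smul_closed dual_smul_apply semi_bidual_scale[OF \<Phi>] pullback_in_semi_dual)
      show "\<bar>F f\<bar> \<le> K * nrm V' f" if "f \<in> car V'" for f
        using that semi_bidual_bound[OF \<Phi> pullback_in_semi_dual[OF that] dual_pullback_nrm[OF that]]
        by (simp add: F_def)
    qed
    then obtain c where c: "c \<in> car V" "\<And>f. f \<in> car V' \<Longrightarrow> F f = f c"
      using R unfolding reflexive_nspace_def by blast
    then obtain x where x: "c = \<pi> x" using car by auto
    have "\<Phi> g = g x" if g: "g \<in> semi_dual p" for g
    proof -
      have "F (descend g) = \<Phi> (\<lambda>x. descend g (\<pi> x))" by (simp add: F_def descend_in_dual[OF g])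
      then show ?thesis using c(2)[OF descend_in_dual[OF g]] by (simp add: descend_apply[OF g] x)
    qed
    then show "\<exists>x. \<forall>f\<in>semi_dual p. \<Phi> f = f x" by blast
  qed
next
  assume R: "semi_reflexive p"
  show "reflexive_nspace V"
    unfolding reflexive_nspace_def
  proof
    fix F assume F: "F \<in> car (dual_nspace V')"
    then obtain K where K: "\<And>f. f \<in> car V' \<Longrightarrow> \<bar>F f\<bar> \<le> K * nrm V' f"
      unfolding dual_nspace_car_iff by blast
    have "(\<lambda>g. F (descend g)) \<in> semi_bidual p \<bar>K\<bar>"
      unfolding semi_bidual_def
    proof (intro CollectI conjI ballI allI impI)
      show "F (descend (\<lambda>x. f x + g x)) = F (descend f) + F (descend g)"
        if "f \<in> semi_dual p" "g \<in> semi_dual p" for f g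
        using F that by (simp add: dual_nspace_car_iff descend_add descend_in_dual)
      show "F (descend (\<lambda>x. c * f x)) = c * F (descend f)" if "f \<in> semi_dual p" for c f
        using F that by (simp add: dual_nspace_car_iff descend_scale descend_in_dual)
      show "\<bar>F (descend f)\<bar> \<le> \<bar>K\<bar> * L" if f: "f \<in> semi_dual p" "0 \<le> L" "\<forall>x. \<bar>f x\<bar> \<le> L * p x" for f L
      proof -
        have "\<bar>F (descend f)\<bar> \<le> K * nrm V' (descend f)" by (rule K[OF descend_in_dual[OF f(1)]])
        also have "\<dots> \<le> \<bar>K\<bar> * nrm V' (descend f)"
          by (rule mult_right_mono) (use descend_nrm_bound(1)[OF f(1)] in auto)
        also have "\<dots> \<le> \<bar>K\<bar> * L"
          by (rule mult_left_mono[OF descend_nrm_le]) (use f in auto)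
        finally show ?thesis .
      qed
    qed
    then have "\<exists>x. \<forall>g\<in>semi_dual p. F (descend g) = g x"
      by (rule R[unfolded semi_reflexive_def, rule_format])
    then obtain x where x: "\<And>g. g \<in> semi_dual p \<Longrightarrow> F (descend g) = g x" by blast
    have "F f = f (\<pi> x)" if "f \<in> car V'" for f
      using x[OF pullback_in_semi_dual[OF that]] by (simp add: descend_pullback[OF that])
    then show "\<exists>x\<in>car V. \<forall>f\<in>car V'. F f = f x" using car by blast
  qed
qed

end

lemma seminorm_norm: "seminorm (norm :: 'a::real_normed_vector \<Rightarrow> real)"
  by (auto simp: seminorm_def norm_triangle_ineq)

lemma reflexive_iff_semi_reflexive:
  "reflexive TYPE('a::real_normed_vector) \<longleftrightarrow> semi_reflexive (norm :: 'a \<Rightarrow> real)"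
proof -
  interpret nspace_presentation "nspace_of TYPE('a)" "\<lambda>x. x" norm
    by unfold_locales (simp_all add: seminorm_norm nspace_of_def)
  show ?thesis using reflexive_iff by (simp add: reflexive_nspace_of)
qed

instance bcontfun :: (metric_space, banach) banach ..

text \<open>
  Giving the index type the discrete topology makes all bounded families continuous, and thus the
  bounded families in a Banach space a Banach space for the supremum norm.
\<close>
definition coord :: "('i discrete \<Rightarrow>\<^sub>C 'a::real_normed_vector) \<Rightarrow> 'i \<Rightarrow> 'a" where
  "coord v i = apply_bcontfun v (discrete i)"

definition bounded_family :: "('i \<Rightarrow> 'a::real_normed_vector) \<Rightarrow> ('i discrete \<Rightarrow>\<^sub>C 'a)" where
  "bounded_family x = Bcontfun (\<lambda>d. x (of_discrete d))"

lemma coord_bounded_family: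
  assumes "bounded (range x)"
  shows "coord (bounded_family x) i = x i"
proof -
  have "(\<lambda>d. x (of_discrete d)) \<in> bcontfun"
    using assms unfolding bcontfun_def
    by (auto simp: continuous_on_open_vimage[OF open_discrete] intro: open_discrete bounded_subset[OF assms])
  then show ?thesis by (simp add: coord_def bounded_family_def Bcontfun_inverse discrete_inverse)
qed

lemma bounded_coord: "bounded (range (coord v))"
  using norm_bounded[of v] by (auto simp: bounded_iff coord_def)

lemma coord_simps:
  "coord (v + w) i = coord v i + coord w i" "coord (v - w) i = coord v i - coord w i"
  "coord (c *\<^sub>R v) i = c *\<^sub>R coord v i"
  by (simp_all add: coord_def)

lemma coord_sum: "coord (\<Sum>j\<in>J. v j) i = (\<Sum>j\<in>J. coord (v j) i)"
proof (induction J rule: infinite_finite_induct)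
qed (simp_all add: coord_simps, simp_all add: coord_def)

definition ultra_seminorm :: "'i filter \<Rightarrow> ('i discrete \<Rightarrow>\<^sub>C 'a::real_normed_vector) \<Rightarrow> real" where
  "ultra_seminorm U v = Lim U (\<lambda>i. norm (coord v i))"

context
  fixes U :: "'i filter"
  assumes U: "ultrafilter U"
begin

lemma ultra_seminorm_tendsto: "((\<lambda>i. norm (coord v i)) \<longlongrightarrow> ultra_seminorm U v) U"
  unfolding ultra_seminorm_def
  by (rule ultrafilter_bounded_tendsto[OF U]) (use bounded_coord[of v] in \<open>auto simp: bounded_iff\<close>)

lemma ultra_seminormI: "((\<lambda>i. norm (coord v i)) \<longlongrightarrow> l) U \<Longrightarrow> ultra_seminorm U v = l"
  by (rule tendsto_unique[OF ultrafilter_not_bot[OF U] ultra_seminorm_tendsto])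

lemma ultra_seminorm_le:
  "\<forall>\<^sub>F i in U. norm (coord v i) \<le> b \<Longrightarrow> ultra_seminorm U v \<le> b"
  by (rule tendsto_upperbound[OF ultra_seminorm_tendsto _ ultrafilter_not_bot[OF U]])

lemma ultra_seminorm_ge:
  "\<forall>\<^sub>F i in U. b \<le> norm (coord v i) \<Longrightarrow> b \<le> ultra_seminorm U v"
  by (rule tendsto_lowerbound[OF ultra_seminorm_tendsto _ ultrafilter_not_bot[OF U]])

lemma seminorm_ultra_seminorm: "seminorm (ultra_seminorm U)"
  unfolding seminorm_def
proof (intro conjI allI)
  show "0 \<le> ultra_seminorm U v" for v by (rule ultra_seminorm_ge) simp
  show "ultra_seminorm U (c *\<^sub>R v) = \<bar>c\<bar> * ultra_seminorm U v" for c v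
    by (rule ultra_seminormI) (simp add: coord_simps tendsto_mult_left ultra_seminorm_tendsto)
  show "ultra_seminorm U (v + w) \<le> ultra_seminorm U v + ultra_seminorm U w" for v w
    by (rule tendsto_le[OF ultrafilter_not_bot[OF U] tendsto_add[OF ultra_seminorm_tendsto ultra_seminorm_tendsto]
          ultra_seminorm_tendsto]) (simp add: coord_simps norm_triangle_ineq)
qed

text \<open>
  A family whose norms converge to a limit less than \<open>e\<close> may be set to \<open>0\<close> wherever its norm exceeds \<open>e\<close>:
  the set of these indices is negligible.
\<close>
lemma quotient_seminorm_ultra_seminorm: "quotient_seminorm (ultra_seminorm U)"
  unfolding quotient_seminorm_def
proof (intro conjI allI impI seminorm_ultra_seminorm)
  show "ultra_seminorm U v \<le> norm v" for v
    by (rule ultra_seminorm_le) (simp add: coord_def norm_bounded)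
  fix v e assume e: "ultra_seminorm U v < e"
  define w where "w = bounded_family (\<lambda>i. if norm (coord v i) \<le> e then coord v i else 0)"
  have e0: "0 \<le> e" using e seminorm_nonneg[OF seminorm_ultra_seminorm, of v] by linarith
  have w: "coord w i = (if norm (coord v i) \<le> e then coord v i else 0)" for i
    unfolding w_def by (rule coord_bounded_family) (auto simp: bounded_iff e0 intro!: exI[of _ e])
  have "norm w \<le> e"
  proof (rule norm_bound)
    show "norm (apply_bcontfun w d) \<le> e" for d
      using w[of "of_discrete d"] e0 by (simp add: coord_def of_discrete_inverse split: if_splits)
  qed
  moreover have "\<forall>\<^sub>F i in U. norm (coord v i) < e" by (rule order_tendstoD(2)[OF ultra_seminorm_tendsto e])
  then have "\<forall>\<^sub>F i in U. norm (coord (v - w) i) \<le> 0" by eventually_elim (simp add: coord_simps w)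
  then have "ultra_seminorm U (v - w) \<le> 0" by (rule ultra_seminorm_le)
  then have "ultra_seminorm U (v - w) = 0"
    using seminorm_nonneg[OF seminorm_ultra_seminorm, of "v - w"] by linarith
  ultimately show "\<exists>w. ultra_seminorm U (v - w) = 0 \<and> norm w \<le> e" by blast
qed

lemma reflexive_ultrapower_iff:
  "reflexive_nspace (ultrapower TYPE('a::real_normed_vector) U) \<longleftrightarrow>
     semi_reflexive (ultra_seminorm U :: ('i discrete \<Rightarrow>\<^sub>C 'a) \<Rightarrow> real)"
proof -
  let ?\<pi> = "\<lambda>v :: 'i discrete \<Rightarrow>\<^sub>C 'a. ultrapower_rel U `` {coord v}"
  interpret nspace_presentation "ultrapower TYPE('a) U" ?\<pi> "ultra_seminorm U"
  proof
    show "car (ultrapower TYPE('a) U) = range ?\<pi>"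
    proof -
      have "{x :: 'i \<Rightarrow> 'a. bounded (range x)} = range coord"
      proof (intro equalityI subsetI)
        fix x :: "'i \<Rightarrow> 'a" assume "x \<in> {x. bounded (range x)}"
        then have "coord (bounded_family x) = x" by (intro ext coord_bounded_family) simp
        then show "x \<in> range coord" by (metis rangeI)
      qed (use bounded_coord in auto)
      then show ?thesis by (simp add: ultrapower_def quotient_def UNION_singleton_eq_range image_image)
    qed
    show "add (ultrapower TYPE('a) U) (?\<pi> x) (?\<pi> y) = ?\<pi> (x + y)" for x y
      unfolding ultrapower_add[OF bounded_coord bounded_coord] by (simp add: coord_simps[abs_def])
    show "smul (ultrapower TYPE('a) U) c (?\<pi> x) = ?\<pi> (c *\<^sub>R x)" for c x
      unfolding ultrapower_smul[OF bounded_coord] by (simp add: coord_simps[abs_def])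
    show "nrm (ultrapower TYPE('a) U) (?\<pi> x) = ultra_seminorm U x" for x
      by (simp add: ultrapower_nrm[OF U bounded_coord] ultra_seminorm_def)
  qed (rule seminorm_ultra_seminorm)
  show ?thesis by (rule reflexive_iff)
qed

text \<open>
  A family of seminorm at most \<open>1\<close> may have coordinates of norm larger than \<open>1\<close>, where a map on the
  unit ball gives no information. Clipping moves these coordinates into the ball and changes the family
  by a family of seminorm \<open>0\<close>.
\<close>
definition clip :: "'a::real_normed_vector \<Rightarrow> 'a" where "clip x = (1 / max 1 (norm x)) *\<^sub>R x"

lemma norm_clip: "norm (clip x) \<le> 1"
  by (auto simp: clip_def max_def field_simps)

lemma norm_clip_diff: "norm (clip x - x) = max 0 (norm x - 1)"
proof (cases "norm x \<le> 1")
  case True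
  then show ?thesis by (simp add: clip_def max_def)
next
  case False
  then have "clip x - x = - ((1 - 1 / norm x) *\<^sub>R x)" by (simp add: clip_def max_def algebra_simps)
  then have "norm (clip x - x) = \<bar>1 - 1 / norm x\<bar> * norm x" by simp
  also have "\<dots> = (1 - 1 / norm x) * norm x" using False by (simp add: field_simps)
  also have "(1 - 1 / norm x) * norm x = norm x - 1"
    using False by (cases "x = 0") (simp_all add: left_diff_distrib)
  finally show ?thesis using False by simp
qed

lemma clip_tendsto:
  assumes v: "ultra_seminorm U v \<le> 1" and w: "ultra_seminorm U w \<le> 1"
  shows "((\<lambda>i. norm (clip (coord v i) - clip (coord w i))) \<longlongrightarrow> ultra_seminorm U (v - w)) U"
proof -
  have lim0: "((\<lambda>i. norm (clip (coord v i) - coord v i)) \<longlongrightarrow> 0) U" if "ultra_seminorm U v \<le> 1" for v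
  proof -
    have "((\<lambda>i. max 0 (norm (coord v i) - 1)) \<longlongrightarrow> max 0 (ultra_seminorm U v - 1)) U"
      by (intro tendsto_intros ultra_seminorm_tendsto)
    then show ?thesis using that by (simp add: norm_clip_diff)
  qed
  have "((\<lambda>i. norm (clip (coord v i) - clip (coord w i)) - norm (coord (v - w) i)) \<longlongrightarrow> 0) U"
  proof (rule Lim_null_comparison)
    show "((\<lambda>i. norm (clip (coord v i) - coord v i) + norm (clip (coord w i) - coord w i)) \<longlongrightarrow> 0) U"
      using tendsto_add[OF lim0[OF v] lim0[OF w]] by simp
    show "\<forall>\<^sub>F i in U. norm (norm (clip (coord v i) - clip (coord w i)) - norm (coord (v - w) i)) \<le>
        norm (clip (coord v i) - coord v i) + norm (clip (coord w i) - coord w i)"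
    proof (intro always_eventually allI)
      fix i
      let ?a = "clip (coord v i)" and ?b = "clip (coord w i)"
      have "\<bar>norm (?a - ?b) - norm (coord v i - coord w i)\<bar> \<le> norm ((?a - ?b) - (coord v i - coord w i))"
        by (rule norm_triangle_ineq3)
      also have "(?a - ?b) - (coord v i - coord w i) = (?a - coord v i) - (?b - coord w i)" by simp
      also have "norm \<dots> \<le> norm (?a - coord v i) + norm (?b - coord w i)" by (rule norm_triangle_ineq4)
      finally show "norm (norm (?a - ?b) - norm (coord (v - w) i)) \<le> norm (?a - coord v i) + norm (?b - coord w i)"
        by (simp add: coord_simps)
    qed
  qed
  from tendsto_add[OF this ultra_seminorm_tendsto[of "v - w"]] show ?thesis by simp
qed

lemma ball_separating_ultrapower:
  fixes \<phi> :: "'a::real_normed_vector \<Rightarrow> 'b::real_normed_vector"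
  assumes "ball_separating norm norm \<phi>"
  shows "ball_separating (ultra_seminorm U) (ultra_seminorm U) (\<lambda>v. bounded_family (\<lambda>i. \<phi> (clip (coord v i))))"
proof -
  obtain t \<delta> \<eta> \<omega> B where t: "0 < t" "t < 1" and pos: "0 < \<delta>" "0 < \<eta>" "0 < \<omega>"
    and B: "\<And>x. norm x \<le> 1 \<Longrightarrow> norm (\<phi> x) \<le> B"
    and near: "\<And>x y. norm x \<le> 1 \<Longrightarrow> norm y \<le> 1 \<Longrightarrow> norm (x - y) < \<delta> \<Longrightarrow> norm (\<phi> x - \<phi> y) \<le> \<omega>"
    and sep: "\<And>x y. norm x \<le> 1 \<Longrightarrow> norm y \<le> 1 \<Longrightarrow> \<bar>norm (x - y) - t\<bar> < \<eta> \<Longrightarrow> 3 * \<omega> \<le> norm (\<phi> x - \<phi> y)"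
    using assms unfolding ball_separating_def by metis
  let ?\<Phi> = "\<lambda>v. bounded_family (\<lambda>i. \<phi> (clip (coord v i)))"
  have \<Phi>: "coord (?\<Phi> v) i = \<phi> (clip (coord v i))" for v i
    by (rule coord_bounded_family) (auto simp: bounded_iff intro!: exI[of _ B] B norm_clip)
  have "ultra_seminorm U (?\<Phi> v) \<le> B" for v
    by (rule ultra_seminorm_le) (simp add: \<Phi> B norm_clip)
  moreover have "ultra_seminorm U (?\<Phi> v - ?\<Phi> w) \<le> \<omega>"
    if "ultra_seminorm U v \<le> 1" "ultra_seminorm U w \<le> 1" "ultra_seminorm U (v - w) < \<delta>" for v w
  proof (rule ultra_seminorm_le)
    from order_tendstoD(2)[OF clip_tendsto[OF that(1,2)] that(3)]
    show "\<forall>\<^sub>F i in U. norm (coord (?\<Phi> v - ?\<Phi> w) i) \<le> \<omega>"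
      by eventually_elim (simp add: coord_simps \<Phi> near norm_clip)
  qed
  moreover have "3 * \<omega> \<le> ultra_seminorm U (?\<Phi> v - ?\<Phi> w)"
    if "ultra_seminorm U v \<le> 1" "ultra_seminorm U w \<le> 1" "\<bar>ultra_seminorm U (v - w) - t\<bar> < \<eta>" for v w
  proof (rule ultra_seminorm_ge)
    have "((\<lambda>i. \<bar>norm (clip (coord v i) - clip (coord w i)) - t\<bar>) \<longlongrightarrow> \<bar>ultra_seminorm U (v - w) - t\<bar>) U"
      by (intro tendsto_intros clip_tendsto that)
    from order_tendstoD(2)[OF this that(3)]
    show "\<forall>\<^sub>F i in U. 3 * \<omega> \<le> norm (coord (?\<Phi> v - ?\<Phi> w) i)"
      by eventually_elim (simp add: coord_simps \<Phi> sep norm_clip)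
  qed
  ultimately show ?thesis
    unfolding ball_separating_def using t pos
    by (intro exI[of _ t] exI[of _ \<delta>] exI[of _ \<eta>] exI[of _ \<omega>] exI[of _ B]) simp
qed

end

section \<open>Coarse solvent and uniformly continuous maps\<close>
lemma coarse_on_UNIV_bound:
  assumes "coarse_on UNIV f" "0 \<le> t"
  shows "\<exists>M\<ge>0. \<forall>x y. dist x y \<le> t \<longrightarrow> dist (f x) (f y) \<le> M"
proof -
  define M where "M = enn2real (expansion_modulus UNIV f t)"
  have fin: "expansion_modulus UNIV f t < \<infinity>" using assms by (simp add: coarse_on_def)
  have "dist (f x) (f y) \<le> M" if "dist x y \<le> t" for x y
  proof -
    have "ennreal (dist (f x) (f y)) \<le> expansion_modulus UNIV f t"
      unfolding expansion_modulus_def by (rule SUP_upper2[of "(x, y)"]) (use that in auto)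
    also have "\<dots> = ennreal M" using fin by (simp add: M_def less_top[symmetric])
    finally show ?thesis by (simp add: M_def)
  qed
  then show ?thesis by (intro exI[of _ M]) (simp add: M_def)
qed

text \<open>
  Points at distance at most \<open>1\<close> are moved at most \<open>M\<close> apart, and those at a distance in \<open>[R, R + 1]\<close>
  at least \<open>3 (M + 1)\<close> apart if solvency is applied to \<open>n \<ge> 3 (M + 1)\<close>. Rescaling by \<open>2 R + 1\<close> turns the
  midpoint of this interval into \<open>t = 1/2\<close>.
\<close>
lemma ball_separating_of_coarse_solvent:
  fixes f :: "'a::real_normed_vector \<Rightarrow> 'b::real_normed_vector"
  assumes f: "coarse_on UNIV f" "solvent_on UNIV f"
  obtains \<phi> :: "'a \<Rightarrow> 'b" where "ball_separating norm norm \<phi>"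
proof -
  obtain M where M: "0 \<le> M" "\<And>x y. dist x y \<le> 1 \<Longrightarrow> dist (f x) (f y) \<le> M"
    using coarse_on_UNIV_bound[OF f(1), of 1] by auto
  define \<omega> where "\<omega> = M + 1"
  obtain n :: nat where n: "3 * \<omega> \<le> real n" using real_arch_simple by blast
  have n1: "1 \<le> real n" using n M by (simp add: \<omega>_def)
  obtain R where R: "0 < R" "\<And>x y. dist x y \<in> {R..R + real n} \<Longrightarrow> real n < dist (f x) (f y)"
    using f(2) unfolding solvent_on_def by blast
  define r where "r = 2 * R + 1"
  have r: "0 < r" using R by (simp add: r_def)
  obtain M' where M': "\<And>x y. dist x y \<le> r \<Longrightarrow> dist (f x) (f y) \<le> M'"
    using coarse_on_UNIV_bound[OF f(1), of r] r by auto
  have scale: "dist (r *\<^sub>R x) (r *\<^sub>R y) = r * norm (x - y)" for x y :: 'a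
    using r by (simp add: dist_norm flip: scaleR_diff_right)
  have "ball_separating norm norm (\<lambda>x. f (r *\<^sub>R x))"
    unfolding ball_separating_def
  proof (intro exI conjI allI impI)
    show "(0::real) < 1 / 2" "(1::real) / 2 < 1" "0 < 1 / r" "0 < 1 / (2 * r)" "0 < \<omega>"
      using r M by (simp_all add: \<omega>_def)
    fix x y :: 'a
    show "norm (f (r *\<^sub>R x)) \<le> M' + norm (f 0)" if "norm x \<le> 1"
    proof -
      have "dist (f (r *\<^sub>R x)) (f 0) \<le> M'"
        by (rule M') (use that r in \<open>simp add: mult_left_le\<close>)
      then show ?thesis using norm_triangle_ineq2[of "f (r *\<^sub>R x)" "f 0"] by (simp add: dist_norm)
    qed
    show "norm (f (r *\<^sub>R x) - f (r *\<^sub>R y)) \<le> \<omega>" if "norm (x - y) < 1 / r"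
    proof -
      have "r * norm (x - y) < r * (1 / r)" using that r by (rule mult_strict_left_mono)
      then have "dist (f (r *\<^sub>R x)) (f (r *\<^sub>R y)) \<le> M" using r by (intro M(2)) (simp add: scale)
      then show ?thesis by (simp add: dist_norm \<omega>_def)
    qed
    show "3 * \<omega> \<le> norm (f (r *\<^sub>R x) - f (r *\<^sub>R y))" if "\<bar>norm (x - y) - 1 / 2\<bar> < 1 / (2 * r)"
    proof -
      have "r * \<bar>norm (x - y) - 1 / 2\<bar> < r * (1 / (2 * r))" using that r by (rule mult_strict_left_mono)
      moreover have "r * \<bar>norm (x - y) - 1 / 2\<bar> = \<bar>r * norm (x - y) - r / 2\<bar>"
        using r by (simp add: abs_mult_pos' right_diff_distrib)
      moreover have "r * (1 / (2 * r)) = 1 / 2" using r by simp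
      ultimately have "\<bar>r * norm (x - y) - r / 2\<bar> < 1 / 2" by (simp only:)
      then have "dist (r *\<^sub>R x) (r *\<^sub>R y) \<in> {R..R + real n}"
      proof -
        have "r / 2 = R + 1 / 2" by (simp add: r_def)
        moreover have "r * norm (x - y) - r / 2 < 1 / 2" "r / 2 - r * norm (x - y) < 1 / 2"
          using \<open>\<bar>r * norm (x - y) - r / 2\<bar> < 1 / 2\<close> by linarith+
        ultimately have "R \<le> r * norm (x - y)" "r * norm (x - y) \<le> R + real n" using n1 by linarith+
        then show ?thesis unfolding scale by simp
      qed
      from R(2)[OF this] n show ?thesis by (simp add: dist_norm)
    qed
  qed
  then show thesis by (rule that)
qed

text \<open>Every point of the ball is reached from \<open>0\<close> in the same number of short steps.\<close>
lemma uniformly_continuous_ball_bounded: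
  fixes \<phi> :: "'a::real_normed_vector \<Rightarrow> 'b::real_normed_vector"
  assumes uc: "uniformly_continuous_on (cball 0 1) \<phi>"
  obtains B where "\<And>x. norm x \<le> 1 \<Longrightarrow> norm (\<phi> x) \<le> B"
proof -
  obtain \<delta> where \<delta>: "0 < \<delta>"
    and d: "\<And>x y. norm x \<le> 1 \<Longrightarrow> norm y \<le> 1 \<Longrightarrow> dist x y < \<delta> \<Longrightarrow> dist (\<phi> x) (\<phi> y) < 1"
    using uc[unfolded uniformly_continuous_on_def, rule_format, of 1] by auto
  obtain n :: nat where n: "0 < n" "1 / real n < \<delta>" using \<delta> by (metis nat_approx_posE zero_less_Suc)
  have "norm (\<phi> x) \<le> norm (\<phi> 0) + real n" if x: "norm x \<le> 1" for x
  proof -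
    have "norm (\<phi> ((real j / real n) *\<^sub>R x)) \<le> norm (\<phi> 0) + real j" if "j \<le> n" for j
      using that
    proof (induction j)
      case (Suc j)
      have le1: "norm ((real i / real n) *\<^sub>R x) \<le> 1" if "i \<le> n" for i
      proof -
        have "(real i / real n) * norm x \<le> 1 * 1" using x n that by (intro mult_mono) auto
        then show ?thesis by simp
      qed
      have "dist ((real (Suc j) / real n) *\<^sub>R x) ((real j / real n) *\<^sub>R x) = (1 / real n) * norm x"
        by (simp add: dist_norm add_divide_distrib flip: scaleR_diff_left)
      also have "\<dots> \<le> (1 / real n) * 1" by (rule mult_left_mono[OF x]) simp
      finally have "dist (\<phi> ((real (Suc j) / real n) *\<^sub>R x)) (\<phi> ((real j / real n) *\<^sub>R x)) < 1"
        using Suc.prems n by (intro d le1) auto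
      then show ?case
        using Suc norm_triangle_ineq2[of "\<phi> ((real (Suc j) / real n) *\<^sub>R x)" "\<phi> ((real j / real n) *\<^sub>R x)"]
        by (simp add: dist_norm)
    qed simp
    from this[of n] n show ?thesis by simp
  qed
  then show thesis by (rule that)
qed

text \<open>
  The hypothesis concerns the exact distance \<open>t\<close>. If the distance of \<open>x\<close> and \<open>y\<close> is only close to \<open>t\<close>,
  then a point \<open>z\<close> at distance exactly \<open>t\<close> from \<open>x\<close> on the ray through \<open>y\<close> is close to \<open>y\<close>, and uniform
  continuity applies to \<open>y\<close> and \<open>z\<close>. Restricting \<open>f\<close> to a ball of radius \<open>r\<close> with \<open>t < r < 1\<close> makes room
  for \<open>z\<close>.
\<close>
lemma ball_separating_of_uniformly_continuous:
  fixes f :: "'a::real_normed_vector \<Rightarrow> 'b::real_normed_vector"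
  assumes uc: "uniformly_continuous_on (cball 0 1) f" and t: "0 < t" "t < 1"
    and comp: "exact_compression_modulus (cball 0 1) f t > 0"
  obtains \<phi> :: "'a \<Rightarrow> 'b" where "ball_separating norm norm \<phi>"
proof -
  obtain \<rho>' where \<rho>': "0 < \<rho>'" "\<rho>' < exact_compression_modulus (cball 0 1) f t" using comp dense by blast
  define \<rho> where "\<rho> = enn2real \<rho>'"
  have \<rho>'fin: "\<rho>' < \<infinity>" using \<rho>'(2) by (metis infinity_ennreal_def less_top_ennreal order.strict_trans2 top_greatest)
  then have \<rho>: "0 < \<rho>" using \<rho>'(1) by (simp add: \<rho>_def enn2real_positive_iff)
  have far: "\<rho> \<le> dist (f x) (f y)" if "norm x \<le> 1" "norm y \<le> 1" "dist x y = t" for x y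
  proof -
    have "exact_compression_modulus (cball 0 1) f t \<le> ennreal (dist (f x) (f y))"
      unfolding exact_compression_modulus_def by (rule INF_lower2[of "(x, y)"]) (use that in auto)
    then have "\<rho>' \<le> ennreal (dist (f x) (f y))" using \<rho>'(2) by simp
    moreover have "\<rho>' = ennreal \<rho>" using \<rho>'fin by (simp add: \<rho>_def less_top[symmetric])
    ultimately show ?thesis by simp
  qed
  obtain \<delta> where \<delta>: "0 < \<delta>"
    and d: "\<And>x y. norm x \<le> 1 \<Longrightarrow> norm y \<le> 1 \<Longrightarrow> dist x y < \<delta> \<Longrightarrow> dist (f x) (f y) < \<rho> / 4"
    using uc[unfolded uniformly_continuous_on_def, rule_format, of "\<rho> / 4"] \<rho> by auto
  obtain B where B: "\<And>x. norm x \<le> 1 \<Longrightarrow> norm (f x) \<le> B"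
    using uniformly_continuous_ball_bounded[OF uc] by blast
  define r where "r = (1 + t) / 2"
  have r: "0 < r" "t < r" "r < 1" using t by (auto simp: r_def)
  \<comment> \<open>the bounds by \<open>1 - r\<close> and \<open>t\<close> keep \<open>z\<close> below in the unit ball and \<open>x\<close> and \<open>y\<close> apart\<close>
  define \<eta> where "\<eta> = min \<delta> (min (1 - r) t)"
  have \<eta>: "0 < \<eta>" "\<eta> \<le> \<delta>" "\<eta> \<le> 1 - r" "\<eta> \<le> t" using \<delta> r t by (auto simp: \<eta>_def)
  have scale: "norm (r *\<^sub>R x - r *\<^sub>R y) = r * norm (x - y)" for x y :: 'a
    using r by (simp flip: scaleR_diff_right)
  have ball: "norm (r *\<^sub>R x) \<le> r" if "norm x \<le> 1" for x :: 'a
    using that r by (simp add: mult_left_le)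
  have sep: "3 * (\<rho> / 4) \<le> dist (f x) (f y)"
    if x: "norm x \<le> r" and y: "norm y \<le> r" and xy: "\<bar>norm (y - x) - t\<bar> < \<eta>" for x y
  proof -
    define s where "s = norm (y - x)"
    have s: "0 < s" "\<bar>s - t\<bar> < \<eta>" using xy \<eta>(4) by (auto simp: s_def)
    define z where "z = x + (t / s) *\<^sub>R (y - x)"
    have "dist x z = t" using s t by (simp add: dist_norm z_def s_def)
    moreover have zy: "dist z y = \<bar>s - t\<bar>"
    proof -
      have "z - y = ((t / s) - 1) *\<^sub>R (y - x)" by (simp add: z_def algebra_simps)
      then have "dist z y = \<bar>t / s - 1\<bar> * s" by (simp add: dist_norm s_def)
      also have "\<dots> = \<bar>(t / s - 1) * s\<bar>" using s by (simp add: abs_mult)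
      also have "(t / s - 1) * s = t - s" using s by (simp add: field_simps)
      finally show ?thesis by (simp add: abs_minus_commute)
    qed
    moreover have "norm z \<le> 1"
      using norm_triangle_ineq2[of z y] zy s(2) y \<eta>(3) by (simp add: dist_norm)
    ultimately have "\<rho> \<le> dist (f x) (f z)" "dist (f z) (f y) < \<rho> / 4"
      using far[of x z] d[of z y] x y r s(2) \<eta>(2) by auto
    then show ?thesis using dist_triangle[of "f x" "f z" "f y"] by (simp add: dist_commute)
  qed
  have "ball_separating norm norm (\<lambda>x. f (r *\<^sub>R x))"
    unfolding ball_separating_def
  proof (intro exI conjI allI impI)
    show "0 < t / r" "t / r < 1" "0 < \<delta>" "0 < \<eta>" "0 < \<rho> / 4" using t r \<delta> \<eta> \<rho> by simp_all
    fix x y :: 'a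
    show "norm (f (r *\<^sub>R x)) \<le> B" if "norm x \<le> 1" by (rule B, rule order_trans[OF ball[OF that]]) (use r in simp)
    show "norm (f (r *\<^sub>R x) - f (r *\<^sub>R y)) \<le> \<rho> / 4" if "norm x \<le> 1" "norm y \<le> 1" "norm (x - y) < \<delta>"
    proof -
      have "r * norm (x - y) \<le> norm (x - y)" using r by (intro mult_left_le_one_le) auto
      then have "dist (f (r *\<^sub>R x)) (f (r *\<^sub>R y)) < \<rho> / 4"
        using that(3) by (intro d order_trans[OF ball[OF that(1)]] order_trans[OF ball[OF that(2)]])
          (use r in \<open>auto simp: dist_norm scale\<close>)
      then show ?thesis by (simp add: dist_norm)
    qed
    show "3 * (\<rho> / 4) \<le> norm (f (r *\<^sub>R x) - f (r *\<^sub>R y))"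
      if "norm x \<le> 1" "norm y \<le> 1" "\<bar>norm (x - y) - t / r\<bar> < \<eta>"
    proof -
      have "\<bar>norm (r *\<^sub>R y - r *\<^sub>R x) - t\<bar> = r * \<bar>norm (x - y) - t / r\<bar>"
        using r by (simp add: scale norm_minus_commute[of y] abs_mult_pos' right_diff_distrib)
      also have "\<dots> \<le> 1 * \<bar>norm (x - y) - t / r\<bar>" using r by (intro mult_right_mono) auto
      finally show ?thesis
        using sep[OF ball[OF that(1)] ball[OF that(2)]] that(3) by (simp add: dist_norm)
    qed
  qed
  then show thesis by (rule that)
qed

section \<open>Type\<close>

text \<open>
  An \<open>\<ell>\<^sub>1\<close>-spreading model provides \<open>k\<close> vectors, bounded independently of \<open>k\<close>, for which all
  \<open>2 ^ k\<close> signed sums have seminorm at least \<open>k c / 2\<close>. As there are only finitely many sums, some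
  coordinate \<open>i\<close> has the same properties, up to a small change of the constants. Type \<open>s\<close> now gives
  \<open>(k c / 2)\<^sup>s \<le> const * k\<close>, which fails for large \<open>k\<close> since \<open>s > 1\<close>.
\<close>
lemma type_excludes_l1_ultrapower:
  fixes U :: "'i filter"
  assumes U: "ultrafilter U" and s: "1 < s" "has_type TYPE('a::real_normed_vector) s"
  shows "\<not> semi_l1_spreading_model (ultra_seminorm U :: ('i discrete \<Rightarrow>\<^sub>C 'a) \<Rightarrow> real)"
proof
  let ?p = "ultra_seminorm U :: ('i discrete \<Rightarrow>\<^sub>C 'a) \<Rightarrow> real"
  assume "semi_l1_spreading_model ?p"
  then obtain z :: "nat \<Rightarrow> ('i discrete \<Rightarrow>\<^sub>C 'a)" and N :: "(nat \<Rightarrow>\<^sub>0 real) \<Rightarrow> real" and e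
    where z: "semi_generates_spreading_model ?p z N e" and eq: "equivalent_to_l1_basis N e"
    unfolding semi_l1_spreading_model_def by blast
  note ex = z[unfolded semi_generates_spreading_model_def, THEN conjunct1]
    and gen = z[unfolded semi_generates_spreading_model_def, THEN conjunct2]
  obtain B where B: "\<And>n. ?p (z n) \<le> B" using ex by blast
  obtain c where c: "0 < c" "\<And>k a. c * (\<Sum>j<k. \<bar>a j\<bar>) \<le> N (\<Sum>j<k. a j *\<^sub>R e j)"
    using eq unfolding equivalent_to_l1_basis_def by blast
  have B0: "0 \<le> B" using B[of 0] seminorm_nonneg[OF seminorm_ultra_seminorm[OF U], of "z 0"] by simp
  obtain C where C: "0 < C"
    and type: "\<And>(n::nat) (x :: nat \<Rightarrow> 'a). measure_pmf.expectation (pmf_of_set ({..<n} \<rightarrow>\<^sub>E {-1, 1 :: real}))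
            (\<lambda>\<epsilon>. norm (\<Sum>j<n. \<epsilon> j *\<^sub>R x j) powr s) \<le> C powr s * (\<Sum>j<n. norm (x j) powr s)"
    using s(2) unfolding has_type_def by blast
  have main: "(real k * (c / 2)) powr s \<le> C powr s * (real k * (B + 1) powr s)" if k: "0 < k" for k :: nat
  proof -
    let ?E = "{..<k} \<rightarrow>\<^sub>E {-1, 1 :: real}"
    have E: "finite ?E" "?E \<noteq> {}" by (auto intro!: finite_PiE simp: PiE_eq_empty_iff)
    have "\<exists>m. \<forall>m'\<ge>m. \<bar>?p (\<Sum>j<k. \<epsilon> j *\<^sub>R z (m' + j)) - N (\<Sum>j<k. \<epsilon> j *\<^sub>R e j)\<bar> < real k * (c / 2)" for \<epsilon>
    proof -
      obtain m where m: "\<forall>n. strict_mono_on {..<k} n \<and> (\<forall>j<k. m \<le> n j) \<longrightarrow>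
          \<bar>?p (\<Sum>j<k. \<epsilon> j *\<^sub>R z (n j)) - N (\<Sum>j<k. \<epsilon> j *\<^sub>R e j)\<bar> < real k * (c / 2)"
        using gen[rule_format, of "real k * (c / 2)" k \<epsilon>] k c by auto
      have "\<bar>?p (\<Sum>j<k. \<epsilon> j *\<^sub>R z (m' + j)) - N (\<Sum>j<k. \<epsilon> j *\<^sub>R e j)\<bar> < real k * (c / 2)" if "m \<le> m'" for m'
        by (rule m[rule_format, of "\<lambda>j. m' + j"]) (use that in \<open>auto simp: strict_mono_on_def\<close>)
      then show ?thesis by blast
    qed
    then obtain M where M: "\<And>\<epsilon> m'. M \<epsilon> \<le> m' \<Longrightarrow>
        \<bar>?p (\<Sum>j<k. \<epsilon> j *\<^sub>R z (m' + j)) - N (\<Sum>j<k. \<epsilon> j *\<^sub>R e j)\<bar> < real k * (c / 2)" by metis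
    define m where "m = Max (M ` ?E)"
    have large: "real k * (c / 2) < ?p (\<Sum>j<k. \<epsilon> j *\<^sub>R z (m + j))" if \<epsilon>: "\<epsilon> \<in> ?E" for \<epsilon>
    proof -
      have "M \<epsilon> \<le> m" unfolding m_def using E \<epsilon> by (intro Max_ge) auto
      from M[OF this] have "N (\<Sum>j<k. \<epsilon> j *\<^sub>R e j) - real k * (c / 2) < ?p (\<Sum>j<k. \<epsilon> j *\<^sub>R z (m + j))"
        by linarith
      moreover have "\<bar>\<epsilon> j\<bar> = 1" if "j < k" for j using PiE_mem[OF \<epsilon>, of j] that by auto
      then have "(\<Sum>j<k. \<bar>\<epsilon> j\<bar>) = real k" by simp
      then have "c * real k \<le> N (\<Sum>j<k. \<epsilon> j *\<^sub>R e j)" using c(2)[where k = k and a = \<epsilon>] by simp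
      ultimately show ?thesis by (simp add: field_simps)
    qed
    have "\<forall>\<^sub>F i in U. \<forall>\<epsilon>\<in>?E. real k * (c / 2) < norm (coord (\<Sum>j<k. \<epsilon> j *\<^sub>R z (m + j)) i)"
      by (intro eventually_ball_finite E(1) ballI order_tendstoD(1)[OF ultra_seminorm_tendsto[OF U]] large)
    moreover have "\<forall>\<^sub>F i in U. \<forall>j\<in>{..<k}. norm (coord (z (m + j)) i) < B + 1"
      by (intro eventually_ball_finite ballI order_tendstoD(2)[OF ultra_seminorm_tendsto[OF U]])
        (use B in \<open>auto intro: le_less_trans[of _ B]\<close>)
    ultimately have "\<forall>\<^sub>F i in U. (\<forall>\<epsilon>\<in>?E. real k * (c / 2) < norm (coord (\<Sum>j<k. \<epsilon> j *\<^sub>R z (m + j)) i)) \<and>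
        (\<forall>j\<in>{..<k}. norm (coord (z (m + j)) i) < B + 1)"
      by (rule eventually_conj)
    from eventually_happens'[OF ultrafilter_not_bot[OF U] this]
    obtain i where i: "\<And>\<epsilon>. \<epsilon> \<in> ?E \<Longrightarrow> real k * (c / 2) < norm (coord (\<Sum>j<k. \<epsilon> j *\<^sub>R z (m + j)) i)"
      "\<And>j. j < k \<Longrightarrow> norm (coord (z (m + j)) i) < B + 1" by auto
    define x where "x j = coord (z (m + j)) i" for j
    let ?f = "\<lambda>\<epsilon>. norm (\<Sum>j<k. \<epsilon> j *\<^sub>R x j) powr s"
    have "real (card ?E) * (real k * (c / 2)) powr s \<le> sum ?f ?E"
    proof (rule sum_bounded_below)
      fix \<epsilon> assume "\<epsilon> \<in> ?E"
      from i(1)[OF this] have "real k * (c / 2) \<le> norm (\<Sum>j<k. \<epsilon> j *\<^sub>R x j)"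
        by (simp add: coord_sum coord_simps x_def)
      then show "(real k * (c / 2)) powr s \<le> ?f \<epsilon>" using s c by (intro powr_mono2) auto
    qed
    then have "(real k * (c / 2)) powr s \<le> sum ?f ?E / real (card ?E)"
      using E by (simp add: field_simps card_gt_0_iff)
    also have "\<dots> = measure_pmf.expectation (pmf_of_set ?E) ?f"
      by (rule integral_pmf_of_set[OF E(2,1), symmetric])
    also have "\<dots> \<le> C powr s * (\<Sum>j<k. norm (x j) powr s)" by (rule type)
    also have "\<dots> \<le> C powr s * (\<Sum>j<k. (B + 1) powr s)"
      by (intro mult_left_mono sum_mono powr_mono2) (use s i(2) in \<open>auto simp: x_def less_imp_le\<close>)
    finally show ?thesis by simp
  qed
  define D where "D = C powr s * (B + 1) powr s / (c / 2) powr s"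
  have D0: "0 \<le> D" by (simp add: D_def)
  obtain k :: nat where "(D + 1) powr (1 / (s - 1)) < real k" using reals_Archimedean2 by blast
  moreover have "0 < real k" using calculation powr_ge_zero[of "D + 1" "1 / (s - 1)"] by linarith
  ultimately have k: "0 < k" "((D + 1) powr (1 / (s - 1))) powr (s - 1) < real k powr (s - 1)"
    using s(1) by (auto intro: powr_less_mono2)
  then have Dk: "D < real k powr (s - 1)" using D0 s(1) by (simp add: powr_powr)
  have "real k powr s * (c / 2) powr s \<le> real k * (C powr s * (B + 1) powr s)"
    using main[OF k(1)] c(1) powr_mult[of "real k" "c / 2" s] by (simp only: mult.left_commute)
  moreover have "real k powr s = real k * real k powr (s - 1)"
    using k(1) by (simp add: powr_diff)
  ultimately have "real k powr (s - 1) * (c / 2) powr s \<le> C powr s * (B + 1) powr s"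
    using k(1) by (simp add: mult.assoc)
  then have "real k powr (s - 1) \<le> D" using c(1) by (simp add: D_def pos_le_divide_eq)
  with Dk show False by simp
qed

theorem theorem4p2:
  assumes "(\<exists>f :: 'a::banach \<Rightarrow> 'b::banach. coarse_on UNIV f \<and> solvent_on UNIV f) \<or>
    (\<exists>\<phi> :: 'a \<Rightarrow> 'b. uniformly_continuous_on (cball 0 1) \<phi> \<and>
       (\<exists>t. 0 < t \<and> t < 1 \<and> exact_compression_modulus (cball 0 1) \<phi> t > 0))"
  shows "(reflexive TYPE('b) \<longrightarrow> reflexive TYPE('a) \<or> has_l1_spreading_model TYPE('a)) \<and>
    (super_reflexive TYPE('i) TYPE('b) \<longrightarrow> super_reflexive TYPE('i) TYPE('a) \<or> trivial_type TYPE('a))"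
proof -
  obtain \<phi> :: "'a \<Rightarrow> 'b" where \<phi>: "ball_separating norm norm \<phi>"
    using assms ball_separating_of_coarse_solvent ball_separating_of_uniformly_continuous by metis
  have "has_l1_spreading_model TYPE('a)" if "reflexive TYPE('b)" "\<not> reflexive TYPE('a)"
  proof -
    have "quotient_seminorm (norm :: 'a \<Rightarrow> real)"
      by (auto simp: quotient_seminorm_def seminorm_norm intro: exI[of _ "_ :: 'a"])
    then have "semi_l1_spreading_model (norm :: 'a \<Rightarrow> real)"
      using that \<phi> by (intro l1_spreading_model_of_ball_separating[where q = norm and \<phi> = \<phi>])
        (simp_all add: reflexive_iff_semi_reflexive seminorm_norm)
    then show ?thesis
      unfolding semi_l1_spreading_model_def has_l1_spreading_model_def generates_spreading_model_def
        semi_generates_spreading_model_def by (simp add: bounded_iff)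
  qed
  moreover have "trivial_type TYPE('a)"
    if Y: "super_reflexive TYPE('i) TYPE('b)" and X: "\<not> super_reflexive TYPE('i) TYPE('a)"
  proof -
    obtain U :: "'i filter" where U: "ultrafilter U" "\<not> reflexive_nspace (ultrapower TYPE('a) U)"
      using X unfolding super_reflexive_def by blast
    have "semi_l1_spreading_model (ultra_seminorm U :: ('i discrete \<Rightarrow>\<^sub>C 'a) \<Rightarrow> real)"
    proof (rule l1_spreading_model_of_ball_separating)
      show "\<not> semi_reflexive (ultra_seminorm U :: ('i discrete \<Rightarrow>\<^sub>C 'a) \<Rightarrow> real)"
        using U reflexive_ultrapower_iff by blast
      show "semi_reflexive (ultra_seminorm U :: ('i discrete \<Rightarrow>\<^sub>C 'b) \<Rightarrow> real)"
        using U(1) Y reflexive_ultrapower_iff unfolding super_reflexive_def by blast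
      show "ball_separating (ultra_seminorm U) (ultra_seminorm U)
          (\<lambda>v :: 'i discrete \<Rightarrow>\<^sub>C 'a. bounded_family (\<lambda>i. \<phi> (clip (coord v i))))"
        by (rule ball_separating_ultrapower[OF U(1) \<phi>])
    qed (simp_all add: quotient_seminorm_ultra_seminorm seminorm_ultra_seminorm U(1))
    then show ?thesis using type_excludes_l1_ultrapower[OF U(1)] unfolding trivial_type_def by blast
  qed
  ultimately show ?thesis by blast
qed

end
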